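(* Let $n\ge1$ and $1<p<2$. The origin $(0,0)$ is regular with respect to the domain $$\Theta=\{(x,t)\in\mathbf{R}^{n+1}:-1<t<0\text{ and }|x|^l<K(-t)\}$$ if $0<l<p$ and $K>1$ is arbitrary.
   Context: Points of $\mathbf{R}^{n+1}$ are written $(x,t)$ with $x\in\mathbf{R}^n$, $t\in\mathbf{R}$; $\nabla$ and $\operatorname{div}$ are taken with respect to $x$ only. The equation considered is $\partial_t u=\Delta_p u:=\operatorname{div}(|\nabla u|^{p-2}\nabla u)$. For an open set $U\subset\mathbf{R}^n$ and $t_1<t_2$ let $U_{t_1,t_2}=U\times(t_1,t_2)$; $D'\Subset D$ means that $\overline{D'}$ is a compact subset of $D$. A function $u$ on $\Theta$ is \emph{$p$-parabolic} if it is a continuous weak solution, i.e. $u$ is continuous and, whenever $U_{t_1,t_2}\Subset\Theta$, one has $u\in L^p(t_1,t_2;W^{1,p}(U))$, $t\mapsto\int_U|u(x,t)|^2\,dx$ is continuous on $[t_1,t_2]$, and $\int_{t_1}^{t_2}\int_U|\nabla u|^{p-2}\nabla u\cdot\nabla\varphi\,dx\,dt-\int_{t_1}^{t_2}\int_U u\,\partial_t\varphi\,dx\,dt=0$ for all $\varphi\in C_0^\infty(U_{t_1,t_2})$. A space-time box is $Q_{t_1,t_2}$ with $Q=(a_1,b_1)\times\cdots\times(a_n,b_n)$; its parabolic boundary is $\partial_pQ_{t_1,t_2}=(\overline{Q}\times\{t_1\})\cup(\partial Q\times(t_1,t_2])$. A function $u:\Theta\to(-\infty,\infty]$ is \emph{$p$-superparabolic}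 if (i) $u$ is lower semicontinuous; (ii) $u$ is finite in a dense subset of $\Theta$; (iii) for each space-time box $Q_{t_1,t_2}\Subset\Theta$: if $h$ is $p$-parabolic in $Q_{t_1,t_2}$, continuous on $\overline{Q}_{t_1,t_2}$ and $h\le u$ on $\partial_pQ_{t_1,t_2}$, then $h\le u$ in $Q_{t_1,t_2}$. For a bounded function $f:\partial\Theta\to\mathbf{R}$, the upper class $\mathcal{U}_f$ is the set of all $p$-superparabolic functions $u$ on $\Theta$ which are bounded below and satisfy $\liminf_{\Theta\ni\eta\to\xi}u(\eta)\ge f(\xi)$ for all $\xi\in\partial\Theta$. The upper Perron solution is $\overline{H}f(\xi)=\inf_{u\in\mathcal{U}_f}u(\xi)$, $\xi\in\Theta$. A point $\xi_0\in\partial\Theta$ is \emph{regular} with respect to $\Theta$ if $\lim_{\Theta\ni\xi\to\xi_0}\overline{H}f(\xi)=f(\xi_0)$ for every continuous $f:\partial\Theta\to\mathbf{R}$. *)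

theory Defs
  imports "HOL-Analysis.Analysis"
begin

definition compactly_contained :: "'a::topological_space set \<Rightarrow> 'a set \<Rightarrow> bool"
    (infix \<open>\<Subset>\<close> 50) where
  "D' \<Subset> D \<longleftrightarrow> compact (closure D') \<and> closure D' \<subseteq> D"

fun C_diff :: "nat \<Rightarrow> ('a::euclidean_space \<Rightarrow> real) \<Rightarrow> bool" where
  "C_diff 0 f \<longleftrightarrow> continuous_on UNIV f"
| "C_diff (Suc k) f \<longleftrightarrow> (\<forall>z. f differentiable (at z)) \<and>
     (\<forall>e\<in>Basis. C_diff k (\<lambda>z. frechet_derivative f (at z) e))"

text \<open>\<open>C\<^sub>0\<^sup>\<infinity>(V)\<close>; its elements are extended by zero to the whole space.\<close>

definition test_functions :: "'a::euclidean_space set \<Rightarrow> ('a \<Rightarrow> real) set" where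
  "test_functions V = {\<phi>. (\<forall>k. C_diff k \<phi>) \<and> {z. \<phi> z \<noteq> 0} \<Subset> V}"

definition Lp :: "real \<Rightarrow> 'a::euclidean_space set \<Rightarrow> ('a \<Rightarrow> 'b::euclidean_space) set" where
  "Lp p A = {f. set_borel_measurable lborel A f \<and>
     set_integrable lborel A (\<lambda>x. norm (f x) powr p)}"

definition gradient :: "(real^'n \<Rightarrow> real) \<Rightarrow> real^'n \<Rightarrow> real^'n" where
  "gradient f x = (\<chi> i. frechet_derivative f (at x) (axis i 1))"

definition weak_gradient ::
    "(real^'n) set \<Rightarrow> (real^'n \<Rightarrow> real) \<Rightarrow> (real^'n \<Rightarrow> real^'n) \<Rightarrow> bool" where
  "weak_gradient U f g \<longleftrightarrow>
     (\<forall>C. compact C \<and> C \<subseteq> U \<longrightarrow> set_integrable lborel C f \<and> set_integrable lborel C g) \<and>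
     (\<forall>\<phi>\<in>test_functions U.
        (LINT x:U|lborel. f x *\<^sub>R gradient \<phi> x) = - (LINT x:U|lborel. \<phi> x *\<^sub>R g x))"

definition W1p :: "real \<Rightarrow> (real^'n) set \<Rightarrow> (real^'n \<Rightarrow> real) set" where
  "W1p p U = {f \<in> Lp p U. \<exists>g\<in>Lp p U. weak_gradient U f g}"

text \<open>\<open>u \<in> L\<^sup>p(t\<^sub>1,t\<^sub>2; W\<^sup>1\<^sup>,\<^sup>p(U))\<close> with spatial weak gradient \<open>\<nabla>u = G\<close>: for almost every \<open>t\<close>
  the slice \<open>u(\<cdot>,t)\<close> is in \<open>W\<^sup>1\<^sup>,\<^sup>p(U)\<close>, and \<open>|u|\<^sup>p + |\<nabla>u|\<^sup>p\<close> is integrable over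
  \<open>U \<times> (t\<^sub>1,t\<^sub>2)\<close>. The field \<open>G\<close> is determined almost everywhere by \<open>u\<close>.\<close>

definition parabolic_sobolev ::
    "real \<Rightarrow> (real^'n) set \<Rightarrow> real \<Rightarrow> real \<Rightarrow>
     ((real^'n) \<times> real \<Rightarrow> real) \<Rightarrow> ((real^'n) \<times> real \<Rightarrow> real^'n) \<Rightarrow> bool" where
  "parabolic_sobolev p U t1 t2 u G \<longleftrightarrow>
     u \<in> Lp p (U \<times> {t1<..<t2}) \<and> G \<in> Lp p (U \<times> {t1<..<t2}) \<and>
     (AE t\<in>{t1<..<t2} in lborel.
        (\<lambda>x. u (x, t)) \<in> W1p p U \<and> weak_gradient U (\<lambda>x. u (x, t)) (\<lambda>x. G (x, t)))"

text \<open>At zeros of \<open>G\<close> the integrand \<open>|G|\<^sup>p\<^sup>-\<^sup>2 G\<close> is read as \<open>0\<close>, also for \<open>p < 2\<close>.\<close>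

definition p_parabolic :: "real \<Rightarrow> ((real^'n) \<times> real) set \<Rightarrow> ((real^'n) \<times> real \<Rightarrow> real) \<Rightarrow> bool"
  where
  "p_parabolic p \<Theta> u \<longleftrightarrow> continuous_on \<Theta> u \<and>
     (\<forall>U t1 t2. open U \<and> t1 < t2 \<and> U \<times> {t1<..<t2} \<Subset> \<Theta> \<longrightarrow>
        continuous_on {t1..t2} (\<lambda>t. LINT x:U|lborel. \<bar>u (x, t)\<bar>\<^sup>2) \<and>
        (\<exists>G. parabolic_sobolev p U t1 t2 u G \<and>
          (\<forall>\<phi>\<in>test_functions (U \<times> {t1<..<t2}).
             (LINT t:{t1<..<t2}|lborel. LINT x:U|lborel.
                (norm (G (x, t)) powr (p - 2) *\<^sub>R G (x, t)) \<bullet> gradient (\<lambda>y. \<phi> (y, t)) x)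
             - (LINT t:{t1<..<t2}|lborel. LINT x:U|lborel.
                u (x, t) * deriv (\<lambda>s. \<phi> (x, s)) t) = 0)))"

definition parabolic_boundary ::
    "(real^'n) set \<Rightarrow> real \<Rightarrow> real \<Rightarrow> ((real^'n) \<times> real) set" where
  "parabolic_boundary Q t1 t2 = (closure Q \<times> {t1}) \<union> (frontier Q \<times> {t1<..t2})"

text \<open>Since \<open>at \<xi> within \<Theta>\<close> omits \<open>\<xi>\<close> itself, the first clause bounding \<open>u \<xi>\<close> by the limes
  inferior is lower semicontinuity at \<open>\<xi>\<close>.\<close>

definition p_superparabolic ::
    "real \<Rightarrow> ((real^'n) \<times> real) set \<Rightarrow> ((real^'n) \<times> real \<Rightarrow> ereal) \<Rightarrow> bool" where
  "p_superparabolic p \<Theta> u \<longleftrightarrow>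
     (\<forall>\<xi>\<in>\<Theta>. u \<xi> \<noteq> -\<infinity>) \<and>
     (\<forall>\<xi>\<in>\<Theta>. u \<xi> \<le> Liminf (at \<xi> within \<Theta>) u) \<and>
     \<Theta> \<subseteq> closure {\<xi>\<in>\<Theta>. u \<xi> \<noteq> \<infinity>} \<and>
     (\<forall>a b t1 t2 h. (\<forall>i. a $ i < b $ i) \<and> t1 < t2 \<and> box a b \<times> {t1<..<t2} \<Subset> \<Theta> \<and>
        p_parabolic p (box a b \<times> {t1<..<t2}) h \<and>
        continuous_on (closure (box a b \<times> {t1<..<t2})) h \<and>
        (\<forall>\<xi>\<in>parabolic_boundary (box a b) t1 t2. ereal (h \<xi>) \<le> u \<xi>) \<longrightarrow>
        (\<forall>\<xi>\<in>box a b \<times> {t1<..<t2}. ereal (h \<xi>) \<le> u \<xi>))"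

definition upper_class ::
    "real \<Rightarrow> ((real^'n) \<times> real) set \<Rightarrow> ((real^'n) \<times> real \<Rightarrow> real) \<Rightarrow>
     ((real^'n) \<times> real \<Rightarrow> ereal) set" where
  "upper_class p \<Theta> f = {u. p_superparabolic p \<Theta> u \<and>
     (\<exists>m::real. \<forall>\<xi>\<in>\<Theta>. ereal m \<le> u \<xi>) \<and>
     (\<forall>\<xi>\<in>frontier \<Theta>. ereal (f \<xi>) \<le> Liminf (at \<xi> within \<Theta>) u)}"

definition upper_Perron ::
    "real \<Rightarrow> ((real^'n) \<times> real) set \<Rightarrow> ((real^'n) \<times> real \<Rightarrow> real) \<Rightarrow>
     (real^'n) \<times> real \<Rightarrow> ereal" where
  "upper_Perron p \<Theta> f \<xi> = (INF u\<in>upper_class p \<Theta> f. u \<xi>)"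

text \<open>Meant for bounded open \<open>\<Theta>\<close>, where continuous boundary data are automatically bounded.\<close>

definition regular_point ::
    "real \<Rightarrow> ((real^'n) \<times> real) set \<Rightarrow> (real^'n) \<times> real \<Rightarrow> bool" where
  "regular_point p \<Theta> \<xi>\<^sub>0 \<longleftrightarrow> \<xi>\<^sub>0 \<in> frontier \<Theta> \<and>
     (\<forall>f. continuous_on (frontier \<Theta>) f \<longrightarrow>
        (upper_Perron p \<Theta> f \<longlongrightarrow> ereal (f \<xi>\<^sub>0)) (at \<xi>\<^sub>0 within \<Theta>))"

end

theory Submission
  imports Defs
begin

text \<open>Put \<open>q = p / (p - 1)\<close>. For every real \<open>\<gamma>\<close> the function
  \<open>n |\<gamma>|\<^sup>p\<^sup>-\<^sup>2 \<gamma> t + (\<gamma> / q) |x - y|\<^sup>q + c\<close> is \<open>p\<close>-parabolic, because its flux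
  \<open>|\<nabla>u|\<^sup>p\<^sup>-\<^sup>2 \<nabla>u = |\<gamma>|\<^sup>p\<^sup>-\<^sup>2 \<gamma> (x - y)\<close> is linear. With \<open>\<gamma>\<^sup>p\<^sup>-\<^sup>1\<close> proportional to \<open>1 / \<delta>\<close>, the
  function \<open>k (-t) - (\<gamma> / q) |x|\<^sup>q\<close> with \<open>k\<close> proportional to \<open>1 / \<delta>\<close> is nonnegative on
  \<open>\<Theta> \<inter> {t \<ge> -\<delta>}\<close> and as large as desired at \<open>t = -\<delta>\<close>: since \<open>|x| \<le> (K \<delta>)\<^sup>1\<^sup>/\<^sup>l\<close> this needs
  \<open>\<delta>\<^sup>q\<^sup>/\<^sup>l\<^sup>-\<^sup>q\<^sup>/\<^sup>p\<close> to be small, which is where \<open>l < p\<close> enters. It tends to \<open>0\<close> at the origin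
  and therefore serves as a barrier from both sides.

  From above, the barrier has to be compared with arbitrary \<open>p\<close>-parabolic functions. Weak solutions
  \<open>h\<close> and \<open>w\<close> are compared by mollifying the equation for \<open>h - w\<close>, testing it with
  \<open>(T - t)\<^sub>+\<^sup>2 (h - w - \<epsilon>)\<^sub>+\<^sup>2\<close>, and passing to the limit by Fatou's lemma and the monotonicity of the
  flux.

  From below, a superparabolic \<open>u\<close> has to be compared with a strict subsolution
  \<open>v = k t + (\<gamma> / q) |x|\<^sup>q + c\<close>. Where \<open>u - v\<close> attains a negative minimum, \<open>v\<close> is touched strictly
  from below by an explicit \<open>p\<close>-parabolic function with a smaller \<open>\<gamma>\<close> and a translated center, which
  contradicts the comparison property of \<open>u\<close> in a small box.\<close>

section \<open>Integration by parts\<close>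

text \<open>Both comparisons are arranged so that no Dirichlet problem has to be solved.

  Such an \<open>h\<close> is known only weakly and has no time derivative, so \<open>h - w\<close>
  cannot serve as a test function. Mollification cures this but breaks the link between gradient and
  flux; the sign of their product returns only in the limit, hence Fatou's lemma. The weight in time
  removes the top face of the cylinder, where nothing is assumed.

  From below, the definition of \<open>u\<close> already contains a comparison, but only on boxes,
  and \<open>\<Theta>\<close> near the origin is not a box. The argument is therefore local, at a
  minimum point, and this needs slack in the equation. The slack is a factor 2: the same
  \<open>\<gamma>\<close> is paired with time slope \<open>2 * k\<close> in the exact solution used
  from above and with \<open>k\<close> in the strict subsolution used from below.

  The size \<open>N\<close> required at time \<open>- \<delta>\<close> must not depend on the
  individual \<open>u\<close>, which calls for a lower bound common to the whole upper
  class.\<close>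

lemma has_derivative_imp_directional:
  fixes f :: "'a::real_normed_vector \<Rightarrow> real"
  assumes "(f has_derivative F) (at x)"
  shows "((\<lambda>s. f (x + s *\<^sub>R e)) has_real_derivative F e) (at 0)"
proof -
  have "((\<lambda>s. x + s *\<^sub>R e) has_derivative (\<lambda>s. s *\<^sub>R e)) (at 0)" by (auto intro!: derivative_eq_intros)
  from has_derivative_compose[OF this, of f F] assms
  have "((\<lambda>s. f (x + s *\<^sub>R e)) has_derivative (\<lambda>s. F (s *\<^sub>R e))) (at 0)" by simp
  moreover have "F (s *\<^sub>R e) = F e * s" for s
    using linear_scale[OF has_derivative_linear[OF assms], of s e] by simp
  ultimately show ?thesis by (simp add: has_field_derivative_def mult_commute_abs)
qed

text \<open>Derivatives are recorded at parameter 0 for every base point; moving the base point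
  along the line gives them at all parameters, as the mean value theorem requires.\<close>

lemma directional_derivative_shift:
  fixes f :: "'a::real_normed_vector \<Rightarrow> real"
  assumes "\<And>x. ((\<lambda>s. f (x + s *\<^sub>R e)) has_real_derivative g x) (at 0)"
  shows "((\<lambda>s. f (x + s *\<^sub>R e)) has_real_derivative g (x + s *\<^sub>R e)) (at s)"
proof -
  have "((\<lambda>u. f ((x + s *\<^sub>R e) + (u - s) *\<^sub>R e)) has_real_derivative g (x + s *\<^sub>R e) * 1) (at s)"
    by (rule DERIV_chain'[where g = "\<lambda>u. f ((x + s *\<^sub>R e) + u *\<^sub>R e)" and f = "\<lambda>u. u - s"])
       (auto intro!: derivative_eq_intros assms)
  then show ?thesis by (simp add: algebra_simps)
qed

lemma continuous_compact_support_bounded: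
  fixes f :: "'a::t2_space \<Rightarrow> real"
  assumes f: "continuous_on UNIV f" and K: "compact K" "\<And>x. x \<notin> K \<Longrightarrow> f x = 0"
  obtains B where "\<And>x. \<bar>f x\<bar> \<le> B"
proof -
  have "compact (f ` K)" by (intro compact_continuous_image continuous_on_subset[OF f] K) auto
  from compact_imp_bounded[OF this] obtain B where B: "\<forall>y\<in>f ` K. norm y \<le> B" unfolding bounded_iff by blast
  have "\<bar>f x\<bar> \<le> max B 0" for x
  proof (cases "x \<in> K")
    case True
    then have "norm (f x) \<le> B" using B by blast
    then show ?thesis by simp
  qed (use K(2)[of x] in simp)
  then show ?thesis using that by blast
qed

lemma integrable_continuous_compact_support:
  fixes f :: "'a::euclidean_space \<Rightarrow> 'b::euclidean_space"
  assumes "continuous_on UNIV f" "compact K" "\<And>x. x \<notin> K \<Longrightarrow> f x = 0"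
  shows "integrable lborel f"
proof -
  have "integrable lborel (\<lambda>x. indicator K x *\<^sub>R f x)"
    using assms by (intro borel_integrable_compact) (auto intro: continuous_on_subset)
  also have "(\<lambda>x. indicator K x *\<^sub>R f x) = f"
    using assms(3) by (auto simp: fun_eq_iff indicator_def)
  finally show ?thesis .
qed

lemma integrable_lborel_translate:
  fixes f :: "'a::euclidean_space \<Rightarrow> 'b::{banach, second_countable_topology}"
  assumes "integrable lborel f"
  shows "integrable lborel (\<lambda>x. f (x + z))"
proof -
  have "integrable (distr lborel borel ((+) z)) f" using assms by (simp add: lborel_distr_plus)
  then have "integrable lborel (\<lambda>x. f (z + x))" by (rule integrable_distr[rotated]) auto
  then show ?thesis by (simp add: add.commute)
qed

lemma integral_lborel_translate:
  fixes f :: "'a::euclidean_space \<Rightarrow> 'b::{banach, second_countable_topology}"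
  assumes [measurable]: "f \<in> borel_measurable borel"
  shows "(\<integral>x. f (x + z) \<partial>lborel) = (\<integral>x. f x \<partial>lborel)"
proof -
  have "(\<integral>x. f x \<partial>lborel) = (\<integral>x. f x \<partial>distr lborel borel ((+) z))"
    by (simp add: lborel_distr_plus)
  also have "\<dots> = (\<integral>x. f (z + x) \<partial>lborel)" by (rule integral_distr) auto
  finally show ?thesis by (simp add: add.commute)
qed

text \<open>Difference quotients of \<open>f\<close> integrate to 0 by translation invariance of
  Lebesgue measure. The mean value theorem bounds them by a bound for \<open>g\<close>, so dominated
  convergence carries the value 0 over to \<open>g\<close>.\<close>

lemma integral_directional_derivative_eq_0_aux:
  fixes f g :: "'a::euclidean_space \<Rightarrow> real"
  assumes f: "continuous_on UNIV f" and g: "continuous_on UNIV g" and K: "compact K"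
    and f0: "\<And>x. x \<notin> K \<Longrightarrow> f x = 0" and g0: "\<And>x. x \<notin> K \<Longrightarrow> g x = 0"
    and der: "\<And>x. ((\<lambda>s. f (x + s *\<^sub>R e)) has_real_derivative g x) (at 0)"
  shows "integral\<^sup>L lborel g = 0"
proof -
  obtain B where B: "\<And>x. \<bar>g x\<bar> \<le> B" using continuous_compact_support_bounded[OF g K g0] by blast
  define s where "s n = 1 / real (Suc n)" for n
  have s: "s \<longlonglongrightarrow> 0" and s1: "0 < s n" "s n \<le> 1" for n
    unfolding s_def using LIMSEQ_inverse_real_of_nat by (auto simp: inverse_eq_divide)
  obtain C where C: "\<And>x. x \<in> K \<Longrightarrow> norm x \<le> C"
    using compact_imp_bounded[OF K] unfolding bounded_iff by auto
  \<comment> \<open>Steps are at most 1, so outside this enlarged ball both \<open>x\<close> and the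
    shifted point miss \<open>K\<close>; one dominating function serves all
    \<open>n\<close>.\<close>
  define S where "S = cball (0::'a) (C + norm e)"
  note der' = directional_derivative_shift[OF der]
  have diff: "\<bar>f (x + s n *\<^sub>R e) - f x\<bar> \<le> B * s n" for x n
  proof -
    obtain z where "0 < z" "z < s n"
      "f (x + s n *\<^sub>R e) - f (x + 0 *\<^sub>R e) = (s n - 0) * g (x + z *\<^sub>R e)"
      using MVT2[OF s1(1)[of n], of "\<lambda>s. f (x + s *\<^sub>R e)" "\<lambda>s. g (x + s *\<^sub>R e)"] der' by blast
    then show ?thesis using B[of "x + z *\<^sub>R e"] s1(1)[of n]
      by (simp add: abs_mult mult.commute mult_left_mono)
  qed
  have fi: "integrable lborel f" by (rule integrable_continuous_compact_support[OF f K f0])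
  have fti: "integrable lborel (\<lambda>x. f (x + s n *\<^sub>R e))" for n
    by (rule integrable_lborel_translate[OF fi])
  have eq: "(\<integral>x. f (x + s n *\<^sub>R e) \<partial>lborel) = (\<integral>x. f x \<partial>lborel)" for n
    by (rule integral_lborel_translate) (use fi in auto)
  have "(\<lambda>n. \<integral>x. (f (x + s n *\<^sub>R e) - f x) / s n \<partial>lborel) \<longlonglongrightarrow> (\<integral>x. g x \<partial>lborel)"
  proof (rule integral_dominated_convergence[where w = "\<lambda>x. indicator S x *\<^sub>R B"])
    show "g \<in> borel_measurable lborel" using g by (auto intro: borel_measurable_continuous_onI)
    show "(\<lambda>x. (f (x + s n *\<^sub>R e) - f x) / s n) \<in> borel_measurable lborel" for n
      using fi fti by measurable
    show "integrable lborel (\<lambda>x. indicator S x *\<^sub>R B)"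
      unfolding S_def by (intro borel_integrable_compact) auto
    show "AE x in lborel. (\<lambda>n. (f (x + s n *\<^sub>R e) - f x) / s n) \<longlonglongrightarrow> g x"
    proof (rule AE_I2)
      fix x
      have "((\<lambda>h. (f (x + h *\<^sub>R e) - f x) / h) \<longlongrightarrow> g x) (at 0)"
        using der[of x] by (simp add: DERIV_def)
      moreover have "filterlim s (at 0) sequentially"
        using s s1 by (auto simp: filterlim_at intro!: always_eventually less_imp_neq[symmetric])
      ultimately show "(\<lambda>n. (f (x + s n *\<^sub>R e) - f x) / s n) \<longlonglongrightarrow> g x"
        by (rule filterlim_compose)
    qed
    show "AE x in lborel. norm ((f (x + s n *\<^sub>R e) - f x) / s n) \<le> indicator S x *\<^sub>R B" for n
    proof (rule AE_I2)
      fix x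
      show "norm ((f (x + s n *\<^sub>R e) - f x) / s n) \<le> indicator S x *\<^sub>R B"
      proof (cases "x \<in> S")
        case True
        then show ?thesis using diff[of x n] s1(1)[of n] by (simp add: abs_div pos_divide_le_eq)
      next
        case False
        have "norm x \<le> norm (x + s n *\<^sub>R e) + norm (s n *\<^sub>R e)"
          using norm_triangle_ineq4[of "x + s n *\<^sub>R e" "s n *\<^sub>R e"] by simp
        also have "norm (s n *\<^sub>R e) \<le> norm e"
          using s1[of n] by (simp add: mult_left_le_one_le)
        finally have "norm (x + s n *\<^sub>R e) > C" using False by (auto simp: S_def)
        moreover have "norm x > C" using False norm_ge_zero[of e] by (auto simp: S_def simp del: norm_ge_zero)
        ultimately have "f (x + s n *\<^sub>R e) = 0" "f x = 0" using C f0 by (meson not_le)+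
        then show ?thesis using False by simp
      qed
    qed
  qed
  moreover have "(\<integral>x. (f (x + s n *\<^sub>R e) - f x) / s n \<partial>lborel) = 0" for n
    using fti[of n] fi eq[of n] by (subst integral_divide_zero) simp
  ultimately have "(\<lambda>n. 0) \<longlonglongrightarrow> integral\<^sup>L lborel g" by (simp only:)
  then show ?thesis by (simp add: LIMSEQ_const_iff)
qed

text \<open>Extension by zero reduces this to the whole space: \<open>R\<close> and the complement
  of \<open>K\<close> are open and cover everything, and the extended functions are continuous on
  each. Assumptions are made on \<open>R\<close> only, because the mollified equation holds only at
  some distance from the boundary of its domain.\<close>

lemma integral_directional_derivative_eq_0:
  fixes f g :: "'a::euclidean_space \<Rightarrow> real"
  assumes R: "open R" and K: "compact K" "K \<subseteq> R" and f0: "\<And>x. x \<in> R \<Longrightarrow> x \<notin> K \<Longrightarrow> f x = 0"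
    and f: "continuous_on R f" and g: "continuous_on R g"
    and der: "\<And>x. x \<in> R \<Longrightarrow> ((\<lambda>s. f (x + s *\<^sub>R e)) has_real_derivative g x) (at 0)"
  shows "integrable lborel (\<lambda>x. indicator R x * g x)" "(\<integral>x. indicator R x * g x \<partial>lborel) = 0"
    "\<And>x. x \<in> R \<Longrightarrow> x \<notin> K \<Longrightarrow> g x = 0"
proof -
  have line: "((\<lambda>s. x + s *\<^sub>R e) \<longlongrightarrow> x) (at 0)" for x
    by (rule tendsto_eq_intros refl | simp)+
  have near: "\<forall>\<^sub>F s in nhds 0. x + s *\<^sub>R e \<in> S" if "open S" "x \<in> S" for S x
    using topological_tendstoD[OF line that] that by (simp add: eventually_nhds_conv_at)
  have oRK: "open (R - K)" "open (- K)" using R K by (auto intro: compact_imp_closed open_Diff)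
  show g0: "g x = 0" if "x \<in> R" "x \<notin> K" for x
  proof -
    have "((\<lambda>s. f (x + s *\<^sub>R e)) has_real_derivative 0) (at 0)"
      by (rule DERIV_cong_ev[THEN iffD2, OF refl _ refl DERIV_const[of 0]])
         (use near[OF oRK(1), of x] that in \<open>auto elim!: eventually_mono simp: f0\<close>)
    then show ?thesis using der[OF that(1)] DERIV_unique by blast
  qed
  define F where "F x = indicator R x * f x" for x
  define G where "G x = indicator R x * g x" for x
  have cover: "R \<union> - K = UNIV" using K by auto
  have FR: "continuous_on UNIV F" 
  proof -
    have "continuous_on R F" using f by (rule continuous_on_eq) (auto simp: F_def)
    moreover have "continuous_on (- K) F"
      by (rule continuous_on_eq[of _ "\<lambda>_. 0"]) (auto simp: F_def indicator_def f0)
    ultimately show ?thesis using continuous_on_open_Un[of R "- K" F] R oRK cover by auto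
  qed
  have GR: "continuous_on UNIV G" 
  proof -
    have "continuous_on R G" using g by (rule continuous_on_eq) (auto simp: G_def)
    moreover have "continuous_on (- K) G"
      by (rule continuous_on_eq[of _ "\<lambda>_. 0"]) (auto simp: G_def indicator_def g0)
    ultimately show ?thesis using continuous_on_open_Un[of R "- K" G] R oRK cover by auto
  qed
  have G0: "G x = 0" "F x = 0" if "x \<notin> K" for x
    using that g0 f0 by (auto simp: F_def G_def indicator_def)
  have "integrable lborel G" by (rule integrable_continuous_compact_support[OF GR K(1) G0(1)])
  then show "integrable lborel (\<lambda>x. indicator R x * g x)" by (simp add: G_def[abs_def])
  have "((\<lambda>s. F (x + s *\<^sub>R e)) has_real_derivative G x) (at 0)" for x
  proof (cases "x \<in> R")
    case True
    show ?thesis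
      by (rule DERIV_cong_ev[THEN iffD2, OF refl _ refl der[OF True, THEN DERIV_cong]])
         (use near[OF R True] True in \<open>auto elim!: eventually_mono simp: F_def G_def\<close>)
  next
    case False
    then have x: "x \<in> - K" using K by auto
    have "\<forall>\<^sub>F s in nhds 0. F (x + s *\<^sub>R e) = 0"
      using near[OF oRK(2) x] by eventually_elim (auto simp: G0)
    from DERIV_cong_ev[THEN iffD2, OF refl this refl DERIV_const[of 0]] show ?thesis
      using x by (simp add: G0)
  qed
  then have "integral\<^sup>L lborel G = 0"
    by (rule integral_directional_derivative_eq_0_aux[OF FR GR K(1) G0(2) G0(1), rotated 2]) auto
  then show "(\<integral>x. indicator R x * g x \<partial>lborel) = 0" by (simp add: G_def[abs_def])
qed

text \<open>The product rule under the integral. The support condition on \<open>f\<close> passes to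
  \<open>f'\<close>, which makes both products integrable.\<close>

lemma integration_by_parts_directional:
  fixes f g f' g' :: "'a::euclidean_space \<Rightarrow> real"
  assumes R: "open R" and K: "compact K" "K \<subseteq> R" and f0: "\<And>x. x \<in> R \<Longrightarrow> x \<notin> K \<Longrightarrow> f x = 0"
    and c: "continuous_on R f" "continuous_on R g" "continuous_on R f'" "continuous_on R g'"
    and f': "\<And>x. x \<in> R \<Longrightarrow> ((\<lambda>s. f (x + s *\<^sub>R e)) has_real_derivative f' x) (at 0)"
    and g': "\<And>x. x \<in> R \<Longrightarrow> ((\<lambda>s. g (x + s *\<^sub>R e)) has_real_derivative g' x) (at 0)"
  shows "integrable lborel (\<lambda>x. indicator R x * (f' x * g x))"
    "integrable lborel (\<lambda>x. indicator R x * (f x * g' x))"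
    "(\<integral>x. indicator R x * (f' x * g x) \<partial>lborel) = - (\<integral>x. indicator R x * (f x * g' x) \<partial>lborel)"
proof -
  have d: "((\<lambda>s. f (x + s *\<^sub>R e) * g (x + s *\<^sub>R e)) has_real_derivative (f' x * g x + f x * g' x)) (at 0)"
    if "x \<in> R" for x
    using DERIV_mult[OF f'[OF that] g'[OF that]] by (simp add: algebra_simps)
  note I = integral_directional_derivative_eq_0[OF R K, of "\<lambda>x. f x * g x" "\<lambda>x. f' x * g x + f x * g' x" e]
  have f'0: "f' x = 0" if "x \<in> R" "x \<notin> K" for x
    using integral_directional_derivative_eq_0(3)[OF R K f0 c(1) c(3) f'] that by blast
  have int: "integrable lborel (\<lambda>x. indicator R x * h x)"
    if "continuous_on R h" "\<And>x. x \<in> R \<Longrightarrow> x \<notin> K \<Longrightarrow> h x = 0" for h :: "'a \<Rightarrow> real"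
  proof -
    have "integrable lborel (\<lambda>x. indicator K x *\<^sub>R h x)"
      using K that(1) by (intro borel_integrable_compact) (auto intro: continuous_on_subset)
    also have "(\<lambda>x. indicator K x *\<^sub>R h x) = (\<lambda>x. indicator R x * h x)"
      using that(2) K by (auto simp: fun_eq_iff indicator_def)
    finally show ?thesis .
  qed
  show i1: "integrable lborel (\<lambda>x. indicator R x * (f' x * g x))"
    by (rule int) (auto intro!: continuous_intros c simp: f'0)
  show i2: "integrable lborel (\<lambda>x. indicator R x * (f x * g' x))"
    by (rule int) (auto intro!: continuous_intros c simp: f0)
  have "(\<integral>x. indicator R x * (f' x * g x + f x * g' x) \<partial>lborel) = 0"
    by (rule I) (auto intro!: continuous_intros c d simp: f0)
  also have "(\<integral>x. indicator R x * (f' x * g x + f x * g' x) \<partial>lborel) =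
     (\<integral>x. indicator R x * (f' x * g x) \<partial>lborel) + (\<integral>x. indicator R x * (f x * g' x) \<partial>lborel)"
    using i1 i2 by (simp add: distrib_left)
  finally show "(\<integral>x. indicator R x * (f' x * g x) \<partial>lborel) = - (\<integral>x. indicator R x * (f x * g' x) \<partial>lborel)"
    by simp
qed

section \<open>A smooth mollifier\<close>

text \<open>The powers of \<open>1 / s\<close> are included because the derivative of
  \<open>exp (- (1 / s)) / s ^ m\<close> is a combination of members of the same family; smoothness
  then becomes a closure property.\<close>

definition exp_pole :: "nat \<Rightarrow> real \<Rightarrow> real" where
  "exp_pole m s = (if s > 0 then exp (- (1 / s)) / s ^ m else 0)"

lemma exp_pole_over: "0 < s \<Longrightarrow> exp_pole m s / s = exp_pole (Suc m) s"
  by (simp add: exp_pole_def)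

lemma exp_pole_nonneg: "0 \<le> exp_pole m s" and exp_pole_pos: "0 < s \<Longrightarrow> 0 < exp_pole m s"
  by (auto simp: exp_pole_def)

lemma exp_pole_tendsto_0: "(exp_pole m \<longlongrightarrow> 0) (at_right 0)"
proof -
  have "((\<lambda>x::real. x ^ m / exp x) \<longlongrightarrow> 0) at_top" by (rule tendsto_power_div_exp_0)
  then have "((\<lambda>s::real. (inverse s) ^ m / exp (inverse s)) \<longlongrightarrow> 0) (at_right 0)"
    by (rule filterlim_compose[OF _ filterlim_inverse_at_top_right])
  then show ?thesis
  proof (rule Lim_transform_eventually)
    show "\<forall>\<^sub>F s in at_right 0. (inverse s) ^ m / exp (inverse s) = exp_pole m s"
      by (rule eventually_at_rightI[of 0 1])
         (auto simp: exp_pole_def exp_minus field_simps)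
  qed
qed

lemma exp_pole_has_derivative:
  "(exp_pole m has_real_derivative (exp_pole (m + 2) s - real m * exp_pole (m + 1) s)) (at s)"
proof -
  consider "s > 0" | "s < 0" | "s = 0" by linarith
  then show ?thesis
  proof cases
    case 1
    have "((\<lambda>s. exp (- (1 / s)) / s ^ m) has_real_derivative
       (exp_pole (m + 2) s - real m * exp_pole (m + 1) s)) (at s)"
      using 1 by (auto intro!: derivative_eq_intros simp: exp_pole_def field_simps power2_eq_square)
        (cases m; simp add: field_simps)
    moreover have "\<forall>\<^sub>F x in nhds s. exp_pole m x = exp (- (1 / x)) / x ^ m"
      using eventually_nhds_in_open[of "{0<..}" s] 1
      by (auto elim!: eventually_mono simp: exp_pole_def)
    ultimately show ?thesis by (subst DERIV_cong_ev[OF refl _ refl])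
  next
    case 2
    have "\<forall>\<^sub>F x in nhds s. exp_pole m x = 0"
      using eventually_nhds_in_open[of "{..<0}" s] 2
      by (auto elim!: eventually_mono simp: exp_pole_def)
    from DERIV_cong_ev[THEN iffD2, OF refl this refl DERIV_const]
    have "(exp_pole m has_real_derivative 0) (at s)" .
    moreover have "exp_pole (m + 2) s - real m * exp_pole (m + 1) s = 0"
      using 2 by (simp add: exp_pole_def)
    ultimately show ?thesis by (simp only:)
  next
    case 3
    \<comment> \<open>Dividing by \<open>h\<close> only raises the order of the pole by one, and
      every member of the family tends to 0 from the right.\<close>
    have "((\<lambda>h. exp_pole m h / h) \<longlongrightarrow> 0) (at_right 0)"
      by (rule Lim_transform_eventually[OF exp_pole_tendsto_0[of "Suc m"]])
         (auto intro!: eventually_at_rightI[of 0 1] simp: exp_pole_over)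
    moreover have "((\<lambda>h. exp_pole m h / h) \<longlongrightarrow> 0) (at_left 0)"
      by (rule tendsto_eventually) (auto intro!: eventually_at_leftI[of "-1" 0] simp: exp_pole_def)
    ultimately have "((\<lambda>h. exp_pole m h / h) \<longlongrightarrow> 0) (at 0)"
      by (rule filterlim_split_at_real[rotated])
    then show ?thesis using 3 by (simp add: DERIV_def exp_pole_def)
  qed
qed

text \<open>A class closed under directional derivatives, so that one induction over its generation
  yields \<open>C_diff k\<close> for every \<open>k\<close>. Membership is what makes a function
  usable as a smooth test function below.\<close>

inductive_set bump_algebra :: "('a::euclidean_space \<Rightarrow> real) set" where
  const: "(\<lambda>z. c) \<in> bump_algebra"
| inner: "(\<lambda>z. z \<bullet> v) \<in> bump_algebra"
| pole: "f \<in> bump_algebra \<Longrightarrow> (\<lambda>z. exp_pole m (f z)) \<in> bump_algebra"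
| add: "f \<in> bump_algebra \<Longrightarrow> g \<in> bump_algebra \<Longrightarrow> (\<lambda>z. f z + g z) \<in> bump_algebra"
| mult: "f \<in> bump_algebra \<Longrightarrow> g \<in> bump_algebra \<Longrightarrow> (\<lambda>z. f z * g z) \<in> bump_algebra"

lemma bump_algebra_sum:
  "finite I \<Longrightarrow> (\<And>i. i \<in> I \<Longrightarrow> f i \<in> bump_algebra) \<Longrightarrow> (\<lambda>z. \<Sum>i\<in>I. f i z) \<in> bump_algebra"
  by (induction I rule: finite_induct) (auto intro: bump_algebra.intros)

lemma bump_algebra_has_derivative:
  "f \<in> bump_algebra \<Longrightarrow>
    \<exists>f'. (\<forall>z. (f has_derivative (\<lambda>h. f' h z)) (at z)) \<and> (\<forall>h. f' h \<in> bump_algebra)"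
proof (induction rule: bump_algebra.induct)
  case (const c)
  show ?case by (rule exI[of _ "\<lambda>h z. 0"]) (auto intro: bump_algebra.const)
next
  case (inner v)
  show ?case
    by (rule exI[of _ "\<lambda>h z. h \<bullet> v"]) (auto intro: bump_algebra.const derivative_eq_intros)
next
  case (pole f m)
  then obtain f' where f': "\<And>z. (f has_derivative (\<lambda>h. f' h z)) (at z)" "\<And>h. f' h \<in> bump_algebra"
    by blast
  let ?g = "\<lambda>z. exp_pole (m + 2) (f z) + (- real m) * exp_pole (m + 1) (f z)"
  have "((\<lambda>z. exp_pole m (f z)) has_derivative (\<lambda>h. f' h z * ?g z)) (at z)" for z
    using has_derivative_compose[OF f'(1) exp_pole_has_derivative[unfolded has_field_derivative_def]]
    by (simp add: mult.commute)
  moreover have "?g \<in> bump_algebra"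
    by (intro bump_algebra.intros pole.hyps)
  ultimately show ?case
    by (intro exI[of _ "\<lambda>h z. f' h z * ?g z"] conjI allI bump_algebra.mult f'(2))
next
  case (add f g)
  then obtain f' g' where f': "\<And>z. (f has_derivative (\<lambda>h. f' h z)) (at z)" "\<And>h. f' h \<in> bump_algebra"
    and g': "\<And>z. (g has_derivative (\<lambda>h. g' h z)) (at z)" "\<And>h. g' h \<in> bump_algebra"
    by blast
  then show ?case
    by (intro exI[of _ "\<lambda>h z. f' h z + g' h z"]) (auto intro!: bump_algebra.intros has_derivative_add)
next
  case (mult f g)
  then obtain f' g' where f': "\<And>z. (f has_derivative (\<lambda>h. f' h z)) (at z)" "\<And>h. f' h \<in> bump_algebra"
    and g': "\<And>z. (g has_derivative (\<lambda>h. g' h z)) (at z)" "\<And>h. g' h \<in> bump_algebra"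
    by blast
  then show ?case using mult.hyps
    by (intro exI[of _ "\<lambda>h z. f z * g' h z + f' h z * g z"])
       (auto intro!: bump_algebra.intros has_derivative_mult)
qed

lemma bump_algebra_C_diff:
  assumes "f \<in> bump_algebra" shows "C_diff k f"
  using assms
proof (induction k arbitrary: f)
  case 0
  then obtain f' where "\<And>z. (f has_derivative (\<lambda>h. f' h z)) (at z)"
    using bump_algebra_has_derivative by blast
  then have "\<And>z. isCont f z" by (blast intro: has_derivative_continuous)
  then show ?case by (auto simp: continuous_on_eq_continuous_at)
next
  case (Suc k)
  then obtain f' where f': "\<And>z. (f has_derivative (\<lambda>h. f' h z)) (at z)" "\<And>h. f' h \<in> bump_algebra"
    using bump_algebra_has_derivative by blast
  have "(\<lambda>z. frechet_derivative f (at z) e) = f' e" for e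
    using frechet_derivative_at[OF f'(1)] by (auto simp: fun_eq_iff)
  then show ?case using f' Suc.IH by (auto simp: differentiable_def)
qed

text \<open>The standard bump \<open>exp (- 1 / (1 - |z|^2))\<close> of the unit ball, extended by
  zero.\<close>

definition std_bump :: "'a::euclidean_space \<Rightarrow> real" where
  "std_bump z = exp_pole 0 (1 - z \<bullet> z)"

text \<open>Normalised by the integral of the scaled bump itself rather than by a power of
  \<open>\<eta>\<close>, so that no change of variables under scaling is required.\<close>

definition mollifier :: "real \<Rightarrow> 'a::euclidean_space \<Rightarrow> real" where
  "mollifier \<eta> z = std_bump (z /\<^sub>R \<eta>) / (\<integral>y. std_bump ((y::'a) /\<^sub>R \<eta>) \<partial>lborel)"

lemma std_bump_bump_algebra:
  "(\<lambda>z. std_bump ((\<xi> - z) /\<^sub>R \<eta>)) \<in> (bump_algebra :: ('a::euclidean_space \<Rightarrow> real) set)"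
proof -
  \<comment> \<open>Each coordinate of the argument is affine in \<open>z\<close>, so the squared
    norm, expanded over \<open>Basis\<close>, lies in the algebra.\<close>
  have *: "((\<xi> - z) /\<^sub>R \<eta>) \<bullet> b = (\<xi> \<bullet> b) / \<eta> + z \<bullet> (- (b /\<^sub>R \<eta>))" for z b :: 'a
    by (simp add: inner_diff_left divide_inverse algebra_simps)
  have "(\<lambda>z. std_bump ((\<xi> - z) /\<^sub>R \<eta>)) = (\<lambda>z. exp_pole 0 (1 + (\<Sum>b\<in>Basis.
     ((\<xi> \<bullet> b) / \<eta> + z \<bullet> (- (b /\<^sub>R \<eta>))) * ((\<xi> \<bullet> b) / \<eta> + z \<bullet> (- (b /\<^sub>R \<eta>))) * (-1))))"
    unfolding std_bump_def
    by (subst euclidean_inner) (simp only: *, simp only: mult_minus1_right sum_negf diff_conv_add_uminus)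
  also have "\<dots> \<in> bump_algebra"
    by (intro bump_algebra.intros bump_algebra_sum) auto
  finally show ?thesis .
qed

lemma mollifier_bump_algebra: "(\<lambda>z. mollifier \<eta> (\<xi> - z)) \<in> bump_algebra"
proof -
  have "(\<lambda>z. mollifier \<eta> (\<xi> - z)) =
     (\<lambda>z. std_bump ((\<xi> - z) /\<^sub>R \<eta>) * (1 / (\<integral>y. std_bump ((y::'a) /\<^sub>R \<eta>) \<partial>lborel)))"
    by (simp add: mollifier_def fun_eq_iff)
  also have "\<dots> \<in> bump_algebra"
    by (intro bump_algebra.intros std_bump_bump_algebra)
  finally show ?thesis .
qed

lemma std_bump_eq_0: 
  assumes "0 < \<eta>" "\<eta> \<le> norm z" shows "std_bump (z /\<^sub>R \<eta>) = 0"
proof -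
  have "1 \<le> norm (z /\<^sub>R \<eta>)" using assms by (simp add: field_simps)
  then have "1 \<le> (norm (z /\<^sub>R \<eta>))\<^sup>2" by (simp add: one_le_power)
  then have "\<not> 0 < 1 - (z /\<^sub>R \<eta>) \<bullet> (z /\<^sub>R \<eta>)" by (simp only: power2_norm_eq_inner)
  then show ?thesis unfolding std_bump_def exp_pole_def by (simp only: if_False)
qed

lemma std_bump_nonneg: "0 \<le> std_bump z"
  by (simp add: std_bump_def exp_pole_nonneg)

lemma mollifier_eq_0: "0 < \<eta> \<Longrightarrow> \<eta> \<le> norm z \<Longrightarrow> mollifier \<eta> z = 0"
  by (simp add: mollifier_def std_bump_eq_0)

lemma bump_algebra_continuous: "f \<in> bump_algebra \<Longrightarrow> continuous_on UNIV f"
  using bump_algebra_C_diff[of f 0] by simp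

lemma std_bump_scaled_continuous: "continuous_on UNIV (\<lambda>z::'a::euclidean_space. std_bump (z /\<^sub>R \<eta>))"
proof -
  have "(0 - z) /\<^sub>R (- \<eta>) = z /\<^sub>R \<eta>" for z :: 'a by simp
  then show ?thesis
    using bump_algebra_continuous[OF std_bump_bump_algebra[of "-\<eta>" "0::'a"]] by (simp only:)
qed

lemma std_bump_integrable:
  "0 < \<eta> \<Longrightarrow> integrable lborel (\<lambda>z::'a::euclidean_space. std_bump (z /\<^sub>R \<eta>))"
  by (rule integrable_continuous_compact_support[OF std_bump_scaled_continuous compact_cball[of 0 \<eta>]])
     (auto intro: std_bump_eq_0)

lemma std_bump_integral_pos:
  assumes "0 < \<eta>" shows "0 < (\<integral>z. std_bump ((z::'a::euclidean_space) /\<^sub>R \<eta>) \<partial>lborel)"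
proof -
  have "(\<integral>z. std_bump ((z::'a) /\<^sub>R \<eta>) \<partial>lborel) \<noteq> 0"
  proof
    assume "(\<integral>z. std_bump ((z::'a) /\<^sub>R \<eta>) \<partial>lborel) = 0"
    then have "AE z in lborel. std_bump ((z::'a) /\<^sub>R \<eta>) = 0"
      using integral_nonneg_eq_0_iff_AE[OF std_bump_integrable[OF assms]]
      by (auto simp: std_bump_nonneg)
    then have "AE z in lborel. z \<notin> ball (0::'a) \<eta>"
    proof eventually_elim
      case (elim z)
      have "norm (z /\<^sub>R \<eta>) < 1" if "norm z < \<eta>" using that assms by (simp add: field_simps)
      then have "(norm (z /\<^sub>R \<eta>))\<^sup>2 < 1" if "norm z < \<eta>" using that by (simp add: power_less_one_iff)
      then have "std_bump (z /\<^sub>R \<eta>) > 0" if "norm z < \<eta>"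
        using that unfolding std_bump_def power2_norm_eq_inner by (intro exp_pole_pos) simp
      then show ?case using elim by auto
    qed
    then have "emeasure lborel (ball (0::'a) \<eta>) = 0"
      by (subst (asm) AE_iff_measurable[where N = "ball 0 \<eta>"]) auto
    moreover have "0 < unit_ball_vol (real DIM('a)) * \<eta> ^ DIM('a)" using assms by simp
    ultimately show False using assms by (simp add: emeasure_ball ennreal_eq_0_iff not_le)
  qed
  moreover have "0 \<le> (\<integral>z. std_bump ((z::'a) /\<^sub>R \<eta>) \<partial>lborel)"
    by (simp add: std_bump_nonneg)
  ultimately show ?thesis by linarith
qed

lemma mollifier_nonneg: "0 \<le> mollifier \<eta> z"
  by (simp add: mollifier_def std_bump_nonneg)

lemma mollifier_continuous: "continuous_on UNIV (mollifier \<eta>)"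
  unfolding mollifier_def[abs_def] divide_inverse
  by (intro continuous_intros std_bump_scaled_continuous)

lemma mollifier_integrable: "0 < \<eta> \<Longrightarrow> integrable lborel (mollifier \<eta>)"
  unfolding mollifier_def[abs_def] by (simp add: std_bump_integrable)

lemma mollifier_integral: "0 < \<eta> \<Longrightarrow> (\<integral>z. mollifier \<eta> (z::'a::euclidean_space) \<partial>lborel) = 1"
  using std_bump_integral_pos[of \<eta>, where 'a='a]
  by (simp add: mollifier_def[abs_def] std_bump_integrable)

section \<open>Mollification of integrable functions\<close>

lemma integrable_bounded_scaleR:
  fixes f :: "'a::euclidean_space \<Rightarrow> 'b::{banach, second_countable_topology}"
  assumes f: "integrable lborel f" and k: "k \<in> borel_measurable borel" "\<And>x. \<bar>k x\<bar> \<le> (B::real)"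
  shows "integrable lborel (\<lambda>x. k x *\<^sub>R f x)"
proof (rule Bochner_Integration.integrable_bound[where f = "\<lambda>x. B *\<^sub>R f x"])
  show "(\<lambda>x. k x *\<^sub>R f x) \<in> borel_measurable lborel" using f k by measurable
  have "\<bar>k x\<bar> * norm (f x) \<le> \<bar>B\<bar> * norm (f x)" for x
    by (rule mult_right_mono) (use k(2)[of x] in auto)
  then show "AE x in lborel. norm (k x *\<^sub>R f x) \<le> norm (B *\<^sub>R f x)" by simp
qed (use f in auto)

lemma continuous_on_convolution:
  fixes f :: "'a::euclidean_space \<Rightarrow> 'b::{banach, second_countable_topology}"
  assumes f: "integrable lborel f" and k: "continuous_on UNIV k" "\<And>x. \<bar>k x\<bar> \<le> (B::real)"
  shows "continuous_on UNIV (\<lambda>\<xi>. \<integral>z. k (\<xi> - z) *\<^sub>R f z \<partial>lborel)"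
proof -
  have [measurable]: "k \<in> borel_measurable borel" using k by (intro borel_measurable_continuous_onI)
  have km: "(\<lambda>z. k (\<xi> - z)) \<in> borel_measurable borel" for \<xi> by measurable
  show ?thesis
    unfolding continuous_on_sequentially
  proof (intro allI ballI impI, elim conjE)
    fix x a assume x: "x \<longlonglongrightarrow> (a::'a)"
    have "(\<lambda>n. \<integral>z. k (x n - z) *\<^sub>R f z \<partial>lborel) \<longlonglongrightarrow> (\<integral>z. k (a - z) *\<^sub>R f z \<partial>lborel)"
    proof (rule integral_dominated_convergence[where w = "\<lambda>z. B * norm (f z)"])
      show "integrable lborel (\<lambda>z. B * norm (f z))" using f by auto
      show "AE z in lborel. norm (k (x n - z) *\<^sub>R f z) \<le> B * norm (f z)" for n
        by (auto intro!: mult_right_mono k(2))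
      show "AE z in lborel. (\<lambda>n. k (x n - z) *\<^sub>R f z) \<longlonglongrightarrow> k (a - z) *\<^sub>R f z"
        by (auto intro!: tendsto_intros continuous_on_tendsto_compose[OF k(1)] x)
    qed (use integrable_bounded_scaleR[OF f km k(2)] in auto)
    then show "((\<lambda>\<xi>. \<integral>z. k (\<xi> - z) *\<^sub>R f z \<partial>lborel) \<circ> x) \<longlonglongrightarrow> (\<integral>z. k (a - z) *\<^sub>R f z \<partial>lborel)"
      by (simp add: comp_def)
  qed
qed

text \<open>The derivative falls on the kernel. Its difference quotients are bounded by
  \<open>B\<close> through the mean value inequality, so \<open>B * |f|\<close> dominates.\<close>

lemma convolution_has_directional_derivative:
  fixes f :: "'a::euclidean_space \<Rightarrow> real"
  assumes f: "integrable lborel f" and k: "continuous_on UNIV k" "\<And>x. \<bar>k x\<bar> \<le> (B::real)"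
    and k': "continuous_on UNIV k'" "\<And>x. \<bar>k' x\<bar> \<le> B"
    and der: "\<And>x. ((\<lambda>s. k (x + s *\<^sub>R e)) has_real_derivative k' x) (at 0)"
  shows "((\<lambda>s. \<integral>z. k (\<xi> + s *\<^sub>R e - z) * f z \<partial>lborel) has_real_derivative
    (\<integral>z. k' (\<xi> - z) * f z \<partial>lborel)) (at 0)"
proof -
  have [measurable]: "k \<in> borel_measurable borel" "k' \<in> borel_measurable borel"
    using k k' by (auto intro: borel_measurable_continuous_onI)
  have int: "integrable lborel (\<lambda>z. k (\<xi> - z) * f z)" "integrable lborel (\<lambda>z. k' (\<xi> - z) * f z)" for \<xi>
    using integrable_bounded_scaleR[OF f, of "\<lambda>z. k (\<xi> - z)" B]
      integrable_bounded_scaleR[OF f, of "\<lambda>z. k' (\<xi> - z)" B] k k' by auto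
  note der' = directional_derivative_shift[OF der]
  have diff: "\<bar>k (x + s *\<^sub>R e) - k x\<bar> \<le> B * \<bar>s\<bar>" for x s
  proof -
    have "\<bar>k (x + s *\<^sub>R e) - k (x + 0 *\<^sub>R e)\<bar> \<le> B * \<bar>s - 0\<bar>"
      using field_differentiable_bound[of UNIV "\<lambda>s. k (x + s *\<^sub>R e)" "\<lambda>s. k' (x + s *\<^sub>R e)" B s 0]
        der' k'(2) by auto
    then show ?thesis by simp
  qed
  show ?thesis
    unfolding DERIV_def tendsto_at_iff_sequentially
  proof (intro allI impI)
    fix s :: "nat \<Rightarrow> real" assume s: "\<forall>i. s i \<in> UNIV - {0}" "s \<longlonglongrightarrow> 0"
    have "(\<lambda>n. \<integral>z. (k (\<xi> + s n *\<^sub>R e - z) - k (\<xi> - z)) / s n * f z \<partial>lborel) \<longlonglongrightarrow>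
        (\<integral>z. k' (\<xi> - z) * f z \<partial>lborel)"
    proof (rule integral_dominated_convergence[where w = "\<lambda>z. B * \<bar>f z\<bar>"])
      show "integrable lborel (\<lambda>z. B * \<bar>f z\<bar>)" using f by auto
      show "AE z in lborel. norm ((k (\<xi> + s n *\<^sub>R e - z) - k (\<xi> - z)) / s n * f z) \<le> B * \<bar>f z\<bar>" for n
      proof (rule AE_I2)
        fix z
        have "\<bar>k (\<xi> + s n *\<^sub>R e - z) - k (\<xi> - z)\<bar> / \<bar>s n\<bar> \<le> B"
          using diff[of "\<xi> - z" "s n"] s by (simp add: divide_le_eq algebra_simps)
        from mult_right_mono[OF this abs_ge_zero[of "f z"]]
        show "norm ((k (\<xi> + s n *\<^sub>R e - z) - k (\<xi> - z)) / s n * f z) \<le> B * \<bar>f z\<bar>"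
          by (simp add: abs_mult)
      qed
      show "AE z in lborel. (\<lambda>n. (k (\<xi> + s n *\<^sub>R e - z) - k (\<xi> - z)) / s n * f z)
          \<longlonglongrightarrow> k' (\<xi> - z) * f z"
      proof (rule AE_I2)
        fix z
        have "((\<lambda>s. (k (\<xi> - z + s *\<^sub>R e) - k (\<xi> - z)) / s) \<longlongrightarrow> k' (\<xi> - z)) (at 0)"
          using der[of "\<xi> - z"] by (simp add: DERIV_def)
        then have "(\<lambda>n. (k (\<xi> - z + s n *\<^sub>R e) - k (\<xi> - z)) / s n) \<longlonglongrightarrow> k' (\<xi> - z)"
          using s unfolding tendsto_at_iff_sequentially comp_def by blast
        then show "(\<lambda>n. (k (\<xi> + s n *\<^sub>R e - z) - k (\<xi> - z)) / s n * f z) \<longlonglongrightarrow> k' (\<xi> - z) * f z"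
          by (intro tendsto_mult_right) (simp add: algebra_simps)
      qed
      show "(\<lambda>z. k' (\<xi> - z) * f z) \<in> borel_measurable lborel" using int(2)[of \<xi>] by auto
      show "(\<lambda>z. (k (\<xi> + s n *\<^sub>R e - z) - k (\<xi> - z)) / s n * f z) \<in> borel_measurable lborel" for n
        using f by measurable
    qed
    moreover have "(\<integral>z. (k (\<xi> + s n *\<^sub>R e - z) - k (\<xi> - z)) / s n * f z \<partial>lborel) =
      ((\<integral>z. k (\<xi> + s n *\<^sub>R e - z) * f z \<partial>lborel) - (\<integral>z. k (\<xi> - z) * f z \<partial>lborel)) / s n" for n
      by (subst Bochner_Integration.integral_diff[symmetric, OF int(1) int(1)])
         (simp add: algebra_simps diff_divide_distrib flip: integral_divide_zero)
    ultimately have "(\<lambda>n. ((\<integral>z. k (\<xi> + s n *\<^sub>R e - z) * f z \<partial>lborel) -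
        (\<integral>z. k (\<xi> - z) * f z \<partial>lborel)) / s n) \<longlonglongrightarrow> (\<integral>z. k' (\<xi> - z) * f z \<partial>lborel)"
      by (simp only:)
    then show "((\<lambda>h. ((\<integral>z. k (\<xi> + (0 + h) *\<^sub>R e - z) * f z \<partial>lborel) -
        (\<integral>z. k (\<xi> + 0 *\<^sub>R e - z) * f z \<partial>lborel)) / h) \<circ> s) \<longlonglongrightarrow> (\<integral>z. k' (\<xi> - z) * f z \<partial>lborel)"
      by (simp add: comp_def)
  qed
qed

section \<open>Continuity of translations in L1\<close>

definition L1_modulus :: "('a::euclidean_space \<Rightarrow> 'b::{banach, second_countable_topology}) \<Rightarrow> 'a \<Rightarrow> real" where
  "L1_modulus f z = (\<integral>x. norm (f (x + z) - f x) \<partial>lborel)"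

text \<open>The triangle inequality through \<open>g\<close>; by translation invariance the error
  \<open>f - g\<close> enters twice, once for each of the two points.\<close>

lemma L1_modulus_approx:
  fixes f g :: "'a::euclidean_space \<Rightarrow> 'b::{banach, second_countable_topology}"
  assumes f: "integrable lborel f" and g: "integrable lborel g"
  shows "L1_modulus f z \<le> L1_modulus g z + 2 * (\<integral>x. norm (f x - g x) \<partial>lborel)"
proof -
  note [simp] = f g integrable_lborel_translate[OF f] integrable_lborel_translate[OF g]
  have fg: "integrable lborel (\<lambda>x. norm (f x - g x))" by simp
  have "L1_modulus f z \<le> (\<integral>x. norm (g (x + z) - g x) + norm (f (x + z) - g (x + z)) + norm (f x - g x) \<partial>lborel)"
    unfolding L1_modulus_def
  proof (rule integral_mono)
    show "norm (f (x + z) - f x) \<le> norm (g (x + z) - g x) + norm (f (x + z) - g (x + z)) + norm (f x - g x)" for x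
      using norm_triangle_ineq4[of "(g (x + z) - g x) + (f (x + z) - g (x + z))" "f x - g x"]
        norm_triangle_ineq[of "g (x + z) - g x" "f (x + z) - g (x + z)"] by simp
  qed (auto simp: integrable_lborel_translate[OF fg])
  also have "\<dots> = L1_modulus g z + 2 * (\<integral>x. norm (f x - g x) \<partial>lborel)"
    using integral_lborel_translate[of "\<lambda>x. norm (f x - g x)" z] f g
    by (simp add: L1_modulus_def integrable_lborel_translate[OF fg])
  finally show ?thesis .
qed

lemma L1_modulus_nonneg: "0 \<le> L1_modulus f z"
  by (simp add: L1_modulus_def)

lemma L1_modulus_tendsto_approx:
  fixes f :: "'a::euclidean_space \<Rightarrow> 'b::{banach, second_countable_topology}"
  assumes f: "integrable lborel f"
    and ex: "\<And>e. e > 0 \<Longrightarrow> \<exists>g. integrable lborel g \<and> (L1_modulus g \<longlongrightarrow> 0) (at 0) \<and>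
       (\<integral>x. norm (f x - g x) \<partial>lborel) \<le> e"
  shows "(L1_modulus f \<longlongrightarrow> 0) (at 0)"
proof (rule tendstoI)
  fix e :: real assume e: "0 < e"
  obtain g where g: "integrable lborel g" "(L1_modulus g \<longlongrightarrow> 0) (at 0)"
    "(\<integral>x. norm (f x - g x) \<partial>lborel) \<le> e / 4" using ex[of "e / 4"] e by auto
  have "\<forall>\<^sub>F z in at 0. dist (L1_modulus g z) 0 < e / 2" using tendstoD[OF g(2), of "e/2"] e by simp
  then show "\<forall>\<^sub>F z in at 0. dist (L1_modulus f z) 0 < e"
  proof eventually_elim
    case (elim z)
    then show ?case using L1_modulus_approx[OF f g(1), of z] g(3) by (auto simp: L1_modulus_nonneg)
  qed
qed

text \<open>By translation invariance \<open>1\<^sub>U\<close> and its translate have equal integrals, so only the positive part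
  of their difference matters; for open \<open>U\<close> it tends to \<open>0\<close> pointwise and is dominated by \<open>1\<^sub>U\<close>.\<close>

lemma L1_modulus_open_tendsto:
  fixes U :: "'a::euclidean_space set" and c :: "'b::{banach, second_countable_topology}"
  assumes U: "open U" "emeasure lborel U < \<infinity>"
  shows "(L1_modulus (\<lambda>x. indicator U x *\<^sub>R c) \<longlongrightarrow> 0) (at 0)"
proof -
  let ?i = "indicator U :: 'a \<Rightarrow> real"
  have ii: "integrable lborel ?i" using U by auto
  note it = integrable_lborel_translate[OF ii]
  have [measurable]: "U \<in> sets borel" using U by auto
  have eq: "L1_modulus (\<lambda>x. indicator U x *\<^sub>R c) z = 2 * norm c * (\<integral>x. max 0 (?i x - ?i (x + z)) \<partial>lborel)" for z
  proof -
    have "norm (?i (x + z) *\<^sub>R c - ?i x *\<^sub>R c) =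
       norm c * (2 * max 0 (?i x - ?i (x + z)) + (?i (x + z) - ?i x))" for x
      by (auto simp: indicator_def)
    moreover have mi: "integrable lborel (\<lambda>x. max 0 (?i x - ?i (x + z)))"
      by (rule Bochner_Integration.integrable_bound[OF ii]) (auto simp: indicator_def)
    ultimately show ?thesis
      using integral_lborel_translate[of ?i z] ii it[of z]
      by (simp add: L1_modulus_def)
  qed
  have "((\<lambda>z. \<integral>x. max 0 (?i x - ?i (x + z)) \<partial>lborel) \<longlongrightarrow> 0) (at 0)"
    unfolding tendsto_at_iff_sequentially
  proof (intro allI impI)
    fix s :: "nat \<Rightarrow> 'a" assume s: "s \<longlonglongrightarrow> 0"
    have "(\<lambda>n. \<integral>x. max 0 (?i x - ?i (x + s n)) \<partial>lborel) \<longlonglongrightarrow> (\<integral>x. (0::real) \<partial>(lborel :: 'a measure))"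
    proof (rule integral_dominated_convergence[OF _ _ ii])
      show "AE x in lborel. (\<lambda>n. max 0 (?i x - ?i (x + s n))) \<longlonglongrightarrow> 0"
      proof (rule AE_I2)
        fix x
        show "(\<lambda>n. max 0 (?i x - ?i (x + s n))) \<longlonglongrightarrow> 0"
        proof (cases "x \<in> U")
          case True
          have "(\<lambda>n. x + s n) \<longlonglongrightarrow> x + 0" by (intro tendsto_intros s)
          then have "\<forall>\<^sub>F n in sequentially. x + s n \<in> U"
            using topological_tendstoD[OF _ U(1)] True by simp
          then show ?thesis by (intro tendsto_eventually) (auto elim!: eventually_mono simp: True)
        next
          case False
          then show ?thesis by (intro tendsto_eventually) (auto simp: indicator_def)
        qed
      qed
    qed (auto simp: indicator_def)
    then show "((\<lambda>z. \<integral>x. max 0 (?i x - ?i (x + z)) \<partial>lborel) \<circ> s) \<longlonglongrightarrow> 0" by (simp add: comp_def)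
  qed
  then show ?thesis unfolding eq[abs_def] by (rule tendsto_mult_right_zero)
qed

text \<open>Induction over integrable functions: a measurable set is replaced by an open superset
  through outer regularity, and limits are handled by approximation in L1.\<close>

lemma L1_modulus_tendsto:
  fixes f :: "'a::euclidean_space \<Rightarrow> 'b::{banach, second_countable_topology}"
  assumes "integrable lborel f"
  shows "(L1_modulus f \<longlongrightarrow> 0) (at 0)"
  using assms
proof (induction rule: integrable_induct)
  case (base A c)
  show ?case
  proof (rule L1_modulus_tendsto_approx)
    show "integrable lborel (\<lambda>x. indicator A x *\<^sub>R c)" using base by auto
    fix e :: real assume e: "0 < e"
    \<comment> \<open>The \<open>+ 1\<close> keeps the denominator positive when
      \<open>c = 0\<close>.\<close>
    define e' where "e' = e / (norm c + 1)"
    have e': "e' > 0" unfolding e'_def using e by (intro divide_pos_pos) (auto intro: add_nonneg_pos)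
    have AU: "A \<in> sets borel" using base by simp
    obtain U where U: "open U" "A \<subseteq> U" "emeasure lborel (U - A) < ennreal e'"
      using outer_regular_lborel[OF AU e'] by auto
    have [measurable]: "U \<in> sets borel" "A \<in> sets borel" using U AU by auto
    have "emeasure lborel U = emeasure lborel (U - A) + emeasure lborel A"
      using U(2) by (subst plus_emeasure) (auto simp: Un_absorb2)
    then have fU: "emeasure lborel U < \<infinity>" using U(3) base by (auto simp: less_top[symmetric])
    have fUA: "emeasure lborel (U - A) < \<infinity>" using U(3) by (auto simp: less_top[symmetric] top_unique)
    have "(\<integral>x. norm (indicator A x *\<^sub>R c - indicator U x *\<^sub>R c) \<partial>lborel) =
        (\<integral>x. indicator (U - A) x * norm c \<partial>lborel)"
      using U(2) by (intro Bochner_Integration.integral_cong) (auto simp: indicator_def)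
    also have "\<dots> = measure lborel (U - A) * norm c" using fUA by simp
    also have "\<dots> \<le> e' * norm c"
      using U(3) fUA e' by (intro mult_right_mono) (auto simp: emeasure_eq_ennreal_measure ennreal_less_iff)
    also have "\<dots> \<le> e" unfolding e'_def using e norm_ge_zero[of c]
      by (simp add: divide_le_eq mult_left_mono add_pos_nonneg del: norm_ge_zero)
    finally show "\<exists>g. integrable lborel g \<and> (L1_modulus g \<longlongrightarrow> 0) (at 0) \<and>
       (\<integral>x. norm (indicator A x *\<^sub>R c - g x) \<partial>lborel) \<le> e"
      using L1_modulus_open_tendsto[OF U(1) fU, of c] fU
      by (intro exI[of _ "\<lambda>x. indicator U x *\<^sub>R c"]) auto
  qed
next
  case (add f g)
  note [simp] = add(1,2) integrable_lborel_translate[OF add(1)] integrable_lborel_translate[OF add(2)]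
  have le: "L1_modulus (\<lambda>x. f x + g x) z \<le> L1_modulus f z + L1_modulus g z" for z
  proof -
    have "L1_modulus (\<lambda>x. f x + g x) z \<le> (\<integral>x. norm (f (x + z) - f x) + norm (g (x + z) - g x) \<partial>lborel)"
      unfolding L1_modulus_def
    proof (rule integral_mono)
      show "norm (f (x + z) + g (x + z) - (f x + g x)) \<le> norm (f (x + z) - f x) + norm (g (x + z) - g x)" for x
        using norm_triangle_ineq[of "f (x + z) - f x" "g (x + z) - g x"] by (simp add: algebra_simps)
    qed auto
    then show ?thesis by (simp add: L1_modulus_def)
  qed
  have "((\<lambda>z. L1_modulus f z + L1_modulus g z) \<longlongrightarrow> 0) (at 0)"
    using tendsto_add[OF add(3,4)] by simp
  then show ?case
    by (rule tendsto_sandwich[OF always_eventually always_eventually tendsto_const, rotated 2])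
       (auto simp: L1_modulus_nonneg le)
next
  case (lim f s)
  show ?case
  proof (rule L1_modulus_tendsto_approx[OF lim(4)])
    fix e :: real assume e: "0 < e"
    have "(\<lambda>i. \<integral>x. norm (f x - s i x) \<partial>lborel) \<longlonglongrightarrow> (\<integral>x. (0::real) \<partial>(lborel :: 'a measure))"
    \<comment> \<open>The factor 3 is 1 for \<open>f\<close> plus 2 for the approximating functions,
      which are bounded by \<open>2 * norm (f x)\<close>.\<close>
    proof (rule integral_dominated_convergence[where w = "\<lambda>x. 3 * norm (f x)"])
      show "AE x in lborel. (\<lambda>i. norm (f x - s i x)) \<longlonglongrightarrow> 0"
      proof (rule AE_I2)
        fix x
        have "(\<lambda>i. f x - s i x) \<longlonglongrightarrow> f x - f x" by (intro tendsto_intros lim(2)) simp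
        then show "(\<lambda>i. norm (f x - s i x)) \<longlonglongrightarrow> 0" by (intro tendsto_norm_zero) simp
      qed
      show "AE x in lborel. norm (norm (f x - s i x)) \<le> 3 * norm (f x)" for i
      proof (rule AE_I2)
        fix x
        show "norm (norm (f x - s i x)) \<le> 3 * norm (f x)"
          using lim(3)[of x i] norm_triangle_ineq4[of "f x" "s i x"] by simp
      qed
    qed (use lim(1,4) in auto)
    then have "\<forall>\<^sub>F i in sequentially. (\<integral>x. norm (f x - s i x) \<partial>lborel) < e"
      using e by (intro order_tendstoD) auto
    then obtain i where "(\<integral>x. norm (f x - s i x) \<partial>lborel) < e"
      unfolding eventually_sequentially by blast
    then show "\<exists>g. integrable lborel g \<and> (L1_modulus g \<longlongrightarrow> 0) (at 0) \<and>
       (\<integral>x. norm (f x - g x) \<partial>lborel) \<le> e"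
      using lim(1,5) by (intro exI[of _ "s i"]) auto
  qed
qed

section \<open>Mollified functions and their convergence\<close>

lemma mollifier_minus: "mollifier \<eta> (- z) = mollifier \<eta> z"
  by (simp add: mollifier_def std_bump_def)

lemma mollifier_bounded: 
  assumes "0 < \<eta>" obtains B where "\<And>z::'a::euclidean_space. \<bar>mollifier \<eta> z\<bar> \<le> B"
proof (rule continuous_compact_support_bounded[OF mollifier_continuous compact_cball[of 0 \<eta>]])
  show "mollifier \<eta> z = 0" if "z \<notin> cball (0::'a) \<eta>" for z
    by (rule mollifier_eq_0[OF assms]) (use that in simp)
qed (rule that)

lemma mollifier_derivative:
  assumes \<eta>: "0 < \<eta>"
  obtains m' B where "\<And>z::'a::euclidean_space. (mollifier \<eta> has_derivative (\<lambda>h. m' h z)) (at z)"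
    "\<And>h. continuous_on UNIV (m' h)" "\<And>h z. \<bar>m' h z\<bar> \<le> B h"
proof -
  have "(\<lambda>z::'a. mollifier \<eta> (0 - z)) \<in> bump_algebra" by (rule mollifier_bump_algebra)
  then have "(mollifier \<eta> :: 'a \<Rightarrow> real) \<in> bump_algebra" by (simp add: mollifier_minus)
  then obtain m' where m': "\<And>z::'a. (mollifier \<eta> has_derivative (\<lambda>h. m' h z)) (at z)"
    "\<And>h. m' h \<in> bump_algebra" using bump_algebra_has_derivative by blast
  have c: "continuous_on UNIV (m' h)" for h by (rule bump_algebra_continuous[OF m'(2)])
  note d = has_derivative_imp_directional[OF m'(1)]
  have z: "m' h z = 0" if "norm z > \<eta>" for h z
    by (rule integral_directional_derivative_eq_0(3)[where R = UNIV and K = "cball 0 \<eta>" and f = "mollifier \<eta>" and e = h])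
       (use that in \<open>auto intro: c d mollifier_continuous mollifier_eq_0[OF \<eta>]\<close>)
  have "\<exists>B. \<forall>z. \<bar>m' h z\<bar> \<le> B" for h
    by (rule continuous_compact_support_bounded[OF c[of h] compact_cball[of 0 \<eta>]]) (use z in auto)
  then obtain B where "\<And>h z. \<bar>m' h z\<bar> \<le> B h" by metis
  then show ?thesis using that m'(1) c by blast
qed

definition mollify :: "real \<Rightarrow> ('a::euclidean_space \<Rightarrow> 'b::{banach, second_countable_topology}) \<Rightarrow> 'a \<Rightarrow> 'b" where
  "mollify \<eta> f \<xi> = (\<integral>z. mollifier \<eta> (\<xi> - z) *\<^sub>R f z \<partial>lborel)"

lemma mollifier_scaleR_integrable:
  fixes f :: "'a::euclidean_space \<Rightarrow> 'b::{banach, second_countable_topology}"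
  assumes "0 < \<eta>" "integrable lborel f"
  shows "integrable lborel (\<lambda>z. mollifier \<eta> (\<xi> - z) *\<^sub>R f z)"
proof -
  obtain B where B: "\<And>z::'a. \<bar>mollifier \<eta> z\<bar> \<le> B" using mollifier_bounded[OF assms(1)] by blast
  have [measurable]: "mollifier \<eta> \<in> borel_measurable (borel :: 'a measure)"
    by (intro borel_measurable_continuous_onI mollifier_continuous)
  show ?thesis by (rule integrable_bounded_scaleR[OF assms(2), where B = B]) (auto simp: B)
qed

lemma mollify_continuous:
  fixes f :: "'a::euclidean_space \<Rightarrow> 'b::{banach, second_countable_topology}"
  assumes "0 < \<eta>" "integrable lborel f"
  shows "continuous_on UNIV (mollify \<eta> f)"
proof -
  obtain B where B: "\<And>z::'a. \<bar>mollifier \<eta> z\<bar> \<le> B" using mollifier_bounded[OF assms(1)] by blast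
  show ?thesis unfolding mollify_def[abs_def]
    by (rule continuous_on_convolution[OF assms(2) mollifier_continuous B])
qed

lemma mollifier_integral_reflected:
  assumes "0 < \<eta>" shows "(\<integral>z. mollifier \<eta> ((\<xi>::'a::euclidean_space) - z) \<partial>lborel) = 1"
    "integrable lborel (\<lambda>z. mollifier \<eta> (\<xi> - z))"
proof -
  have [measurable]: "mollifier \<eta> \<in> borel_measurable (borel :: 'a measure)"
    by (intro borel_measurable_continuous_onI mollifier_continuous)
  have eq: "mollifier \<eta> (\<xi> - z) = mollifier \<eta> (z + (- \<xi>))" for z
    using mollifier_minus[of \<eta> "\<xi> - z"] by simp
  show "(\<integral>z. mollifier \<eta> (\<xi> - z) \<partial>lborel) = 1"
    unfolding eq by (subst integral_lborel_translate) (auto simp: mollifier_integral assms)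
  show "integrable lborel (\<lambda>z. mollifier \<eta> (\<xi> - z))"
    unfolding eq by (rule integrable_lborel_translate[OF mollifier_integrable[OF assms]])
qed

lemma nn_integral_lborel_translate:
  fixes f :: "'a::euclidean_space \<Rightarrow> ennreal"
  assumes [measurable]: "f \<in> borel_measurable borel"
  shows "(\<integral>\<^sup>+x. f (x + z) \<partial>lborel) = (\<integral>\<^sup>+x. f x \<partial>lborel)"
proof -
  have "(\<integral>\<^sup>+x. f x \<partial>lborel) = (\<integral>\<^sup>+x. f x \<partial>distr lborel borel ((+) z))"
    by (simp add: lborel_distr_plus)
  also have "\<dots> = (\<integral>\<^sup>+x. f (z + x) \<partial>lborel)" by (rule nn_integral_distr) auto
  finally show ?thesis by (simp add: add.commute)
qed

text \<open>The error is an average of \<open>L1_modulus f\<close> over shifts shorter than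
  \<open>\<eta>\<close>. The estimate is run with nonnegative integrals, so that the order of
  integration may be exchanged without prior integrability; integrability of
  \<open>mollify \<eta> f\<close> then comes out as a by-product.\<close>

lemma mollify_L1_error:
  fixes f :: "'a::euclidean_space \<Rightarrow> 'b::{banach, second_countable_topology}"
  assumes \<eta>: "0 < \<eta>" and f: "integrable lborel f"
    and e: "\<And>z. norm z < \<eta> \<Longrightarrow> L1_modulus f z \<le> e" and e0: "0 \<le> e"
  shows "integrable lborel (mollify \<eta> f)" "(\<integral>x. norm (mollify \<eta> f x - f x) \<partial>lborel) \<le> e"
proof -
  let ?m = "mollifier \<eta> :: 'a \<Rightarrow> real"
  have [measurable]: "?m \<in> borel_measurable borel"
    by (intro borel_measurable_continuous_onI mollifier_continuous)
  have [measurable]: "f \<in> borel_measurable borel" using f by auto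
  have [measurable]: "mollify \<eta> f \<in> borel_measurable borel"
    by (intro borel_measurable_continuous_onI mollify_continuous \<eta> f)
  note mi = mollifier_scaleR_integrable[OF \<eta>] mollifier_integral_reflected[OF \<eta>]
  have le: "ennreal (norm (mollify \<eta> f \<xi> - f \<xi>)) \<le> (\<integral>\<^sup>+z. ennreal (?m (\<xi> - z) * norm (f z - f \<xi>)) \<partial>lborel)" for \<xi>
  proof -
    have i: "integrable lborel (\<lambda>z. ?m (\<xi> - z) *\<^sub>R (f z - f \<xi>))"
      using mi(1)[OF f, of \<xi>] mi(3)[of \<xi>] by (simp add: scaleR_diff_right)
    have "mollify \<eta> f \<xi> - f \<xi> = (\<integral>z. ?m (\<xi> - z) *\<^sub>R (f z - f \<xi>) \<partial>lborel)"
      using mi(1)[OF f, of \<xi>] mi(2,3)[of \<xi>] by (simp add: scaleR_diff_right mollify_def)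
    also have "norm \<dots> \<le> (\<integral>z. norm (?m (\<xi> - z) *\<^sub>R (f z - f \<xi>)) \<partial>lborel)"
      by (rule integral_norm_bound)
    finally have "norm (mollify \<eta> f \<xi> - f \<xi>) \<le> (\<integral>z. norm (?m (\<xi> - z) *\<^sub>R (f z - f \<xi>)) \<partial>lborel)" .
    then have "ennreal (norm (mollify \<eta> f \<xi> - f \<xi>)) \<le> ennreal (\<integral>z. norm (?m (\<xi> - z) *\<^sub>R (f z - f \<xi>)) \<partial>lborel)"
      by (rule ennreal_leI)
    also have "\<dots> = (\<integral>\<^sup>+z. ennreal (norm (?m (\<xi> - z) *\<^sub>R (f z - f \<xi>))) \<partial>lborel)"
      by (subst nn_integral_eq_integral[OF integrable_norm[OF i]]) auto
    finally show ?thesis by (simp add: mollifier_nonneg)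
  qed
  have "(\<integral>\<^sup>+\<xi>. ennreal (norm (mollify \<eta> f \<xi> - f \<xi>)) \<partial>lborel)
     \<le> (\<integral>\<^sup>+\<xi>. \<integral>\<^sup>+z. ennreal (?m (\<xi> - z) * norm (f z - f \<xi>)) \<partial>lborel \<partial>lborel)"
    by (intro nn_integral_mono le)
  also have "\<dots> = (\<integral>\<^sup>+z. \<integral>\<^sup>+\<xi>. ennreal (?m (\<xi> - z) * norm (f z - f \<xi>)) \<partial>lborel \<partial>lborel)"
    by (rule lborel_pair.Fubini') (measurable)
  also have "\<dots> = (\<integral>\<^sup>+z. \<integral>\<^sup>+y. ennreal (?m y * norm (f z - f (y + z))) \<partial>lborel \<partial>lborel)"
  proof (rule nn_integral_cong)
    fix z
    show "(\<integral>\<^sup>+\<xi>. ennreal (?m (\<xi> - z) * norm (f z - f \<xi>)) \<partial>lborel) =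
        (\<integral>\<^sup>+y. ennreal (?m y * norm (f z - f (y + z))) \<partial>lborel)"
      using nn_integral_lborel_translate[of "\<lambda>\<xi>. ennreal (?m (\<xi> - z) * norm (f z - f \<xi>))" z] by simp
  qed
  also have "\<dots> = (\<integral>\<^sup>+y. \<integral>\<^sup>+z. ennreal (?m y * norm (f z - f (y + z))) \<partial>lborel \<partial>lborel)"
    by (rule lborel_pair.Fubini') (measurable)
  also have "\<dots> \<le> (\<integral>\<^sup>+y. ennreal (?m y * e) \<partial>lborel)"
  proof (rule nn_integral_mono)
    fix y :: 'a
    have i: "integrable lborel (\<lambda>z. norm (f (z + y) - f z))"
      using f integrable_lborel_translate[OF f] by auto
    have "(\<integral>\<^sup>+z. ennreal (?m y * norm (f z - f (y + z))) \<partial>lborel) =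
       (\<integral>\<^sup>+z. ennreal (?m y * norm (f (z + y) - f z)) \<partial>lborel)"
      by (simp add: norm_minus_commute add.commute)
    also have "\<dots> = ennreal (\<integral>z. ?m y * norm (f (z + y) - f z) \<partial>lborel)"
      using i by (subst nn_integral_eq_integral) (auto simp: mollifier_nonneg)
    also have "\<dots> = ennreal (?m y * L1_modulus f y)"
      by (simp add: L1_modulus_def)
    also have "\<dots> \<le> ennreal (?m y * e)"
      using e[of y] mollifier_eq_0[OF \<eta>, of y]
      by (intro ennreal_leI) (cases "norm y < \<eta>"; simp add: mollifier_nonneg mult_left_mono)
    finally show "(\<integral>\<^sup>+z. ennreal (?m y * norm (f z - f (y + z))) \<partial>lborel) \<le> ennreal (?m y * e)" .
  qed
  also have "\<dots> = ennreal (\<integral>y. ?m y * e \<partial>lborel)"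
    using mollifier_integrable[OF \<eta>] e0 by (subst nn_integral_eq_integral) (auto simp: mollifier_nonneg)
  also have "\<dots> = ennreal e" by (simp add: mollifier_integral \<eta>)
  finally have *: "(\<integral>\<^sup>+\<xi>. ennreal (norm (mollify \<eta> f \<xi> - f \<xi>)) \<partial>lborel) \<le> ennreal e" .
  then have d: "integrable lborel (\<lambda>x. mollify \<eta> f x - f x)"
    by (intro integrableI_bounded) (auto simp: less_top[symmetric] top_unique)
  from Bochner_Integration.integrable_add[OF this f] show "integrable lborel (mollify \<eta> f)" by simp
  show "(\<integral>x. norm (mollify \<eta> f x - f x) \<partial>lborel) \<le> e"
    using * d e0 by (subst (asm) nn_integral_eq_integral) auto
qed

text \<open>Radii chosen from the modulus give convergence in L1, and a subsequence also converges
  almost everywhere. Both modes along one and the same sequence are what the Fatou argument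
  consumes.\<close>

lemma mollify_sequence:
  fixes f :: "'a::euclidean_space \<Rightarrow> 'b::{banach, second_countable_topology}"
  assumes f: "integrable lborel f" and r: "0 < r"
  obtains \<eta> where "\<And>n::nat. 0 < \<eta> n" "\<And>n. \<eta> n < r" "\<And>n. integrable lborel (mollify (\<eta> n) f)"
    "(\<lambda>n. \<integral>x. norm (mollify (\<eta> n) f x - f x) \<partial>lborel) \<longlonglongrightarrow> 0"
    "AE x in lborel. (\<lambda>n. mollify (\<eta> n) f x) \<longlonglongrightarrow> f x"
proof -
  have "\<exists>\<eta>>0. \<eta> < r \<and> (\<forall>z. norm z < \<eta> \<longrightarrow> L1_modulus f z \<le> 1 / real (Suc n))" for n
  proof -
    have "\<forall>\<^sub>F z in at 0. dist (L1_modulus f z) 0 < 1 / real (Suc n)"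
      by (rule tendstoD[OF L1_modulus_tendsto[OF f]]) auto
    then obtain d where d0: "d > 0" "\<And>z. z \<noteq> 0 \<Longrightarrow> dist z 0 < d \<Longrightarrow> dist (L1_modulus f z) 0 < 1 / real (Suc n)"
      unfolding eventually_at by blast
    then have d: "d > 0" "\<And>z. z \<noteq> 0 \<Longrightarrow> norm z < d \<Longrightarrow> L1_modulus f z < 1 / real (Suc n)"
      by (simp_all add: L1_modulus_nonneg)
    have "L1_modulus f z \<le> 1 / real (Suc n)" if "norm z < d" for z
      using d(2)[of z] that by (cases "z = 0") (auto simp: L1_modulus_def)
    then show ?thesis using d(1) r by (intro exI[of _ "min d (r/2)"]) auto
  qed
  then obtain \<eta> where \<eta>: "\<And>n. 0 < \<eta> n" "\<And>n. \<eta> n < r"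
    "\<And>n z. norm z < \<eta> n \<Longrightarrow> L1_modulus f z \<le> 1 / real (Suc n)" by metis
  have i: "integrable lborel (mollify (\<eta> n) f)" for n
    by (rule mollify_L1_error(1)[OF \<eta>(1) f \<eta>(3)]) auto
  have le: "(\<integral>x. norm (mollify (\<eta> n) f x - f x) \<partial>lborel) \<le> 1 / real (Suc n)" for n
    by (rule mollify_L1_error(2)[OF \<eta>(1) f \<eta>(3)]) auto
  have lim: "(\<lambda>n. \<integral>x. norm (mollify (\<eta> n) f x - f x) \<partial>lborel) \<longlonglongrightarrow> 0"
    by (rule tendsto_sandwich[OF always_eventually always_eventually tendsto_const LIMSEQ_Suc[OF lim_1_over_n]])
       (use le in auto)
  obtain s where s: "strict_mono (s :: nat \<Rightarrow> nat)" "AE x in lborel. (\<lambda>n. mollify (\<eta> (s n)) f x - f x) \<longlonglongrightarrow> 0"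
    using tendsto_L1_AE_subseq[of lborel "\<lambda>n x. mollify (\<eta> n) f x - f x"] i f lim by auto
  show ?thesis
  proof (rule that[of "\<eta> \<circ> s"])
    show "(\<lambda>n. \<integral>x. norm (mollify ((\<eta> \<circ> s) n) f x - f x) \<partial>lborel) \<longlonglongrightarrow> 0"
      using LIMSEQ_subseq_LIMSEQ[OF lim s(1)] by (simp add: comp_def)
    show "AE x in lborel. (\<lambda>n. mollify ((\<eta> \<circ> s) n) f x) \<longlonglongrightarrow> f x"
      using s(2) by eventually_elim (simp add: LIM_zero_iff)
  qed (use \<eta> i in auto)
qed

section \<open>Monotonicity of the flux and further estimates\<close>

definition pflux :: "real \<Rightarrow> 'a::real_normed_vector \<Rightarrow> 'a" where
  "pflux p v = norm v powr (p - 2) *\<^sub>R v"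

lemma norm_pflux: "norm (pflux p v) = norm v powr (p - 1)"
proof (cases "v = 0")
  case False
  then have "norm v powr (p - 2) * norm v powr 1 = norm v powr (p - 1)"
    by (subst powr_add[symmetric]) simp
  then show ?thesis using False by (simp add: pflux_def)
qed (simp add: pflux_def)

lemma norm_pflux_powr: "1 < p \<Longrightarrow> norm (pflux p v) powr (p / (p - 1)) = norm v powr p"
  by (simp add: norm_pflux powr_powr)

text \<open>Expanding the product and applying Cauchy-Schwarz to the mixed terms leaves the scalar
  expression \<open>(?A - ?B) * (norm a - norm b)\<close>, which is nonnegative because
  \<open>s powr (p - 1)\<close> increases with \<open>s\<close>.\<close>

lemma pflux_monotone:
  fixes a b :: "'a::real_inner"
  assumes "1 < p"
  shows "0 \<le> (pflux p a - pflux p b) \<bullet> (a - b)"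
proof -
  let ?A = "norm a powr (p - 1)" and ?B = "norm b powr (p - 1)"
  have 1: "pflux p v \<bullet> v = norm v powr (p - 1) * norm v" for v :: 'a
    using norm_pflux[of p v] by (simp add: pflux_def dot_square_norm power2_eq_square)
  have 2: "pflux p v \<bullet> w \<le> norm v powr (p - 1) * norm w" for v w :: 'a
    using norm_cauchy_schwarz[of "pflux p v" w] by (simp add: norm_pflux)
  have "(norm a \<le> norm b \<longrightarrow> ?A \<le> ?B) \<and> (norm b \<le> norm a \<longrightarrow> ?B \<le> ?A)"
    using assms by (auto intro!: powr_mono2)
  then have "0 \<le> (?A - ?B) * (norm a - norm b)"
    using linear[of "norm a" "norm b"] by (auto simp: zero_le_mult_iff)
  then show ?thesis
    using 1[of a] 1[of b] 2[of a b] 2[of b a] by (simp add: algebra_simps inner_diff_left inner_diff_right)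
qed

text \<open>Young's inequality with constants 1 in place of the optimal ones: depending on how
  \<open>y\<close> compares with \<open>x powr (p - 1)\<close>, one of the two terms alone dominates
  the product.\<close>

lemma mult_le_powr_add_powr:
  fixes x y p :: real
  assumes p: "1 < p" and "0 \<le> x" "0 \<le> y"
  shows "x * y \<le> x powr p + y powr (p / (p - 1))"
proof (cases "y \<le> x powr (p - 1)")
  case True
  have "x * y \<le> x * x powr (p - 1)" using True assms by (intro mult_left_mono) auto
  also have "\<dots> = x powr p" using assms by (cases "x = 0") (auto simp: powr_mult_base)
  finally show ?thesis by (simp add: add_increasing2)
next
  case False
  have "x = (x powr (p - 1)) powr (1 / (p - 1))" using assms by (simp add: powr_powr)
  also have "\<dots> \<le> y powr (1 / (p - 1))" using False p by (intro powr_mono2) auto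
  finally have "x * y \<le> y powr (1 / (p - 1)) * y" using assms by (intro mult_right_mono) auto
  also have "\<dots> = y powr (p / (p - 1))"
    using assms by (cases "y = 0") (auto simp: powr_mult_base mult.commute[of _ y] field_simps)
  finally show ?thesis by (simp add: add_increasing)
qed

lemma norm_diff_powr_le:
  fixes a b :: "'a::real_normed_vector"
  assumes "0 \<le> s"
  shows "norm (a - b) powr s \<le> 2 powr s * (norm a powr s + norm b powr s)"
proof -
  have "norm (a - b) powr s \<le> (2 * max (norm a) (norm b)) powr s"
    using assms norm_triangle_ineq4[of a b] by (intro powr_mono2) auto
  also have "\<dots> = 2 powr s * max (norm a) (norm b) powr s" by (simp add: powr_mult)
  also have "max (norm a) (norm b) powr s \<le> norm a powr s + norm b powr s"
    by (simp add: max_def)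
  finally show ?thesis by simp
qed

text \<open>Exponents start at 2, where the power of the positive part is differentiable at 0 as
  well. Squares serve as test functions and weights, cubes as primitives of the squares.\<close>

lemma DERIV_max_0_power:
  "((\<lambda>s. max 0 s ^ (k + 2)) has_real_derivative real (k + 2) * max 0 s ^ (k + 1)) (at (s::real))"
proof -
  consider "s > 0" | "s < 0" | "s = 0" by linarith
  then show ?thesis
  proof cases
    case 1
    have ev: "\<forall>\<^sub>F x in nhds s. max 0 x ^ (k + 2) = x ^ (k + 2)"
      using eventually_nhds_in_open[of "{0<..}" s] 1 by (auto elim!: eventually_mono)
    have "((\<lambda>x. x ^ (k + 2)) has_real_derivative real (k + 2) * s ^ (k + 1)) (at s)"
      using DERIV_pow[of "k + 2" s] by simp
    from DERIV_cong_ev[OF refl ev refl, THEN iffD2, OF this] show ?thesis using 1 by simp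
  next
    case 2
    have ev: "\<forall>\<^sub>F x in nhds s. max 0 x ^ (k + 2) = 0"
      using eventually_nhds_in_open[of "{..<0}" s] 2 by (auto elim!: eventually_mono)
    from DERIV_cong_ev[OF refl ev refl, THEN iffD2, OF DERIV_const] show ?thesis using 2 by simp
  next
    case 3
    have "((\<lambda>h::real. max 0 h ^ (k + 2) / h) \<longlongrightarrow> 0) (at 0)"
    proof (rule Lim_null_comparison)
      show "\<forall>\<^sub>F h in at 0. norm (max 0 h ^ (k + 2) / h) \<le> \<bar>h\<bar> ^ (k + 1)"
        by (rule always_eventually) (auto simp: max_def abs_mult power_abs[symmetric] mult_nonpos_nonneg)
      show "((\<lambda>h. \<bar>h\<bar> ^ (k + 1)) \<longlongrightarrow> 0) (at (0::real))" by (auto intro!: tendsto_eq_intros)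
    qed
    then show ?thesis using 3 by (simp add: DERIV_def)
  qed
qed

lemma DERIV_max_0_power_chain:
  assumes "(f has_real_derivative f') (at (s::real))"
  shows "((\<lambda>s. max 0 (f s) ^ (k + 2)) has_real_derivative real (k + 2) * max 0 (f s) ^ (k + 1) * f') (at s)"
  using DERIV_chain2[OF DERIV_max_0_power assms] .

lemma mollify_bounded_linear:
  fixes f :: "'a::euclidean_space \<Rightarrow> 'b::{banach, second_countable_topology}"
  assumes "bounded_linear T" "0 < \<eta>" "integrable lborel f"
  shows "T (mollify \<eta> f \<xi>) = mollify \<eta> (\<lambda>z. T (f z)) \<xi>"
  unfolding mollify_def
  using integral_bounded_linear[OF assms(1) mollifier_scaleR_integrable[OF assms(2,3), of \<xi>]]
  by (simp add: linear_simps(5)[OF assms(1)])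

lemma mollify_le_const:
  fixes f :: "'a::euclidean_space \<Rightarrow> real"
  assumes \<eta>: "0 < \<eta>" and f: "integrable lborel f" and le: "\<And>z. norm (\<xi> - z) < \<eta> \<Longrightarrow> f z \<le> c"
  shows "mollify \<eta> f \<xi> \<le> c"
proof -
  have "mollify \<eta> f \<xi> \<le> (\<integral>z. mollifier \<eta> (\<xi> - z) * c \<partial>lborel)"
    unfolding mollify_def
  proof (rule integral_mono)
    show "mollifier \<eta> (\<xi> - z) *\<^sub>R f z \<le> mollifier \<eta> (\<xi> - z) * c" for z
      using le[of z] mollifier_eq_0[OF \<eta>, of "\<xi> - z"]
      by (cases "norm (\<xi> - z) < \<eta>") (auto simp: mollifier_nonneg mult_left_mono)
  qed (use mollifier_scaleR_integrable[OF \<eta> f] mollifier_integral_reflected[OF \<eta>] in auto)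
  then show ?thesis by (simp add: mollifier_integral_reflected[OF \<eta>])
qed

lemma norm_mollify_le:
  assumes \<eta>: "0 < \<eta>" and f: "integrable lborel f"
  shows "norm (mollify \<eta> f \<xi>) \<le> mollify \<eta> (\<lambda>z. norm (f z)) \<xi>"
proof -
  have "norm (mollify \<eta> f \<xi>) \<le> (\<integral>z. norm (mollifier \<eta> (\<xi> - z) *\<^sub>R f z) \<partial>lborel)"
    unfolding mollify_def by (rule integral_norm_bound)
  then show ?thesis by (simp add: mollify_def mollifier_nonneg)
qed

text \<open>With Young's inequality for \<open>|x| |y|\<close> this dominates a product of mollifications by a mollified
  integrable function, so that no \<open>L\<^sup>p\<close>-convergence of mollifications is needed.\<close>

lemma mollify_mult_le:
  fixes f g A B :: "'a::euclidean_space \<Rightarrow> real"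
  assumes \<eta>: "0 < \<eta>" and i: "integrable lborel f" "integrable lborel g" "integrable lborel A" "integrable lborel B"
    and le: "\<And>x y. f x * g y \<le> A x + B y"
  shows "mollify \<eta> f \<xi> * mollify \<eta> g \<xi> \<le> mollify \<eta> A \<xi> + mollify \<eta> B \<xi>"
proof -
  note mi = mollifier_scaleR_integrable[OF \<eta>] mollifier_integral_reflected[OF \<eta>]
  have 1: "f x * mollify \<eta> g \<xi> \<le> A x + mollify \<eta> B \<xi>" for x
  proof -
    have "(\<integral>z. mollifier \<eta> (\<xi> - z) * (f x * g z) \<partial>lborel) \<le>
        (\<integral>z. mollifier \<eta> (\<xi> - z) * A x + mollifier \<eta> (\<xi> - z) * B z \<partial>lborel)"
    proof (rule integral_mono)
      show "mollifier \<eta> (\<xi> - z) * (f x * g z) \<le> mollifier \<eta> (\<xi> - z) * A x + mollifier \<eta> (\<xi> - z) * B z" for z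
        using mult_left_mono[OF le[of x z] mollifier_nonneg[of \<eta> "\<xi> - z"]] by (simp add: distrib_left)
      show "integrable lborel (\<lambda>z. mollifier \<eta> (\<xi> - z) * (f x * g z))"
        using mi(1)[OF i(2), of \<xi>] by (simp add: mult.left_commute)
      show "integrable lborel (\<lambda>z. mollifier \<eta> (\<xi> - z) * A x + mollifier \<eta> (\<xi> - z) * B z)"
        using mi(1)[OF i(4), of \<xi>] mi(3)[of \<xi>] by simp
    qed
    also have "\<dots> = A x + mollify \<eta> B \<xi>"
      using mi(1)[OF i(4), of \<xi>] mi(2,3)[of \<xi>] by (simp add: mollify_def)
    finally show ?thesis by (simp add: mollify_def mult.left_commute)
  qed
  have "(\<integral>z. mollifier \<eta> (\<xi> - z) * (f z * mollify \<eta> g \<xi>) \<partial>lborel) \<le>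
        (\<integral>z. mollifier \<eta> (\<xi> - z) * A z + mollifier \<eta> (\<xi> - z) * mollify \<eta> B \<xi> \<partial>lborel)"
  proof (rule integral_mono)
    show "mollifier \<eta> (\<xi> - z) * (f z * mollify \<eta> g \<xi>) \<le>
        mollifier \<eta> (\<xi> - z) * A z + mollifier \<eta> (\<xi> - z) * mollify \<eta> B \<xi>" for z
      using mult_left_mono[OF 1[of z] mollifier_nonneg[of \<eta> "\<xi> - z"]] by (simp add: distrib_left)
    show "integrable lborel (\<lambda>z. mollifier \<eta> (\<xi> - z) * (f z * mollify \<eta> g \<xi>))"
      using mi(1)[OF i(1), of \<xi>] by (simp add: mult.assoc[symmetric])
    show "integrable lborel (\<lambda>z. mollifier \<eta> (\<xi> - z) * A z + mollifier \<eta> (\<xi> - z) * mollify \<eta> B \<xi>)"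
      using mi(1)[OF i(3), of \<xi>] mi(3)[of \<xi>] by simp
  qed
  also have "\<dots> = mollify \<eta> A \<xi> + mollify \<eta> B \<xi>"
    using mi(1)[OF i(3), of \<xi>] mi(2,3)[of \<xi>] by (simp add: mollify_def)
  finally show ?thesis by (simp add: mollify_def mult.assoc[symmetric])
qed

section \<open>Energy estimate for the mollified equation\<close>

text \<open>Inserting this test function turns a weak equation in \<open>W\<close> into a pointwise
  equation at \<open>\<xi>\<close> for mollified functions.\<close>

lemma mollifier_test_function:
  fixes \<xi> :: "'a::euclidean_space"
  assumes "0 < \<eta>" "cball \<xi> \<eta> \<subseteq> W"
  shows "(\<lambda>z. mollifier \<eta> (\<xi> - z)) \<in> test_functions W"
proof -
  have "{z. mollifier \<eta> (\<xi> - z) \<noteq> 0} \<subseteq> cball \<xi> \<eta>"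
    using mollifier_eq_0[OF assms(1)] by (force simp: dist_norm)
  then have c: "closure {z. mollifier \<eta> (\<xi> - z) \<noteq> 0} \<subseteq> cball \<xi> \<eta>"
    by (rule closure_minimal) simp
  then have "compact (closure {z. mollifier \<eta> (\<xi> - z) \<noteq> 0})"
    using bounded_subset[OF bounded_cball] by (auto simp: compact_eq_bounded_closed)
  then show ?thesis
    using c assms(2) bump_algebra_C_diff[OF mollifier_bump_algebra]
    by (auto simp: test_functions_def compactly_contained_def)
qed

text \<open>The kernel is differentiated in the integration variable, whence the minus sign. In this
  form the expression is, up to sign, one side of a weak equation tested with
  \<open>mollifier \<eta> (\<xi> - z)\<close>.\<close>

definition mollify_deriv :: "real \<Rightarrow> 'a \<Rightarrow> ('a::euclidean_space \<Rightarrow> real) \<Rightarrow> 'a \<Rightarrow> real" where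
  "mollify_deriv \<eta> e f \<xi> = - (\<integral>z. frechet_derivative (\<lambda>z. mollifier \<eta> (\<xi> - z)) (at z) e * f z \<partial>lborel)"

lemma mollify_deriv:
  fixes f :: "'a::euclidean_space \<Rightarrow> real"
  assumes \<eta>: "0 < \<eta>" and f: "integrable lborel f"
  shows "((\<lambda>s. mollify \<eta> f (\<xi> + s *\<^sub>R e)) has_real_derivative mollify_deriv \<eta> e f \<xi>) (at 0)"
    "continuous_on UNIV (mollify_deriv \<eta> e f)"
proof -
  obtain m' B' where m': "\<And>z::'a. (mollifier \<eta> has_derivative (\<lambda>h. m' h z)) (at z)"
    "\<And>h. continuous_on UNIV (m' h)" "\<And>h z. \<bar>m' h z\<bar> \<le> B' h"
    using mollifier_derivative[OF \<eta>] by metis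
  obtain B where B: "\<And>z::'a. \<bar>mollifier \<eta> z\<bar> \<le> B" using mollifier_bounded[OF \<eta>] by blast
  have fr: "frechet_derivative (\<lambda>z. mollifier \<eta> (\<xi> - z)) (at z) e = - m' e (\<xi> - z)" for \<xi> z
  proof -
    have "((\<lambda>z. \<xi> - z) has_derivative (\<lambda>h. - h)) (at z)" by (auto intro!: derivative_eq_intros)
    from has_derivative_compose[OF this m'(1)]
    have "((\<lambda>z. mollifier \<eta> (\<xi> - z)) has_derivative (\<lambda>h. m' (- h) (\<xi> - z))) (at z)" .
    from frechet_derivative_at[OF this]
    have "frechet_derivative (\<lambda>z. mollifier \<eta> (\<xi> - z)) (at z) e = m' (- e) (\<xi> - z)" by metis
    then show ?thesis using linear_neg[OF has_derivative_linear[OF m'(1)]] by simp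
  qed
  have eq: "mollify_deriv \<eta> e f = (\<lambda>\<xi>. \<integral>z. m' e (\<xi> - z) * f z \<partial>lborel)"
    by (simp add: fun_eq_iff mollify_deriv_def fr)
  note d = has_derivative_imp_directional[OF m'(1)]
  have bounds: "\<bar>mollifier \<eta> z\<bar> \<le> max B (B' e)" "\<bar>m' e z\<bar> \<le> max B (B' e)" for z
    using B[of z] m'(3)[of e z] by auto
  show "((\<lambda>s. mollify \<eta> f (\<xi> + s *\<^sub>R e)) has_real_derivative mollify_deriv \<eta> e f \<xi>) (at 0)"
    using convolution_has_directional_derivative[OF f mollifier_continuous bounds(1) m'(2) bounds(2) d, of \<xi>]
    unfolding eq by (simp add: mollify_def[abs_def])
  show "continuous_on UNIV (mollify_deriv \<eta> e f)"
    using continuous_on_convolution[OF f m'(2)[of e] bounds(2)] unfolding eq by simp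
qed

text \<open>The weak forms of \<open>\<nabla>d = D\<close> and \<open>\<partial>\<^sub>t d = div F\<close> in \<open>W\<close>. Test functions from \<^const>\<open>bump_algebra\<close>
  suffice, and their time slices are again in that class.\<close>

definition weak_system ::
    "((real^'n) \<times> real) set \<Rightarrow> ((real^'n) \<times> real \<Rightarrow> real) \<Rightarrow> ((real^'n) \<times> real \<Rightarrow> real^'n) \<Rightarrow>
     ((real^'n) \<times> real \<Rightarrow> real^'n) \<Rightarrow> bool" where
  "weak_system W d D F \<longleftrightarrow> (\<forall>\<phi>\<in>test_functions W \<inter> bump_algebra.
     (\<forall>i. (\<integral>z. frechet_derivative \<phi> (at z) (axis i 1, 0) * d z \<partial>lborel) = - (\<integral>z. \<phi> z * D z $ i \<partial>lborel)) \<and>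
     (\<Sum>i\<in>UNIV. \<integral>z. frechet_derivative \<phi> (at z) (axis i 1, 0) * F z $ i \<partial>lborel) =
       (\<integral>z. frechet_derivative \<phi> (at z) (0, 1) * d z \<partial>lborel))"

lemma weak_systemD:
  assumes "weak_system W d D F" "\<phi> \<in> test_functions W" "\<phi> \<in> bump_algebra"
  shows "(\<integral>z. frechet_derivative \<phi> (at z) (axis i 1, 0) * d z \<partial>lborel) = - (\<integral>z. \<phi> z * D z $ i \<partial>lborel)"
    "(\<Sum>i\<in>UNIV. \<integral>z. frechet_derivative \<phi> (at z) (axis i 1, 0) * F z $ i \<partial>lborel) =
      (\<integral>z. frechet_derivative \<phi> (at z) (0, 1) * d z \<partial>lborel)"
  using assms unfolding weak_system_def by blast+

text \<open>In \<open>R\<close> the mollified functions satisfy the equation pointwise. It is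
  multiplied by \<open>Y\<close> and integrated by parts, in space against the flux and in time by
  means of the primitive \<open>X\<close>. The condition \<open>small\<close> keeps \<open>Y\<close>
  and \<open>X\<close> zero off the compact set \<open>K\<close>, so no boundary terms
  appear.\<close>

lemma energy_identity:
  fixes d :: "(real^'n) \<times> real \<Rightarrow> real" and D F :: "(real^'n) \<times> real \<Rightarrow> real^'n"
  assumes \<eta>: "0 < \<eta>" and d: "integrable lborel d" and D: "integrable lborel D" and F: "integrable lborel F"
    and R: "open R" and K: "compact K" "K \<subseteq> R" and RW: "\<And>\<xi>. \<xi> \<in> R \<Longrightarrow> cball \<xi> \<eta> \<subseteq> W"
    and sys: "weak_system W d D F"
    and small: "\<And>\<xi>. \<xi> \<in> R \<Longrightarrow> \<xi> \<notin> K \<Longrightarrow> snd \<xi> < T \<Longrightarrow> mollify \<eta> d \<xi> \<le> \<epsilon>"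
  shows "(\<integral>z. indicator R z * (2 * max 0 (T - snd z) * max 0 (mollify \<eta> d z - \<epsilon>) ^ 3) \<partial>lborel) =
    - (\<integral>z. indicator R z * (max 0 (T - snd z) ^ 2 * (6 * max 0 (mollify \<eta> d z - \<epsilon>)) *
         (mollify \<eta> D z \<bullet> mollify \<eta> F z)) \<partial>lborel)"
proof -
  let ?d = "mollify \<eta> d" and ?D = "mollify \<eta> D" and ?F = "mollify \<eta> F"
  let ?e = "\<lambda>i. (axis i 1, 0) :: (real^'n) \<times> real" and ?t = "(0, 1) :: (real^'n) \<times> real"
  have bl: "bounded_linear (\<lambda>v::real^'n. v $ i)" for i by (rule bounded_linear_vec_nth)
  have Di: "integrable lborel (\<lambda>z. D z $ i)" and Fi: "integrable lborel (\<lambda>z. F z $ i)" for i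
    using integrable_bounded_linear[OF bl D] integrable_bounded_linear[OF bl F] by auto
  have Dm: "?D \<xi> $ i = mollify \<eta> (\<lambda>z. D z $ i) \<xi>" and Fm: "?F \<xi> $ i = mollify \<eta> (\<lambda>z. F z $ i) \<xi>" for \<xi> i
    using mollify_bounded_linear[OF bl \<eta> D] mollify_bounded_linear[OF bl \<eta> F] by auto
  note test = mollifier_test_function[OF \<eta> RW] mollifier_bump_algebra
  define \<sigma> where "\<sigma> i = mollify_deriv \<eta> (?e i) (\<lambda>z. F z $ i)" for i
  define \<tau> where "\<tau> = mollify_deriv \<eta> ?t d"
  \<comment> \<open>The first half of \<open>weak_system\<close>, tested with the kernel centred at
    \<open>\<xi>\<close>, identifies the spatial gradient of the mollified \<open>d\<close> with the
    mollified \<open>D\<close>; this requires the ball of radius \<open>\<eta>\<close> about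
    \<open>\<xi>\<close> to lie in \<open>W\<close>.\<close>
  have dd: "((\<lambda>s. ?d (\<xi> + s *\<^sub>R ?e i)) has_real_derivative ?D \<xi> $ i) (at 0)" if "\<xi> \<in> R" for \<xi> i
  proof -
    have "mollify_deriv \<eta> (?e i) d \<xi> = ?D \<xi> $ i"
      using weak_systemD(1)[OF sys test(1)[OF that] test(2), of i]
      unfolding Dm by (simp add: mollify_deriv_def mollify_def)
    then show ?thesis using mollify_deriv(1)[OF \<eta> d, of \<xi> "?e i"] by simp
  qed
  have dF: "((\<lambda>s. ?F (\<xi> + s *\<^sub>R ?e i) $ i) has_real_derivative \<sigma> i \<xi>) (at 0)" for \<xi> i
    using mollify_deriv(1)[OF \<eta> Fi[of i], of \<xi> "?e i"] by (simp add: Fm \<sigma>_def)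
  have dt: "((\<lambda>s. ?d (\<xi> + s *\<^sub>R ?t)) has_real_derivative \<tau> \<xi>) (at 0)" for \<xi>
    using mollify_deriv(1)[OF \<eta> d, of \<xi> ?t] by (simp add: \<tau>_def)
  have \<sigma>\<tau>: "(\<Sum>i\<in>UNIV. \<sigma> i \<xi>) = \<tau> \<xi>" if "\<xi> \<in> R" for \<xi>
    using weak_systemD(2)[OF sys test(1)[OF that] test(2)] by (simp add: \<sigma>_def \<tau>_def mollify_deriv_def sum_negf)
  have c\<sigma>: "continuous_on R (\<sigma> i)" and c\<tau>: "continuous_on R \<tau>" for i
    using mollify_deriv(2)[OF \<eta> Fi[of i], of "?e i"] mollify_deriv(2)[OF \<eta> d, of ?t]
    by (auto simp: \<sigma>_def \<tau>_def intro: continuous_on_subset)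
  have cd: "continuous_on R ?d" and cD: "continuous_on R ?D" and cF: "continuous_on R ?F"
    using mollify_continuous[OF \<eta> d] mollify_continuous[OF \<eta> D] mollify_continuous[OF \<eta> F]
    by (auto intro: continuous_on_subset)
  \<comment> \<open>\<open>Y\<close> is the multiplier and \<open>Y' i\<close> its spatial
    derivatives. The time derivative of \<open>X\<close> is \<open>Y * \<tau> - X1\<close>, so the
    integral of \<open>Y * \<tau>\<close> equals that of \<open>X1\<close>, which comes from
    differentiating the weight.\<close>
  define Y where "Y z = max 0 (T - snd z) ^ 2 * (3 * max 0 (?d z - \<epsilon>) ^ 2)" for z
  define Y' where "Y' i z = max 0 (T - snd z) ^ 2 * (6 * max 0 (?d z - \<epsilon>)) * ?D z $ i" for i z
  define X where "X z = max 0 (T - snd z) ^ 2 * max 0 (?d z - \<epsilon>) ^ 3" for z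
  define X1 where "X1 z = 2 * max 0 (T - snd z) * max 0 (?d z - \<epsilon>) ^ 3" for z
  have 0: "Y z = 0" "X z = 0" "X1 z = 0" if "z \<in> R" "z \<notin> K" for z
    using small[OF that] by (cases "snd z < T"; simp add: Y_def X_def X1_def max_def)+
  have dY: "((\<lambda>s. Y (z + s *\<^sub>R ?e i)) has_real_derivative Y' i z) (at 0)" if "z \<in> R" for z i
  proof -
    have "((\<lambda>s. ?d (z + s *\<^sub>R ?e i) - \<epsilon>) has_real_derivative ?D z $ i) (at 0)"
      using dd[OF that, of i] by (auto intro!: derivative_eq_intros)
    from DERIV_max_0_power_chain[OF this, of 0]
    have "((\<lambda>s. max 0 (?d (z + s *\<^sub>R ?e i) - \<epsilon>) ^ 2) has_real_derivative 2 * max 0 (?d z - \<epsilon>) * ?D z $ i) (at 0)"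
      by (simp add: power2_eq_square zero_prod_def[symmetric])
    from DERIV_cmult[OF this, of "max 0 (T - snd z) ^ 2 * 3"] show ?thesis
      by (simp add: Y_def Y'_def algebra_simps)
  qed
  have dX: "((\<lambda>s. X (z + s *\<^sub>R ?t)) has_real_derivative (Y z * \<tau> z - X1 z)) (at 0)" for z
  proof -
    have "((\<lambda>s. ?d (z + s *\<^sub>R ?t) - \<epsilon>) has_real_derivative \<tau> z) (at 0)"
      using dt[of z] by (auto intro!: derivative_eq_intros)
    from DERIV_max_0_power_chain[OF this, of 1]
    have 1: "((\<lambda>s. max 0 (?d (z + s *\<^sub>R ?t) - \<epsilon>) ^ 3) has_real_derivative
        3 * max 0 (?d z - \<epsilon>) ^ 2 * \<tau> z) (at 0)" by (simp add: numeral_3_eq_3 numeral_2_eq_2 zero_prod_def[symmetric])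
    have "((\<lambda>s. T - (snd z + s)) has_real_derivative - 1) (at 0)" by (auto intro!: derivative_eq_intros)
    from DERIV_max_0_power_chain[OF this, of 0]
    have 2: "((\<lambda>s. max 0 (T - (snd z + s)) ^ 2) has_real_derivative - 2 * max 0 (T - snd z)) (at 0)"
      by (simp add: numeral_2_eq_2)
    have 3: "X (z + s *\<^sub>R ?t) = max 0 (T - (snd z + s)) ^ 2 * max 0 (?d (z + s *\<^sub>R ?t) - \<epsilon>) ^ 3" for s
      by (simp add: X_def)
    have 4: "Y z * \<tau> z - X1 z = - 2 * max 0 (T - snd z) * max 0 (?d (z + 0 *\<^sub>R ?t) - \<epsilon>) ^ 3 +
        3 * max 0 (?d z - \<epsilon>) ^ 2 * \<tau> z * max 0 (T - (snd z + 0)) ^ 2"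
      by (simp add: Y_def X1_def zero_prod_def[symmetric])
    show ?thesis unfolding 3 4 by (rule DERIV_mult[OF 2 1])
  qed
  note cont = continuous_intros cd cD cF c\<sigma> c\<tau>
  have cY: "continuous_on R Y" and cX: "continuous_on R X" and cX1: "continuous_on R X1"
    and cY': "continuous_on R (Y' i)" for i
    unfolding Y_def[abs_def] X_def[abs_def] X1_def[abs_def] Y'_def[abs_def] by (intro cont)+
  have cFi: "continuous_on R (\<lambda>z. ?F z $ i)" for i by (intro cont)
  note ibp = integration_by_parts_directional[OF R K 0(1) cY cFi cY' c\<sigma> dY dF]
  have cz: "continuous_on R (\<lambda>z. Y z * \<tau> z - X1 z)" by (intro cont cY cX1)
  have zero: "integrable lborel (\<lambda>z. indicator R z * (Y z * \<tau> z - X1 z))"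
    "(\<integral>z. indicator R z * (Y z * \<tau> z - X1 z) \<partial>lborel) = 0"
    by (rule integral_directional_derivative_eq_0(1,2)[OF R K _ cX cz dX], rule 0(2), assumption+)+
  have "max 0 (T - snd z) ^ 2 * (6 * max 0 (?d z - \<epsilon>)) * (?D z \<bullet> ?F z) = (\<Sum>i\<in>UNIV. Y' i z * ?F z $ i)" for z
    by (simp add: Y'_def inner_vec_def sum_distrib_left mult.assoc)
  then have "(\<integral>z. indicator R z * (max 0 (T - snd z) ^ 2 * (6 * max 0 (?d z - \<epsilon>)) * (?D z \<bullet> ?F z)) \<partial>lborel) =
    (\<integral>z. (\<Sum>i\<in>UNIV. indicator R z * (Y' i z * ?F z $ i)) \<partial>lborel)"
    by (simp add: sum_distrib_left)
  also have "\<dots> = (\<Sum>i\<in>UNIV. \<integral>z. indicator R z * (Y' i z * ?F z $ i) \<partial>lborel)"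
    by (rule Bochner_Integration.integral_sum) (rule ibp(1))
  also have "\<dots> = - (\<Sum>i\<in>UNIV. \<integral>z. indicator R z * (Y z * \<sigma> i z) \<partial>lborel)"
    by (simp add: ibp(3) sum_negf)
  also have "(\<Sum>i\<in>UNIV. \<integral>z. indicator R z * (Y z * \<sigma> i z) \<partial>lborel) =
      (\<integral>z. (\<Sum>i\<in>UNIV. indicator R z * (Y z * \<sigma> i z)) \<partial>lborel)"
    by (rule Bochner_Integration.integral_sum[symmetric]) (rule ibp(2))
  also have "\<dots> = (\<integral>z. indicator R z * (Y z * \<tau> z) \<partial>lborel)"
    by (intro Bochner_Integration.integral_cong)
       (auto simp: indicator_def sum_distrib_left[symmetric] \<sigma>\<tau>)
  also have "\<dots> = (\<integral>z. indicator R z * (Y z * \<tau> z - X1 z) + indicator R z * X1 z \<partial>lborel)"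
    by (simp add: algebra_simps)
  also have "\<dots> = (\<integral>z. indicator R z * X1 z \<partial>lborel)"
  proof -
    have "integrable lborel (\<lambda>z. indicator K z *\<^sub>R X1 z)"
      using K cX1 by (intro borel_integrable_compact) (auto intro: continuous_on_subset)
    also have "(\<lambda>z. indicator K z *\<^sub>R X1 z) = (\<lambda>z. indicator R z * X1 z)"
      using 0(3) K by (auto simp: fun_eq_iff indicator_def)
    finally show ?thesis using zero by simp
  qed
  finally show ?thesis by (simp add: X1_def)
qed

lemma compact_in_open_neighbourhood:
  fixes K0 :: "'a::heine_borel set"
  assumes K0: "compact K0" "K0 \<noteq> {}" "K0 \<subseteq> W" "open W" and \<delta>: "0 < \<delta>"
  obtains r where "0 < r" "r < \<delta>" "\<And>\<xi>. infdist \<xi> K0 < 2 * r \<Longrightarrow> cball \<xi> r \<subseteq> W"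
proof -
  obtain \<epsilon> where \<epsilon>: "\<epsilon> > 0" "(\<Union>x\<in>K0. ball x \<epsilon>) \<subseteq> W"
    using compact_subset_open_imp_ball_epsilon_subset[OF K0(1,4,3)] by blast
  \<comment> \<open>A point within \<open>2 * r\<close> of \<open>K0\<close>, moved by at most
    \<open>r\<close>, stays within \<open>3 * r \<le> \<epsilon>\<close> of
    \<open>K0\<close>.\<close>
  define r where "r = min (\<epsilon> / 3) (\<delta> / 2)"
  have r: "0 < r" "r < \<delta>" "3 * r \<le> \<epsilon>" using \<epsilon>(1) \<delta> by (auto simp: r_def)
  have "cball \<xi> r \<subseteq> W" if "infdist \<xi> K0 < 2 * r" for \<xi>
  proof
    fix z assume z: "z \<in> cball \<xi> r"
    obtain y where y: "y \<in> K0" "infdist \<xi> K0 = dist \<xi> y"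
      using infdist_attains_inf[OF compact_imp_closed[OF K0(1)] K0(2)] by metis
    have "dist y z < \<epsilon>"
      using dist_triangle[of y z \<xi>] z that y(2) r by (simp add: dist_commute)
    then have "z \<in> ball y \<epsilon>" by simp
    then show "z \<in> W" using \<epsilon>(2) y(1) by blast
  qed
  then show ?thesis using that r by blast
qed

text \<open>Fatou's lemma for the nonnegative functions \<open>a n + c n\<close>, with dominating
  functions that vary with \<open>n\<close> but whose integrals converge. Comparing with the
  integral of \<open>a'\<close> leaves the sign of \<open>L\<close>.\<close>

lemma nonneg_limit_of_energies:
  fixes a :: "nat \<Rightarrow> 'a::euclidean_space \<Rightarrow> real" and c :: "nat \<Rightarrow> 'a \<Rightarrow> real"
  assumes a: "\<And>n. integrable lborel (a n)" "integrable lborel a'"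
    "(\<lambda>n. \<integral>x. a n x \<partial>lborel) \<longlonglongrightarrow> (\<integral>x. a' x \<partial>lborel)" "AE x in lborel. (\<lambda>n. a n x) \<longlonglongrightarrow> a' x"
    and a0: "\<And>x. 0 \<le> a' x"
    and c: "\<And>n. c n \<in> borel_measurable lborel" "\<And>n x. \<bar>c n x\<bar> \<le> a n x"
    "AE x in lborel. (\<lambda>n. c n x) \<longlonglongrightarrow> c' x" "\<And>x. 0 \<le> c' x"
    and L: "(\<lambda>n. \<integral>x. c n x \<partial>lborel) \<longlonglongrightarrow> L"
  shows "0 \<le> L"
proof -
  have [measurable]: "a n \<in> borel_measurable lborel" "a' \<in> borel_measurable lborel" for n using a by auto
  have ci: "integrable lborel (c n)" for n
    by (rule Bochner_Integration.integrable_bound[OF a(1)[of n] c(1)])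
       (use c(2)[of n] in \<open>auto intro!: AE_I2 order_trans[OF c(2)]\<close>)
  have nn: "0 \<le> a n x + c n x" for n x using c(2)[of n x] by auto
  have lim: "AE x in lborel. (\<lambda>n. ennreal (a n x + c n x)) \<longlonglongrightarrow> ennreal (a' x + c' x)"
    using a(4) c(3) by eventually_elim (auto intro!: tendsto_ennrealI tendsto_intros)
  have "(\<integral>\<^sup>+x. ennreal (a' x) \<partial>lborel) \<le> (\<integral>\<^sup>+x. liminf (\<lambda>n. ennreal (a n x + c n x)) \<partial>lborel)"
  proof (rule nn_integral_mono_AE)
    show "AE x in lborel. ennreal (a' x) \<le> liminf (\<lambda>n. ennreal (a n x + c n x))"
      using lim
    proof eventually_elim
      case (elim x)
      then have "liminf (\<lambda>n. ennreal (a n x + c n x)) = ennreal (a' x + c' x)"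
        by (intro lim_imp_Liminf) auto
      then show ?case using c(4)[of x] by (simp add: ennreal_leI)
    qed
  qed
  also have "\<dots> \<le> liminf (\<lambda>n. \<integral>\<^sup>+x. ennreal (a n x + c n x) \<partial>lborel)"
    by (rule nn_integral_liminf) (use c(1) in measurable)
  also have "(\<lambda>n. \<integral>\<^sup>+x. ennreal (a n x + c n x) \<partial>lborel) = (\<lambda>n. ennreal ((\<integral>x. a n x \<partial>lborel) + (\<integral>x. c n x \<partial>lborel)))"
    using a(1) ci nn by (intro ext, subst nn_integral_eq_integral) auto
  also have "liminf \<dots> = ennreal ((\<integral>x. a' x \<partial>lborel) + L)"
    by (intro lim_imp_Liminf tendsto_ennrealI tendsto_add a(3) L) auto
  also have "(\<integral>\<^sup>+x. ennreal (a' x) \<partial>lborel) = ennreal (\<integral>x. a' x \<partial>lborel)"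
    using a(2) a0 by (subst nn_integral_eq_integral) auto
  finally have le: "ennreal (\<integral>x. a' x \<partial>lborel) \<le> ennreal ((\<integral>x. a' x \<partial>lborel) + L)" .
  \<comment> \<open>Since \<open>ennreal\<close> sends negative numbers to 0, \<open>le\<close> can
    be read back in the reals only once its right side is known to be nonnegative.\<close>
  have "0 \<le> (\<integral>x. a n x \<partial>lborel) + (\<integral>x. c n x \<partial>lborel)" for n
    using integral_nonneg_AE[of "\<lambda>x. a n x + c n x" lborel] nn a(1)[of n] ci[of n] by simp
  then have "0 \<le> (\<integral>x. a' x \<partial>lborel) + L"
    using LIMSEQ_le_const[OF tendsto_add[OF a(3) L]] by blast
  then show ?thesis using le by simp
qed

text \<open>In the limit the energy identity equates a nonnegative integral of
  \<open>(T - t)_+ (d - \<epsilon>)_+^3\<close> with a number that \<open>mono\<close> and Fatou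
  force to be at most 0, so the integrand vanishes almost everywhere. The bound by
  \<open>A x + B y\<close> takes two different points because mollification averages
  \<open>D\<close> and \<open>F\<close> independently.\<close>

lemma weak_subsolution_AE_le:
  fixes d :: "(real^'n) \<times> real \<Rightarrow> real" and D F :: "(real^'n) \<times> real \<Rightarrow> real^'n"
  assumes W: "open W" "bounded W" and d: "integrable lborel d" "\<And>z. \<bar>d z\<bar> \<le> M"
    and D: "integrable lborel D" and F: "integrable lborel F"
    and AB: "integrable lborel A" "integrable lborel B" "\<And>x y. norm (D x) * norm (F y) \<le> A x + B y"
    and mono: "\<And>z. 0 \<le> D z \<bullet> F z"
    and sys: "weak_system W d D F"
    and K0: "compact K0" "K0 \<subseteq> W" and T: "T < T'"
    and le: "\<And>z. z \<in> W \<Longrightarrow> snd z < T' \<Longrightarrow> z \<notin> K0 \<Longrightarrow> d z \<le> \<epsilon>"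
  shows "AE z in lborel. z \<in> W \<and> snd z < T \<longrightarrow> d z \<le> \<epsilon>"
proof (cases "K0 = {}")
  case True
  then show ?thesis using le T by (intro AE_I2) auto
next
  case False
  obtain r where r: "0 < r" "r < T' - T" "\<And>\<xi>. infdist \<xi> K0 < 2 * r \<Longrightarrow> cball \<xi> r \<subseteq> W"
    using compact_in_open_neighbourhood[OF K0(1) False K0(2) W(1), of "T' - T"] T by auto
  \<comment> \<open>For \<open>\<xi>\<close> in \<open>R\<close> outside \<open>K\<close>, a ball of
    radius \<open>\<eta> n < r\<close> misses \<open>K0\<close> and stays in \<open>W\<close>, so
    the mollified \<open>d\<close> is still at most \<open>\<epsilon>\<close> there. In time,
    \<open>r < T' - T\<close> leaves the same kind of room.\<close>
  define R where "R = {\<xi>. infdist \<xi> K0 < 2 * r}"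
  define K where "K = {\<xi>. infdist \<xi> K0 \<le> r}"
  have R: "open R" unfolding R_def by (intro open_Collect_less continuous_intros)
  have K: "compact K" unfolding K_def by (rule compact_infdist_le[OF False K0(1) r(1)])
  have KR: "K \<subseteq> R" using r(1) by (auto simp: K_def R_def)
  have RW: "R \<subseteq> W"
  proof
    fix \<xi> assume "\<xi> \<in> R"
    then show "\<xi> \<in> W" using r(3)[of \<xi>] r(1) by (auto simp: R_def)
  qed
  have [measurable]: "R \<in> sets borel" using R by auto
  have [measurable]: "(snd :: (real^'n) \<times> real \<Rightarrow> real) \<in> borel_measurable borel"
    by (intro borel_measurable_continuous_onI continuous_intros)
  \<comment> \<open>All functions are packed into one vector-valued function, so that a single
    sequence of radii serves them together. The sum \<open>A + B\<close> is included because its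
    mollifications dominate the products of gradient and flux.\<close>
  define f where "f z = (d z, D z, F z, A z + B z)" for z
  have fi: "integrable lborel f"
  proof -
    have 1: "integrable lborel (\<lambda>z. (d z, 0) :: real \<times> (real^'n) \<times> (real^'n) \<times> real)"
      by (rule integrable_bounded_linear[OF bounded_linear_Pair[OF bounded_linear_ident bounded_linear_zero] d(1)])
    have 2: "integrable lborel (\<lambda>z. (0, D z, 0) :: real \<times> (real^'n) \<times> (real^'n) \<times> real)"
      by (rule integrable_bounded_linear[OF bounded_linear_Pair[OF bounded_linear_zero
            bounded_linear_Pair[OF bounded_linear_ident bounded_linear_zero]] D])
    have 3: "integrable lborel (\<lambda>z. (0, 0, F z, 0) :: real \<times> (real^'n) \<times> (real^'n) \<times> real)"
      by (rule integrable_bounded_linear[OF bounded_linear_Pair[OF bounded_linear_zero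
            bounded_linear_Pair[OF bounded_linear_zero bounded_linear_Pair[OF bounded_linear_ident bounded_linear_zero]]] F])
    have 4: "integrable lborel (\<lambda>z. (0, 0, 0, A z + B z) :: real \<times> (real^'n) \<times> (real^'n) \<times> real)"
      by (rule integrable_bounded_linear[OF bounded_linear_Pair[OF bounded_linear_zero
            bounded_linear_Pair[OF bounded_linear_zero bounded_linear_Pair[OF bounded_linear_zero bounded_linear_ident]]]])
         (use AB in auto)
    from Bochner_Integration.integrable_add[OF 1 Bochner_Integration.integrable_add[OF 2 Bochner_Integration.integrable_add[OF 3 4]]]
    show ?thesis by (simp add: f_def[abs_def] zero_prod_def)
  qed
  obtain \<eta> where \<eta>: "\<And>n::nat. 0 < \<eta> n" "\<And>n. \<eta> n < r" and fint: "\<And>n. integrable lborel (mollify (\<eta> n) f)"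
    and fL1: "(\<lambda>n. \<integral>x. norm (mollify (\<eta> n) f x - f x) \<partial>lborel) \<longlonglongrightarrow> 0"
    and fAE: "AE x in lborel. (\<lambda>n. mollify (\<eta> n) f x) \<longlonglongrightarrow> f x"
    using mollify_sequence[OF fi r(1)] by blast
  define Ab where "Ab z = A z + B z" for z
  have Abi: "integrable lborel Ab" using AB by (simp add: Ab_def[abs_def])
  have comp: "mollify (\<eta> n) f x = (mollify (\<eta> n) d x, mollify (\<eta> n) D x, mollify (\<eta> n) F x, mollify (\<eta> n) Ab x)" for n x
  proof (intro prod_eqI; simp)
    note bls = bounded_linear_fst bounded_linear_compose[OF bounded_linear_fst bounded_linear_snd]
      bounded_linear_compose[OF bounded_linear_fst bounded_linear_compose[OF bounded_linear_snd bounded_linear_snd]]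
      bounded_linear_compose[OF bounded_linear_snd bounded_linear_compose[OF bounded_linear_snd bounded_linear_snd]]
    show "fst (mollify (\<eta> n) f x) = mollify (\<eta> n) d x"
      using mollify_bounded_linear[OF bls(1) \<eta>(1) fi, of n x] by (simp add: f_def[abs_def])
    show "fst (snd (mollify (\<eta> n) f x)) = mollify (\<eta> n) D x"
      using mollify_bounded_linear[OF bls(2) \<eta>(1) fi, of n x] by (simp add: f_def[abs_def])
    show "fst (snd (snd (mollify (\<eta> n) f x))) = mollify (\<eta> n) F x"
      using mollify_bounded_linear[OF bls(3) \<eta>(1) fi, of n x] by (simp add: f_def[abs_def])
    show "snd (snd (snd (mollify (\<eta> n) f x))) = mollify (\<eta> n) Ab x"
      using mollify_bounded_linear[OF bls(4) \<eta>(1) fi, of n x] by (simp add: f_def[abs_def] Ab_def[abs_def])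
  qed
  have AE: "AE x in lborel. (\<lambda>n. mollify (\<eta> n) d x) \<longlonglongrightarrow> d x \<and> (\<lambda>n. mollify (\<eta> n) D x) \<longlonglongrightarrow> D x \<and>
      (\<lambda>n. mollify (\<eta> n) F x) \<longlonglongrightarrow> F x \<and> (\<lambda>n. mollify (\<eta> n) Ab x) \<longlonglongrightarrow> Ab x"
    using fAE
  proof eventually_elim
    case (elim x)
    note c = tendsto_fst[OF elim] tendsto_fst[OF tendsto_snd[OF elim]]
      tendsto_fst[OF tendsto_snd[OF tendsto_snd[OF elim]]] tendsto_snd[OF tendsto_snd[OF tendsto_snd[OF elim]]]
    show ?case using c unfolding comp f_def Ab_def[of x] fst_conv snd_conv by blast
  qed
  have mm: "mollify (\<eta> n) d \<in> borel_measurable borel" "mollify (\<eta> n) D \<in> borel_measurable borel"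
    "mollify (\<eta> n) F \<in> borel_measurable borel" for n
    by (intro borel_measurable_continuous_onI mollify_continuous \<eta>(1) d(1) D F)+
  note [measurable] = mm
  have Abint: "integrable lborel (mollify (\<eta> n) Ab)" for n
    using integrable_bounded_linear[OF bounded_linear_compose[OF bounded_linear_snd bounded_linear_compose[OF bounded_linear_snd bounded_linear_snd]] fint[of n]]
    by (simp add: comp)
  have norm_4: "norm d \<le> norm (a, b, c, d)" for a :: real and b c :: "real^'n" and d :: real
  proof -
    have "norm d \<le> norm (c, d)" by (rule norm_snd_le)
    also have "\<dots> \<le> norm (b, c, d)" by (rule norm_snd_le)
    also have "\<dots> \<le> norm (a, b, c, d)" by (rule norm_snd_le)
    finally show ?thesis .
  qed
  have AbL1: "(\<lambda>n. \<integral>x. norm (mollify (\<eta> n) Ab x - Ab x) \<partial>lborel) \<longlonglongrightarrow> 0"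
  proof (rule Lim_null_comparison[OF always_eventually fL1], rule allI)
    fix n
    have "(\<integral>x. norm (mollify (\<eta> n) Ab x - Ab x) \<partial>lborel) \<le> (\<integral>x. norm (mollify (\<eta> n) f x - f x) \<partial>lborel)"
    proof (rule integral_mono)
      show "integrable lborel (\<lambda>x. norm (mollify (\<eta> n) Ab x - Ab x))"
        by (intro integrable_norm Bochner_Integration.integrable_diff Abint Abi)
      show "integrable lborel (\<lambda>x. norm (mollify (\<eta> n) f x - f x))"
        by (intro integrable_norm Bochner_Integration.integrable_diff fint fi)
      fix x
      show "norm (mollify (\<eta> n) Ab x - Ab x) \<le> norm (mollify (\<eta> n) f x - f x)"
        unfolding comp f_def Ab_def[of x] diff_Pair by (rule norm_4)
    qed
    then show "norm (\<integral>x. norm (mollify (\<eta> n) Ab x - Ab x) \<partial>lborel) \<le> (\<integral>x. norm (mollify (\<eta> n) f x - f x) \<partial>lborel)"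
      by simp
  qed
  obtain b where b: "\<And>z. z \<in> W \<Longrightarrow> norm z \<le> b" using W(2) unfolding bounded_iff by auto
  define Q where "Q = \<bar>T\<bar> + \<bar>b\<bar>"
  define C where "C = Q ^ 2 * (6 * (M + \<bar>\<epsilon>\<bar>))"
  have M0: "0 \<le> M" using d(2)[of 0] by auto
  have Q0: "0 \<le> Q" by (simp add: Q_def)
  have C0: "0 \<le> C" using M0 by (simp add: C_def)
  have Qb: "max 0 (T - snd z) \<le> Q" if "z \<in> R" for z
    using b[of z] RW that norm_snd_le[where x = "fst z" and y = "snd z"] by (auto simp: Q_def)
  have dM: "\<bar>mollify (\<eta> n) d x\<bar> \<le> M" for n x
  proof -
    have "\<bar>mollify (\<eta> n) d x\<bar> \<le> mollify (\<eta> n) (\<lambda>z. \<bar>d z\<bar>) x"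
      using norm_mollify_le[OF \<eta>(1)[of n] d(1), of x] by simp
    also have "\<dots> \<le> M" by (rule mollify_le_const[OF \<eta>(1)]) (use d in auto)
    finally show ?thesis .
  qed
  define k where "k dd z = indicator R z * (max 0 (T - snd z) ^ 2 * (6 * max 0 (dd - \<epsilon>)))" for dd z
  define l where "l dd z = indicator R z * (2 * max 0 (T - snd z) * max 0 (dd - \<epsilon>) ^ 3)" for dd z
  have k: "0 \<le> k dd z" "k dd z \<le> C * indicator R z" if "\<bar>dd\<bar> \<le> M" for dd z
  proof -
    show "0 \<le> k dd z" by (simp add: k_def)
    have "max 0 (T - snd z) ^ 2 * (6 * max 0 (dd - \<epsilon>)) \<le> C" if "z \<in> R"
      unfolding C_def using Qb[OF that] \<open>\<bar>dd\<bar> \<le> M\<close> M0 Q0 by (intro mult_mono power_mono) auto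
    then show "k dd z \<le> C * indicator R z" by (auto simp: k_def indicator_def)
  qed
  have prod: "norm (mollify (\<eta> n) D x) * norm (mollify (\<eta> n) F x) \<le> mollify (\<eta> n) Ab x" for n x
  proof -
    have "norm (mollify (\<eta> n) D x) * norm (mollify (\<eta> n) F x) \<le>
      mollify (\<eta> n) (\<lambda>z. norm (D z)) x * mollify (\<eta> n) (\<lambda>z. norm (F z)) x"
      by (intro mult_mono norm_mollify_le[OF \<eta>(1) D] norm_mollify_le[OF \<eta>(1) F] norm_ge_zero
          order_trans[OF norm_ge_zero norm_mollify_le[OF \<eta>(1) D]])
    also have "\<dots> \<le> mollify (\<eta> n) A x + mollify (\<eta> n) B x"
      by (rule mollify_mult_le[OF \<eta>(1)]) (use D F AB in auto)
    also have "\<dots> = mollify (\<eta> n) Ab x"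
      using mollifier_scaleR_integrable[OF \<eta>(1)[of n] AB(1), of x] mollifier_scaleR_integrable[OF \<eta>(1)[of n] AB(2), of x]
      by (simp add: mollify_def Ab_def distrib_left)
    finally show ?thesis .
  qed
  have small: "mollify (\<eta> n) d \<xi> \<le> \<epsilon>" if "\<xi> \<in> R" "\<xi> \<notin> K" "snd \<xi> < T" for \<xi> n
  proof (rule mollify_le_const[OF \<eta>(1) d(1)])
    fix z assume z: "norm (\<xi> - z) < \<eta> n"
    then have dz: "dist \<xi> z < r" using \<eta>(2)[of n] by (simp add: dist_norm)
    show "d z \<le> \<epsilon>"
    proof (rule le)
      have "infdist \<xi> K0 < 2 * r" using that(1) by (simp add: R_def)
      from r(3)[OF this] show "z \<in> W" using dz by (intro subsetD[of "cball \<xi> r" W]) simp_all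
      have "\<bar>snd \<xi> - snd z\<bar> \<le> dist \<xi> z" using dist_snd_le[of \<xi> z] by (simp add: dist_real_def)
      then show "snd z < T'" using that(3) dz r(2) by linarith
      show "z \<notin> K0"
      proof
        assume "z \<in> K0"
        then have "infdist \<xi> K0 \<le> dist \<xi> z" by (rule infdist_le)
        then show False using dz that(2) by (simp add: K_def)
      qed
    qed
  qed
  have energy: "(\<integral>z. l (mollify (\<eta> n) d z) z \<partial>lborel) =
     - (\<integral>z. k (mollify (\<eta> n) d z) z * (mollify (\<eta> n) D z \<bullet> mollify (\<eta> n) F z) \<partial>lborel)" for n
  proof -
    have "cball \<xi> (\<eta> n) \<subseteq> W" if "\<xi> \<in> R" for \<xi>
    proof -
      have "infdist \<xi> K0 < 2 * r" using that by (simp add: R_def)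
      then show ?thesis
        using order_trans[OF subset_cball[OF less_imp_le[OF \<eta>(2)[of n]]] r(3)] by blast
    qed
    from energy_identity[OF \<eta>(1) d(1) D F R K KR this sys small]
    show ?thesis by (simp add: l_def k_def mult.assoc)
  qed
  let ?L = "\<integral>z. l (d z) z \<partial>lborel"
  have Rfin: "emeasure lborel R < \<infinity>"
    using bounded_subset[OF W(2) RW] by (intro emeasure_bounded_finite)
  have [measurable]: "d \<in> borel_measurable borel" using d by auto
  have lbound: "\<bar>l dd z\<bar> \<le> 2 * Q * (M + \<bar>\<epsilon>\<bar>) ^ 3 * indicator R z" if "\<bar>dd\<bar> \<le> M" for dd z
  proof -
    have "2 * max 0 (T - snd z) * max 0 (dd - \<epsilon>) ^ 3 \<le> 2 * Q * (M + \<bar>\<epsilon>\<bar>) ^ 3" if "z \<in> R"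
      using Qb[OF that] \<open>\<bar>dd\<bar> \<le> M\<close> M0 Q0 by (intro mult_mono power_mono) auto
    then show ?thesis by (auto simp: l_def indicator_def)
  qed
  have Rint: "integrable lborel (\<lambda>z. 2 * Q * (M + \<bar>\<epsilon>\<bar>) ^ 3 * indicator R z)" using Rfin by simp
  have Llim: "(\<lambda>n. \<integral>z. l (mollify (\<eta> n) d z) z \<partial>lborel) \<longlonglongrightarrow> ?L"
  proof (rule integral_dominated_convergence[OF _ _ Rint])
    show "AE z in lborel. (\<lambda>n. l (mollify (\<eta> n) d z) z) \<longlonglongrightarrow> l (d z) z"
      using AE by eventually_elim (auto simp: l_def intro!: tendsto_intros)
    show "AE z in lborel. norm (l (mollify (\<eta> n) d z) z) \<le> 2 * Q * (M + \<bar>\<epsilon>\<bar>) ^ 3 * indicator R z" for n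
      using lbound[OF dM] by auto
  qed (auto simp: l_def)
  \<comment> \<open>The products of mollified gradient and flux have no sign for finite
    \<open>n\<close>. Their integrals are known from \<open>energy\<close>, they are dominated by
    \<open>C\<close> times the mollified \<open>Ab\<close>, and their pointwise limit is
    nonnegative.\<close>
  have L0: "0 \<le> - ?L"
  proof (rule nonneg_limit_of_energies)
    show "integrable lborel (\<lambda>z. C * (indicator R z * mollify (\<eta> n) Ab z))" for n
      using integrable_real_mult_indicator[of R lborel, OF _ Abint[of n]] by (simp add: mult.commute)
    show Ri: "integrable lborel (\<lambda>z. C * (indicator R z * Ab z))"
      using integrable_real_mult_indicator[of R lborel, OF _ Abi] by (simp add: mult.commute)
    have i1: "integrable lborel (\<lambda>z. indicator R z * mollify (\<eta> n) Ab z)" for n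
      using integrable_real_mult_indicator[of R lborel, OF _ Abint[of n]] by (simp add: mult.commute)
    have i2: "integrable lborel (\<lambda>z. indicator R z * Ab z)"
      using integrable_real_mult_indicator[of R lborel, OF _ Abi] by (simp add: mult.commute)
    have "(\<lambda>n. \<integral>z. indicator R z * mollify (\<eta> n) Ab z \<partial>lborel) \<longlonglongrightarrow> (\<integral>z. indicator R z * Ab z \<partial>lborel)"
    proof (rule tendsto_L1_int)
      show "(\<lambda>n. \<integral>\<^sup>+x. ennreal (norm (indicator R x * mollify (\<eta> n) Ab x - indicator R x * Ab x)) \<partial>lborel) \<longlonglongrightarrow> 0"
      proof (rule tendsto_sandwich[OF always_eventually always_eventually tendsto_const]; (intro allI)?)
        show "(\<lambda>n. ennreal (\<integral>x. norm (mollify (\<eta> n) Ab x - Ab x) \<partial>lborel)) \<longlonglongrightarrow> 0"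
          using tendsto_ennrealI[OF AbL1] by simp
        show "(\<integral>\<^sup>+x. ennreal (norm (indicator R x * mollify (\<eta> n) Ab x - indicator R x * Ab x)) \<partial>lborel)
           \<le> ennreal (\<integral>x. norm (mollify (\<eta> n) Ab x - Ab x) \<partial>lborel)" for n
        proof -
          have "(\<integral>\<^sup>+x. ennreal (norm (indicator R x * mollify (\<eta> n) Ab x - indicator R x * Ab x)) \<partial>lborel)
            \<le> (\<integral>\<^sup>+x. ennreal (norm (mollify (\<eta> n) Ab x - Ab x)) \<partial>lborel)"
            by (rule nn_integral_mono) (auto simp: indicator_def)
          also have "\<dots> = ennreal (\<integral>x. norm (mollify (\<eta> n) Ab x - Ab x) \<partial>lborel)"
            using Abint[of n] Abi by (intro nn_integral_eq_integral) auto
          finally show ?thesis .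
        qed
      qed simp
    qed (use i1 i2 in auto)
    from tendsto_mult_left[OF this, of C]
    show "(\<lambda>n. \<integral>z. C * (indicator R z * mollify (\<eta> n) Ab z) \<partial>lborel) \<longlonglongrightarrow> (\<integral>z. C * (indicator R z * Ab z) \<partial>lborel)"
      by simp
    show "AE z in lborel. (\<lambda>n. C * (indicator R z * mollify (\<eta> n) Ab z)) \<longlonglongrightarrow> C * (indicator R z * Ab z)"
      using AE by eventually_elim (auto intro!: tendsto_intros)
    have Ab0: "0 \<le> Ab z" for z
      using order_trans[OF _ AB(3)[of z z], of 0] by (simp add: Ab_def)
    show "0 \<le> C * (indicator R z * Ab z)" for z using Ab0 C0 by simp
    show "(\<lambda>z. k (mollify (\<eta> n) d z) z * (mollify (\<eta> n) D z \<bullet> mollify (\<eta> n) F z)) \<in> borel_measurable lborel" for n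
      unfolding k_def by measurable
    show "\<bar>k (mollify (\<eta> n) d z) z * (mollify (\<eta> n) D z \<bullet> mollify (\<eta> n) F z)\<bar> \<le> C * (indicator R z * mollify (\<eta> n) Ab z)" for n z
    proof -
      have "\<bar>k (mollify (\<eta> n) d z) z * (mollify (\<eta> n) D z \<bullet> mollify (\<eta> n) F z)\<bar> \<le> (C * indicator R z) * mollify (\<eta> n) Ab z"
        unfolding abs_mult using k[OF dM, of n z] C0
        by (intro mult_mono order_trans[OF Cauchy_Schwarz_ineq2 prod]) auto
      then show ?thesis by (simp add: mult.assoc)
    qed
    show "AE z in lborel. (\<lambda>n. k (mollify (\<eta> n) d z) z * (mollify (\<eta> n) D z \<bullet> mollify (\<eta> n) F z)) \<longlonglongrightarrow>
        k (d z) z * (D z \<bullet> F z)"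
      using AE by eventually_elim (auto simp: k_def intro!: tendsto_intros)
    show "0 \<le> k (d z) z * (D z \<bullet> F z)" for z using k(1)[OF d(2)] mono by simp
    show "(\<lambda>n. \<integral>z. k (mollify (\<eta> n) d z) z * (mollify (\<eta> n) D z \<bullet> mollify (\<eta> n) F z) \<partial>lborel) \<longlonglongrightarrow> - ?L"
      using tendsto_minus[OF Llim] by (simp add: energy)
  qed
  have l0: "0 \<le> l (d z) z" for z by (simp add: l_def)
  have li: "integrable lborel (\<lambda>z. l (d z) z)"
  proof (rule Bochner_Integration.integrable_bound[OF Rint])
    show "(\<lambda>z. l (d z) z) \<in> borel_measurable lborel" unfolding l_def by measurable
    show "AE z in lborel. norm (l (d z) z) \<le> norm (2 * Q * (M + \<bar>\<epsilon>\<bar>) ^ 3 * indicator R z)"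
    proof (rule AE_I2)
      fix z
      show "norm (l (d z) z) \<le> norm (2 * Q * (M + \<bar>\<epsilon>\<bar>) ^ 3 * indicator R z)"
        unfolding real_norm_def using lbound[OF d(2), of z z] by linarith
    qed
  qed
  have "0 \<le> ?L" by (rule Bochner_Integration.integral_nonneg_AE) (simp add: l0)
  with L0 have "?L = 0" by linarith
  then have "AE z in lborel. l (d z) z = 0"
    using integral_nonneg_eq_0_iff_AE[OF li] l0 by simp
  then show ?thesis
  proof eventually_elim
    case (elim z)
    show ?case
    proof (intro impI, elim conjE)
      assume z: "z \<in> W" "snd z < T"
      show "d z \<le> \<epsilon>"
      proof (cases "z \<in> R")
        case True
        then show ?thesis using elim z by (auto simp: l_def)
      next
        case False
        then have "z \<notin> K0" using r(1) by (auto simp: R_def)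
        then show ?thesis using le[OF z(1)] z(2) T by auto
      qed
    qed
  qed
qed

section \<open>Weak formulation on cylinders\<close>

lemma test_function_derivative:
  fixes \<phi> :: "'a::euclidean_space \<Rightarrow> real"
  assumes "\<phi> \<in> test_functions V"
  shows "(\<phi> has_derivative frechet_derivative \<phi> (at z)) (at z)"
    "e \<in> Basis \<Longrightarrow> continuous_on UNIV (\<lambda>z. frechet_derivative \<phi> (at z) e)"
    "continuous_on UNIV \<phi>" "compact (closure {z. \<phi> z \<noteq> 0})" "closure {z. \<phi> z \<noteq> 0} \<subseteq> V"
    "z \<notin> closure {z. \<phi> z \<noteq> 0} \<Longrightarrow> frechet_derivative \<phi> (at z) = (\<lambda>h. 0)"
proof -
  have C: "C_diff k \<phi>" for k using assms by (auto simp: test_functions_def)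
  show d: "(\<phi> has_derivative frechet_derivative \<phi> (at z)) (at z)" for z
    using C[of "Suc 0"] by (simp add: frechet_derivative_works)
  show "e \<in> Basis \<Longrightarrow> continuous_on UNIV (\<lambda>z. frechet_derivative \<phi> (at z) e)"
    using C[of "Suc 0"] by simp
  show "continuous_on UNIV \<phi>" using C[of 0] by simp
  show "compact (closure {z. \<phi> z \<noteq> 0})" "closure {z. \<phi> z \<noteq> 0} \<subseteq> V"
    using assms by (auto simp: test_functions_def compactly_contained_def)
  assume z: "z \<notin> closure {z. \<phi> z \<noteq> 0}"
  have "((\<lambda>z. 0) has_derivative frechet_derivative \<phi> (at z)) (at z)"
  proof (rule has_derivative_transform_within_open[OF d])
    show "open (- closure {z. \<phi> z \<noteq> 0})" by auto
    show "z \<in> - closure {z. \<phi> z \<noteq> 0}" using z by simp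
    show "\<phi> y = 0" if "y \<in> - closure {z. \<phi> z \<noteq> 0}" for y
      using that closure_subset[of "{z. \<phi> z \<noteq> 0}"] by auto
  qed
  from has_derivative_unique[OF this has_derivative_const] show "frechet_derivative \<phi> (at z) = (\<lambda>h. 0)" .
qed

lemma test_function_line_derivative:
  assumes "\<phi> \<in> test_functions V"
  shows "((\<lambda>s. \<phi> (z + s *\<^sub>R e)) has_real_derivative frechet_derivative \<phi> (at z) e) (at 0)"
  by (rule has_derivative_imp_directional[OF test_function_derivative(1)[OF assms]])

lemma test_function_bounded:
  assumes "\<phi> \<in> test_functions V"
  obtains B where "\<And>z. \<bar>\<phi> z\<bar> \<le> B" "\<And>z e. e \<in> Basis \<Longrightarrow> \<bar>frechet_derivative \<phi> (at z) e\<bar> \<le> B"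
proof -
  note t = test_function_derivative[OF assms]
  have b: "\<exists>B. \<forall>z. \<bar>g z\<bar> \<le> B" if "continuous_on UNIV g" "\<And>z. z \<notin> closure {z. \<phi> z \<noteq> 0} \<Longrightarrow> g z = 0"
    for g :: "'a \<Rightarrow> real"
    by (rule continuous_compact_support_bounded[OF that(1) t(4) that(2)]) auto
  have "\<phi> z = 0" if "z \<notin> closure {z. \<phi> z \<noteq> 0}" for z
    using that closure_subset[of "{z. \<phi> z \<noteq> 0}"] by auto
  then obtain B0 where B0: "\<And>z. \<bar>\<phi> z\<bar> \<le> B0" using b[OF t(3)] by blast
  have "\<forall>e\<in>Basis. \<exists>B. \<forall>z. \<bar>frechet_derivative \<phi> (at z) e\<bar> \<le> B"
    using b[OF t(2)] t(6) by auto
  then obtain B where B: "\<And>e z. e \<in> Basis \<Longrightarrow> \<bar>frechet_derivative \<phi> (at z) e\<bar> \<le> B e" by metis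
  have B_nonneg: "0 \<le> B e" if "e \<in> Basis" for e using B[OF that, of undefined] by linarith
  have B_le: "B e \<le> (\<Sum>e\<in>Basis. B e)" if "e \<in> Basis" for e
    using that B_nonneg by (intro member_le_sum) auto
  have sum_nonneg: "0 \<le> (\<Sum>e\<in>Basis. B e)" using B_nonneg by (intro sum_nonneg)
  have B0_nonneg: "0 \<le> B0" using B0[of undefined] by linarith
  show ?thesis
  proof (rule that[of "B0 + (\<Sum>e\<in>Basis. B e)"])
    show "\<bar>\<phi> z\<bar> \<le> B0 + (\<Sum>e\<in>Basis. B e)" for z
      using B0[of z] sum_nonneg by linarith
    show "\<bar>frechet_derivative \<phi> (at z) e\<bar> \<le> B0 + (\<Sum>e\<in>Basis. B e)" if "e \<in> Basis" for z e
      using B[OF that, of z] B_le[OF that] B0_nonneg by linarith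
  qed
qed

lemma space_dir_Basis: "(axis i 1, 0) \<in> (Basis :: ((real^'n) \<times> real) set)"
  and time_dir_Basis: "(0, 1) \<in> (Basis :: ((real^'n) \<times> real) set)"
  by (auto simp: Basis_prod_def Basis_vec_def)

lemma slice_gradient:
  fixes \<phi> :: "(real^'n) \<times> real \<Rightarrow> real"
  assumes "\<phi> \<in> test_functions V"
  shows "gradient (\<lambda>y. \<phi> (y, t)) x = (\<chi> i. frechet_derivative \<phi> (at (x, t)) (axis i 1, 0))"
    "deriv (\<lambda>s. \<phi> (x, s)) t = frechet_derivative \<phi> (at (x, t)) (0, 1)"
proof -
  have "((\<lambda>y. (y, t)) has_derivative (\<lambda>h. (h, 0))) (at x)" by (auto intro!: derivative_eq_intros)
  from has_derivative_compose[OF this test_function_derivative(1)[OF assms]]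
  have "((\<lambda>y. \<phi> (y, t)) has_derivative (\<lambda>h. frechet_derivative \<phi> (at (x, t)) (h, 0))) (at x)" .
  from frechet_derivative_at[OF this]
  have "frechet_derivative (\<lambda>y. \<phi> (y, t)) (at x) = (\<lambda>h. frechet_derivative \<phi> (at (x, t)) (h, 0))" by (rule sym)
  then show "gradient (\<lambda>y. \<phi> (y, t)) x = (\<chi> i. frechet_derivative \<phi> (at (x, t)) (axis i 1, 0))"
    by (simp add: gradient_def)
  have "((\<lambda>s. (x, s)) has_derivative (\<lambda>h. (0, h))) (at t)" by (auto intro!: derivative_eq_intros)
  from has_derivative_compose[OF this test_function_derivative(1)[OF assms]]
  have d: "((\<lambda>s. \<phi> (x, s)) has_derivative (\<lambda>h. frechet_derivative \<phi> (at (x, t)) (0, h))) (at t)" .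
  have l: "(\<lambda>h. frechet_derivative \<phi> (at (x, t)) (0, h)) = (\<lambda>h. frechet_derivative \<phi> (at (x, t)) (0, 1) * h)"
  proof
    fix h
    show "frechet_derivative \<phi> (at (x, t)) (0, h) = frechet_derivative \<phi> (at (x, t)) (0, 1) * h"
      using linear_scale[OF has_derivative_linear[OF test_function_derivative(1)[OF assms, of "(x, t)"]], of h "(0, 1)"]
      by simp
  qed
  have "((\<lambda>s. \<phi> (x, s)) has_real_derivative frechet_derivative \<phi> (at (x, t)) (0, 1)) (at t)"
    using d unfolding l has_field_derivative_def .
  then show "deriv (\<lambda>s. \<phi> (x, s)) t = frechet_derivative \<phi> (at (x, t)) (0, 1)" by (rule DERIV_imp_deriv)
qed

lemma bump_algebra_slice:
  fixes f :: "'a::euclidean_space \<times> real \<Rightarrow> real"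
  assumes "f \<in> bump_algebra"
  shows "(\<lambda>x. f (x, t)) \<in> bump_algebra"
  using assms
proof (induction rule: bump_algebra.induct)
  case (inner v)
  have "(\<lambda>x. (x, t) \<bullet> v) = (\<lambda>x. x \<bullet> fst v + t * snd v)" by (cases v) (simp add: fun_eq_iff)
  also have "\<dots> \<in> bump_algebra" by (intro bump_algebra.intros)
  finally show ?case .
qed (assumption | rule bump_algebra.intros)+

lemma slice_test_function:
  fixes \<phi> :: "(real^'n) \<times> real \<Rightarrow> real"
  assumes "\<phi> \<in> test_functions (U \<times> I)" "\<phi> \<in> bump_algebra"
  shows "(\<lambda>x. \<phi> (x, t)) \<in> test_functions U"
proof -
  note t = test_function_derivative[OF assms(1)]
  let ?C = "closure {z. \<phi> z \<noteq> 0}"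
  have c: "compact (fst ` ?C)" by (intro compact_continuous_image continuous_intros t(4))
  have "{x. \<phi> (x, t) \<noteq> 0} \<subseteq> fst ` ?C"
  proof
    fix x assume "x \<in> {x. \<phi> (x, t) \<noteq> 0}"
    then have "(x, t) \<in> ?C" by (intro subsetD[OF closure_subset]) simp
    from imageI[OF this, of fst] show "x \<in> fst ` ?C" by simp
  qed
  then have s: "closure {x. \<phi> (x, t) \<noteq> 0} \<subseteq> fst ` ?C"
    using compact_imp_closed[OF c] by (rule closure_minimal)
  then have "compact (closure {x. \<phi> (x, t) \<noteq> 0})"
    using compact_imp_bounded[OF c] bounded_subset by (auto simp: compact_eq_bounded_closed)
  moreover have "fst ` ?C \<subseteq> U" using t(5) by (auto dest: subsetD)
  then have "closure {x. \<phi> (x, t) \<noteq> 0} \<subseteq> U" by (rule order_trans[OF s])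
  ultimately show ?thesis
    using bump_algebra_C_diff[OF bump_algebra_slice[OF assms(2)]]
    by (auto simp: test_functions_def compactly_contained_def)
qed

lemma integral_lborel_snd:
  fixes f :: "'a::euclidean_space \<times> 'b::euclidean_space \<Rightarrow> 'c::{banach, second_countable_topology}"
  assumes "integrable lborel f"
  shows "(\<integral>t. \<integral>x. f (x, t) \<partial>lborel \<partial>lborel) = (\<integral>z. f z \<partial>lborel)"
proof -
  have "integrable (lborel \<Otimes>\<^sub>M lborel) (\<lambda>(x, t). f (x, t))" using assms by (simp add: lborel_prod)
  from lborel_pair.integral_snd[OF this] show ?thesis by (simp add: lborel_prod)
qed

lemma integrable_lborel_snd:
  fixes f :: "'a::euclidean_space \<times> 'b::euclidean_space \<Rightarrow> 'c::{banach, second_countable_topology}"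
  assumes "integrable lborel f"
  shows "integrable lborel (\<lambda>t. \<integral>x. f (x, t) \<partial>lborel)"
proof -
  have "integrable (lborel \<Otimes>\<^sub>M lborel) (\<lambda>(x, t). f (x, t))" using assms by (simp add: lborel_prod)
  from lborel_pair.integrable_snd[OF this] show ?thesis .
qed

text \<open>The definition gives the gradient identity slice by slice for almost every time and the
  equation as an iterated integral. Fubini's theorem turns both into integrals over space-time, with
  all functions cut off to zero outside \<open>W\<close> so that mollification is defined
  everywhere.\<close>

lemma p_parabolic_weak_form:
  fixes h :: "(real^'n) \<times> real \<Rightarrow> real"
  assumes h: "p_parabolic p \<Theta> h" and p: "1 < p" and U: "open U" and t12: "t1 < t2"
    and W: "W = U \<times> {t1<..<t2}" "W \<Subset> \<Theta>"
  obtains g M where "integrable lborel (\<lambda>z. indicator W z * h z)" "\<And>z. \<bar>indicator W z * h z\<bar> \<le> M"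
    "integrable lborel g" "integrable lborel (\<lambda>z. norm (g z) powr p)" "integrable lborel (\<lambda>z. pflux p (g z))"
    "weak_system W (\<lambda>z. indicator W z * h z) g (\<lambda>z. pflux p (g z))"
proof -
  let ?I = "{t1<..<t2}"
  have "U \<times> ?I \<Subset> \<Theta>" using W by simp
  with U t12 have "open U \<and> t1 < t2 \<and> U \<times> ?I \<Subset> \<Theta>" by blast
  from h[unfolded p_parabolic_def, THEN conjunct2, THEN spec, THEN spec, THEN spec, THEN mp, OF this]
  obtain G where G: "parabolic_sobolev p U t1 t2 h G" and
    eq: "\<And>\<phi>. \<phi> \<in> test_functions (U \<times> ?I) \<Longrightarrow>
      (LINT t:?I|lborel. LINT x:U|lborel.
         (norm (G (x, t)) powr (p - 2) *\<^sub>R G (x, t)) \<bullet> gradient (\<lambda>y. \<phi> (y, t)) x)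
      - (LINT t:?I|lborel. LINT x:U|lborel. h (x, t) * deriv (\<lambda>s. \<phi> (x, s)) t) = 0"
    by (elim conjE exE, blast)
  have ind: "indicator W (x, t) = (indicator U x * indicator ?I t :: real)" for x t
    by (auto simp: W(1) indicator_def)
  have oW: "open W" unfolding W(1) by (intro open_Times U) auto
  have cW: "compact (closure W)" "closure W \<subseteq> \<Theta>" using W(2) by (auto simp: compactly_contained_def)
  have bW: "bounded W" using bounded_subset[OF compact_imp_bounded[OF cW(1)] closure_subset] .
  have Wfin: "emeasure lborel W < \<infinity>" by (rule emeasure_bounded_finite[OF bW])
  have [measurable]: "W \<in> sets borel" using oW by auto
  define g where "g z = indicator W z *\<^sub>R G z" for z
  define hW where "hW z = indicator W z * h z" for z
  have gm [measurable]: "g \<in> borel_measurable borel" and hm [measurable]: "hW \<in> borel_measurable borel"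
    and gp: "integrable lborel (\<lambda>z. norm (g z) powr p)"
  proof -
    have *: "G \<in> Lp p W" "h \<in> Lp p W" using G by (auto simp: parabolic_sobolev_def W(1))
    then show "g \<in> borel_measurable borel" "hW \<in> borel_measurable borel"
      by (simp_all add: Lp_def set_borel_measurable_def g_def[abs_def] hW_def[abs_def])
    have "integrable lborel (\<lambda>z. indicator W z *\<^sub>R norm (G z) powr p)"
      using * by (simp add: Lp_def set_integrable_def)
    also have "(\<lambda>z. indicator W z *\<^sub>R norm (G z) powr p) = (\<lambda>z. norm (g z) powr p)"
      using p by (auto simp: g_def indicator_def fun_eq_iff)
    finally show "integrable lborel (\<lambda>z. norm (g z) powr p)" .
  qed
  have dom: "integrable lborel (\<lambda>z. indicator W z + norm (g z) powr p)" using Wfin gp by auto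
  \<comment> \<open>Since \<open>W\<close> has finite measure, integrability of \<open>|g|^p\<close>
    yields that of \<open>|g|\<close> and of the flux, whose size is
    \<open>|g|^(p-1)\<close>.\<close>
  have powr_le: "x powr s \<le> 1 + x powr p" if "0 \<le> x" "0 \<le> s" "s \<le> p" for x s :: real
  proof (cases "x \<le> 1")
    case True
    then have "x powr s \<le> 1" using that by (intro powr_le1) auto
    then show ?thesis by (simp add: add_increasing2)
  next
    case False
    then have "x powr s \<le> x powr p" using that by (intro powr_mono) auto
    then show ?thesis by simp
  qed
  have g_out: "z \<notin> W \<Longrightarrow> g z = 0" for z by (simp add: g_def)
  have gi: "integrable lborel g"
  proof (rule Bochner_Integration.integrable_bound[OF dom])
    have "norm (g z) \<le> indicator W z + norm (g z) powr p" for z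
      using powr_le[of "norm (g z)" 1] p g_out[of z] by (cases "z \<in> W") auto
    then show "AE z in lborel. norm (g z) \<le> norm (indicator W z + norm (g z) powr p)" by auto
  qed simp
  have pgi: "integrable lborel (\<lambda>z. pflux p (g z))"
  proof (rule Bochner_Integration.integrable_bound[OF dom])
    have "norm (pflux p (g z)) \<le> indicator W z + norm (g z) powr p" for z
      using powr_le[of "norm (g z)" "p - 1"] p g_out[of z] unfolding norm_pflux by (cases "z \<in> W") auto
    then show "AE z in lborel. norm (pflux p (g z)) \<le> norm (indicator W z + norm (g z) powr p)" by auto
    show "(\<lambda>z. pflux p (g z)) \<in> borel_measurable lborel" unfolding pflux_def by measurable
  qed
  obtain M where M: "\<And>z. \<bar>hW z\<bar> \<le> M"
  proof -
    have "compact (h ` closure W)"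
      using h cW by (intro compact_continuous_image) (auto simp: p_parabolic_def intro: continuous_on_subset)
    from compact_imp_bounded[OF this] obtain B where B: "\<forall>x\<in>h ` closure W. norm x \<le> B"
      unfolding bounded_iff by blast
    have "\<bar>hW z\<bar> \<le> max B 0" for z
    proof (cases "z \<in> W")
      case True
      then have "norm (h z) \<le> B" using B closure_subset[of W] by blast
      then show ?thesis using True by (simp add: hW_def)
    qed (simp add: hW_def)
    then show ?thesis using that by blast
  qed
  have hi: "integrable lborel hW"
  proof (rule Bochner_Integration.integrable_bound)
    show "integrable lborel (\<lambda>z. M * indicator W z)" using Wfin by simp
    show "AE z in lborel. norm (hW z) \<le> norm (M * indicator W z)"
    proof (rule AE_I2)
      fix z
      show "norm (hW z) \<le> norm (M * indicator W z)"
        using M[of z] by (cases "z \<in> W") (auto simp: hW_def)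
    qed
  qed simp
  show ?thesis
  proof (rule that[of M g])
    show "integrable lborel (\<lambda>z. indicator W z * h z)" "\<And>z. \<bar>indicator W z * h z\<bar> \<le> M"
      using hi M by (auto simp: hW_def[abs_def])
    show "integrable lborel g" "integrable lborel (\<lambda>z. norm (g z) powr p)" "integrable lborel (\<lambda>z. pflux p (g z))"
      by (fact gi gp pgi)+
    show "weak_system W (\<lambda>z. indicator W z * h z) g (\<lambda>z. pflux p (g z))"
      unfolding weak_system_def
    proof (intro ballI conjI allI)
      fix \<phi> :: "(real^'n) \<times> real \<Rightarrow> real" and i
      assume \<phi>': "\<phi> \<in> test_functions W \<inter> bump_algebra"
      then have \<phi>: "\<phi> \<in> test_functions W" "\<phi> \<in> bump_algebra" by auto
      let ?D = "\<lambda>z. \<chi> i. frechet_derivative \<phi> (at z) (axis i 1, 0)"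
      note t = test_function_derivative[OF \<phi>(1)]
      obtain B where B: "\<And>z. \<bar>\<phi> z\<bar> \<le> B" "\<And>z e. e \<in> Basis \<Longrightarrow> \<bar>frechet_derivative \<phi> (at z) e\<bar> \<le> B"
        using test_function_bounded[OF \<phi>(1)] by metis
      have [measurable]: "\<phi> \<in> borel_measurable borel" using t(3) by (rule borel_measurable_continuous_onI)
      have Dm: "(\<lambda>z. frechet_derivative \<phi> (at z) e) \<in> borel_measurable borel" if "e \<in> Basis" for e
        using t(2)[OF that] by (rule borel_measurable_continuous_onI)
      have i1c: "integrable lborel (\<lambda>z. frechet_derivative \<phi> (at z) (axis i 1, 0) * hW z)" for i
        using integrable_bounded_scaleR[OF hi Dm[OF space_dir_Basis] B(2)[OF space_dir_Basis], of i] by simp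
      have i1: "integrable lborel (\<lambda>z. hW z *\<^sub>R ?D z)"
      proof -
        have "integrable lborel (\<lambda>z. \<Sum>i\<in>UNIV. (frechet_derivative \<phi> (at z) (axis i 1, 0) * hW z) *\<^sub>R (axis i 1 :: real^'n))"
          by (intro Bochner_Integration.integrable_sum integrable_scaleR_left i1c)
        also have "(\<lambda>z. \<Sum>i\<in>UNIV. (frechet_derivative \<phi> (at z) (axis i 1, 0) * hW z) *\<^sub>R (axis i 1 :: real^'n)) = (\<lambda>z. hW z *\<^sub>R ?D z)"
          by (simp add: fun_eq_iff vec_eq_iff axis_def if_distrib cong: if_cong)
        finally show ?thesis .
      qed
      have i2: "integrable lborel (\<lambda>z. \<phi> z *\<^sub>R g z)"
        by (rule integrable_bounded_scaleR[OF gi _ B(1)]) simp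
      \<comment> \<open>For almost every \<open>t\<close> in the interval the slice of
        \<open>\<phi>\<close> tests the weak gradient of the slice of \<open>h\<close>; for other
        \<open>t\<close> the cutoff makes both sides 0.\<close>
      have "AE t in lborel. (\<integral>x. hW (x, t) *\<^sub>R ?D (x, t) \<partial>lborel) = - (\<integral>x. \<phi> (x, t) *\<^sub>R g (x, t) \<partial>lborel)"
      proof -
        have "AE t\<in>?I in lborel. weak_gradient U (\<lambda>x. h (x, t)) (\<lambda>x. G (x, t))"
        proof -
          have "AE t\<in>?I in lborel. (\<lambda>x. h (x, t)) \<in> W1p p U \<and> weak_gradient U (\<lambda>x. h (x, t)) (\<lambda>x. G (x, t))"
            using G unfolding parabolic_sobolev_def by blast
          then show ?thesis by (rule eventually_mono) simp
        qed
        then show ?thesis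
        proof eventually_elim
          case (elim t)
          show ?case
          proof (cases "t \<in> ?I")
            case True
            then have "weak_gradient U (\<lambda>x. h (x, t)) (\<lambda>x. G (x, t))" using elim by simp
            moreover have "(\<lambda>x. \<phi> (x, t)) \<in> test_functions U"
              using slice_test_function \<phi> unfolding W(1) by blast
            ultimately have "(LINT x:U|lborel. h (x, t) *\<^sub>R gradient (\<lambda>x. \<phi> (x, t)) x) =
               - (LINT x:U|lborel. \<phi> (x, t) *\<^sub>R G (x, t))"
              unfolding weak_gradient_def by blast
            then show ?thesis using True
              by (simp add: set_lebesgue_integral_def slice_gradient[OF \<phi>(1)] hW_def g_def ind
                scaleR_scaleR mult.commute mult.left_commute mult.assoc)
          next
            case False
            then show ?thesis by (simp add: hW_def g_def ind)
          qed
        qed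
      qed
      then have "(\<integral>t. \<integral>x. hW (x, t) *\<^sub>R ?D (x, t) \<partial>lborel \<partial>lborel) =
          (\<integral>t. - (\<integral>x. \<phi> (x, t) *\<^sub>R g (x, t) \<partial>lborel) \<partial>lborel)"
        by (rule integral_cong_AE[rotated 2])
           (use integrable_lborel_snd[OF i1] integrable_lborel_snd[OF i2] in auto)
      then have "(\<integral>z. hW z *\<^sub>R ?D z \<partial>lborel) = - (\<integral>z. \<phi> z *\<^sub>R g z \<partial>lborel)"
        using integral_lborel_snd[OF i1] integral_lborel_snd[OF i2] by simp
      then have "(\<integral>z. hW z *\<^sub>R ?D z \<partial>lborel) $ i = - ((\<integral>z. \<phi> z *\<^sub>R g z \<partial>lborel) $ i)" by simp
      then show "(\<integral>z. frechet_derivative \<phi> (at z) (axis i 1, 0) * (indicator W z * h z) \<partial>lborel) =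
        - (\<integral>z. \<phi> z * g z $ i \<partial>lborel)"
        using integral_bounded_linear[OF bounded_linear_vec_nth i1, of i]
          integral_bounded_linear[OF bounded_linear_vec_nth i2, of i]
        by (simp add: hW_def mult.commute)
    next
      fix \<phi> :: "(real^'n) \<times> real \<Rightarrow> real"
      assume \<phi>': "\<phi> \<in> test_functions W \<inter> bump_algebra"
      then have \<phi>: "\<phi> \<in> test_functions W" "\<phi> \<in> bump_algebra" by auto
      note t = test_function_derivative[OF \<phi>(1)]
      obtain B where B: "\<And>z. \<bar>\<phi> z\<bar> \<le> B" "\<And>z e. e \<in> Basis \<Longrightarrow> \<bar>frechet_derivative \<phi> (at z) e\<bar> \<le> B"
        using test_function_bounded[OF \<phi>(1)] by metis
      have Dm: "(\<lambda>z. frechet_derivative \<phi> (at z) e) \<in> borel_measurable borel" if "e \<in> Basis" for e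
        using t(2)[OF that] by (rule borel_measurable_continuous_onI)
      have j1: "integrable lborel (\<lambda>z. frechet_derivative \<phi> (at z) (0, 1) * hW z)"
        using integrable_bounded_scaleR[OF hi Dm[OF time_dir_Basis] B(2)[OF time_dir_Basis]] by simp
      have j2: "integrable lborel (\<lambda>z. frechet_derivative \<phi> (at z) (axis i 1, 0) * pflux p (g z) $ i)" for i
        using integrable_bounded_scaleR[OF integrable_bounded_linear[OF bounded_linear_vec_nth pgi]
            Dm[OF space_dir_Basis] B(2)[OF space_dir_Basis], of i i] by simp
      let ?P = "\<lambda>z. \<Sum>i\<in>UNIV. frechet_derivative \<phi> (at z) (axis i 1, 0) * pflux p (g z) $ i"
      have j3: "integrable lborel ?P" by (intro Bochner_Integration.integrable_sum j2)
      have P: "indicator ?I t *\<^sub>R (indicator U x *\<^sub>R ((norm (G (x, t)) powr (p - 2) *\<^sub>R G (x, t)) \<bullet> gradient (\<lambda>y. \<phi> (y, t)) x))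
          = ?P (x, t)" for x t
      proof (cases "(x, t) \<in> W")
        case True
        then have "x \<in> U" "t \<in> ?I" by (auto simp: W(1))
        then show ?thesis using True
          by (simp add: slice_gradient[OF \<phi>(1)] g_def pflux_def inner_vec_def mult.commute)
      next
        case False
        then have "indicator U x * indicator ?I t = (0::real)" using ind[of x t] by simp
        then show ?thesis using False by (auto simp: g_def pflux_def)
      qed
      have H: "indicator ?I t *\<^sub>R (indicator U x *\<^sub>R (h (x, t) * deriv (\<lambda>s. \<phi> (x, s)) t)) =
          frechet_derivative \<phi> (at (x, t)) (0, 1) * hW (x, t)" for x t
        by (simp add: slice_gradient[OF \<phi>(1)] hW_def ind)
      have "(\<integral>t. \<integral>x. ?P (x, t) \<partial>lborel \<partial>lborel) = (\<integral>t. \<integral>x. frechet_derivative \<phi> (at (x, t)) (0, 1) * hW (x, t) \<partial>lborel \<partial>lborel)"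
        using eq[OF \<phi>(1)[unfolded W(1)]]
        unfolding set_lebesgue_integral_def integral_scaleR_right[symmetric] P H by simp
      then have "(\<integral>z. ?P z \<partial>lborel) = (\<integral>z. frechet_derivative \<phi> (at z) (0, 1) * hW z \<partial>lborel)"
        using integral_lborel_snd[OF j1] integral_lborel_snd[OF j3] by simp
      then show "(\<Sum>i\<in>UNIV. \<integral>z. frechet_derivative \<phi> (at z) (axis i 1, 0) * pflux p (g z) $ i \<partial>lborel) =
        (\<integral>z. frechet_derivative \<phi> (at z) (0, 1) * (indicator W z * h z) \<partial>lborel)"
        by (subst Bochner_Integration.integral_sum[symmetric, OF j2]) (simp add: hW_def)
    qed
  qed
qed

section \<open>Comparison of weak solutions\<close>

text \<open>The new faces lie halfway between the old ones and the extreme coordinates of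
  \<open>K\<close>. The resulting box is compactly contained in the old one, as the definition of a
  weak solution demands.\<close>

lemma compact_in_box_shrink:
  fixes K :: "'a::euclidean_space set"
  assumes K: "compact K" "K \<noteq> {}" "K \<subseteq> box a b"
  obtains a' b' where "K \<subseteq> box a' b'" "cbox a' b' \<subseteq> box a b"
proof -
  have "\<exists>m M. m \<in> K \<and> M \<in> K \<and> (\<forall>x\<in>K. m \<bullet> i \<le> x \<bullet> i \<and> x \<bullet> i \<le> M \<bullet> i)" for i
  proof -
    have c: "continuous_on K (\<lambda>x. x \<bullet> i)" by (intro continuous_intros)
    from continuous_attains_inf[OF K(1,2) c] continuous_attains_sup[OF K(1,2) c] show ?thesis by blast
  qed
  then obtain m M where mM: "\<And>i. m i \<in> K" "\<And>i. M i \<in> K"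
    "\<And>i x. x \<in> K \<Longrightarrow> m i \<bullet> i \<le> x \<bullet> i" "\<And>i x. x \<in> K \<Longrightarrow> x \<bullet> i \<le> M i \<bullet> i" by metis
  define a' where "a' = (\<Sum>i\<in>Basis. ((a \<bullet> i + m i \<bullet> i) / 2) *\<^sub>R i)"
  define b' where "b' = (\<Sum>i\<in>Basis. ((b \<bullet> i + M i \<bullet> i) / 2) *\<^sub>R i)"
  have in_box: "a \<bullet> i < x \<bullet> i" "x \<bullet> i < b \<bullet> i" if "x \<in> K" "i \<in> Basis" for x i
    using K(3) that by (auto simp: mem_box)
  have comp: "a' \<bullet> i = (a \<bullet> i + m i \<bullet> i) / 2" "b' \<bullet> i = (b \<bullet> i + M i \<bullet> i) / 2" if "i \<in> Basis" for i
    using that by (simp_all add: a'_def b'_def)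
  show ?thesis
  proof
    show "K \<subseteq> box a' b'"
    proof
      fix x assume x: "x \<in> K"
      have "a' \<bullet> i < x \<bullet> i \<and> x \<bullet> i < b' \<bullet> i" if i: "i \<in> Basis" for i
        using comp[OF i] in_box[OF mM(1)[of i] i] in_box[OF mM(2)[of i] i] mM(3,4)[OF x, of i] by auto
      then show "x \<in> box a' b'" by (simp add: mem_box)
    qed
    show "cbox a' b' \<subseteq> box a b"
    proof
      fix x assume x: "x \<in> cbox a' b'"
      have "a \<bullet> i < x \<bullet> i \<and> x \<bullet> i < b \<bullet> i" if i: "i \<in> Basis" for i
      proof -
        have "a' \<bullet> i \<le> x \<bullet> i" "x \<bullet> i \<le> b' \<bullet> i" using x i by (auto simp: mem_box)
        then show ?thesis
          using comp[OF i] in_box[OF mM(1)[of i] i] in_box[OF mM(2)[of i] i] by auto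
      qed
      then show "x \<in> box a b" by (simp add: mem_box)
    qed
  qed
qed

lemma box_Pair: "box (a, c) (b, d) = box a b \<times> box c d"
  by (subst box_prod) simp

text \<open>The set where \<open>f\<close> exceeds \<open>c\<close> is open and null, hence
  empty.\<close>

lemma AE_le_imp_le_on_open:
  fixes f :: "'a::euclidean_space \<Rightarrow> real"
  assumes V: "open V" and f: "continuous_on V f" and AE: "AE z in lborel. z \<in> V \<longrightarrow> f z \<le> c"
    and z: "z \<in> V"
  shows "f z \<le> c"
proof (rule ccontr)
  assume "\<not> f z \<le> c"
  define N where "N = V \<inter> f -` {c<..}"
  have oN: "open N" unfolding N_def using V f by (intro continuous_open_preimage) auto
  have "z \<in> N" using z \<open>\<not> f z \<le> c\<close> by (simp add: N_def)
  have "AE z in lborel. z \<notin> N" using AE by eventually_elim (auto simp: N_def)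
  then have "N \<in> null_sets lborel" using oN by (subst AE_iff_null_sets) auto
  then have "negligible N" by (simp add: negligible_iff_null_sets null_sets_completionI)
  then show False using open_not_negligible[OF oN] \<open>z \<in> N\<close> by blast
qed

text \<open>The difference of two solutions is itself no solution of the nonlinear equation, but it
  satisfies a linear weak system whose flux is the difference of the two fluxes; monotonicity
  supplies the sign.\<close>

lemma p_parabolic_difference_AE_le:
  fixes h w :: "(real^'n) \<times> real \<Rightarrow> real"
  assumes p: "1 < p" and h: "p_parabolic p \<Theta> h" and w: "p_parabolic p \<Theta> w"
    and U: "open U" and t12: "t1 < t2" and W: "W = U \<times> {t1<..<t2}" "W \<Subset> \<Theta>"
    and K0: "compact K0" "K0 \<subseteq> W" and T: "T < T'"
    and le: "\<And>z. z \<in> W \<Longrightarrow> snd z < T' \<Longrightarrow> z \<notin> K0 \<Longrightarrow> h z - w z \<le> \<epsilon>"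
  shows "AE z in lborel. z \<in> W \<and> snd z < T \<longrightarrow> h z - w z \<le> \<epsilon>"
proof -
  obtain gh Mh where gh: "integrable lborel (\<lambda>z. indicator W z * h z)" "\<And>z. \<bar>indicator W z * h z\<bar> \<le> Mh"
    "integrable lborel gh" "integrable lborel (\<lambda>z. norm (gh z) powr p)" "integrable lborel (\<lambda>z. pflux p (gh z))"
    "weak_system W (\<lambda>z. indicator W z * h z) gh (\<lambda>z. pflux p (gh z))"
    by (rule p_parabolic_weak_form[OF h p U t12 W]) (rule that)
  obtain gw Mw where gw: "integrable lborel (\<lambda>z. indicator W z * w z)" "\<And>z. \<bar>indicator W z * w z\<bar> \<le> Mw"
    "integrable lborel gw" "integrable lborel (\<lambda>z. norm (gw z) powr p)" "integrable lborel (\<lambda>z. pflux p (gw z))"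
    "weak_system W (\<lambda>z. indicator W z * w z) gw (\<lambda>z. pflux p (gw z))"
    by (rule p_parabolic_weak_form[OF w p U t12 W]) (rule that)
  define q where "q = p / (p - 1)"
  define d where "d z = indicator W z * h z - indicator W z * w z" for z
  define D where "D z = gh z - gw z" for z
  define F where "F z = pflux p (gh z) - pflux p (gw z)" for z
  define S where "S z = norm (gh z) powr p + norm (gw z) powr p" for z
  have "AE z in lborel. z \<in> W \<and> snd z < T \<longrightarrow> d z \<le> \<epsilon>"
  proof (rule weak_subsolution_AE_le[OF _ _ _ _ _ _ _ _ _ _ _ K0 T])
    show "open W" unfolding W(1) by (intro open_Times U) auto
    show "bounded W" using W(2) bounded_subset[OF compact_imp_bounded closure_subset]
      by (auto simp: compactly_contained_def)
    show "integrable lborel d" "integrable lborel D" "integrable lborel F"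
      using gh(1,3,5) gw(1,3,5) by (simp_all add: d_def[abs_def] D_def[abs_def] F_def[abs_def])
    show "\<bar>d z\<bar> \<le> Mh + Mw" for z using gh(2)[of z] gw(2)[of z] unfolding d_def by linarith
    show "integrable lborel (\<lambda>z. 2 powr p * S z)" "integrable lborel (\<lambda>z. 2 powr q * S z)"
      using gh(4) gw(4) by (simp_all add: S_def[abs_def])
    \<comment> \<open>Gradients lie in L^p and fluxes in the conjugate space L^q. Young's inequality
      splits the product into these two integrable parts, one for each point.\<close>
    show "norm (D x) * norm (F y) \<le> 2 powr p * S x + 2 powr q * S y" for x y
    proof -
      have "norm (D x) * norm (F y) \<le> norm (D x) powr p + norm (F y) powr q"
        unfolding q_def by (rule mult_le_powr_add_powr[OF p]) auto
      also have "norm (D x) powr p \<le> 2 powr p * S x"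
        unfolding D_def S_def using p by (intro norm_diff_powr_le) auto
      also have "norm (F y) powr q \<le> 2 powr q * (norm (pflux p (gh y)) powr q + norm (pflux p (gw y)) powr q)"
        unfolding F_def using p by (intro norm_diff_powr_le) (auto simp: q_def)
      also have "\<dots> = 2 powr q * S y" unfolding q_def S_def norm_pflux_powr[OF p] ..
      finally show ?thesis by simp
    qed
    show "0 \<le> D z \<bullet> F z" for z
      using pflux_monotone[OF p, of "gh z" "gw z"] by (simp add: D_def F_def inner_commute)
    show "d z \<le> \<epsilon>" if "z \<in> W" "snd z < T'" "z \<notin> K0" for z
      using le[OF that] that(1) by (simp add: d_def)
    show "weak_system W d D F"
      unfolding weak_system_def
    proof (intro ballI conjI allI)
      fix \<phi> :: "(real^'n) \<times> real \<Rightarrow> real"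
      assume "\<phi> \<in> test_functions W \<inter> bump_algebra"
      then have \<phi>: "\<phi> \<in> test_functions W" "\<phi> \<in> bump_algebra" by auto
      note t = test_function_derivative[OF \<phi>(1)]
      obtain B where B: "\<And>z. \<bar>\<phi> z\<bar> \<le> B" "\<And>z e. e \<in> Basis \<Longrightarrow> \<bar>frechet_derivative \<phi> (at z) e\<bar> \<le> B"
        by (rule test_function_bounded[OF \<phi>(1)]) (rule that)
      have \<phi>i: "integrable lborel (\<lambda>z. \<phi> z * f z)" if "integrable lborel f" for f :: "_ \<Rightarrow> real"
        using integrable_bounded_scaleR[OF that borel_measurable_continuous_onI[OF t(3)] B(1)] by simp
      have Di: "integrable lborel (\<lambda>z. frechet_derivative \<phi> (at z) e * f z)"
        if "integrable lborel f" "e \<in> Basis" for f :: "_ \<Rightarrow> real" and e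
        using integrable_bounded_scaleR[OF that(1) borel_measurable_continuous_onI[OF t(2)[OF that(2)]] B(2)[OF that(2)]]
        by simp
      note vn = integrable_bounded_linear[OF bounded_linear_vec_nth]
      show "(\<integral>z. frechet_derivative \<phi> (at z) (axis i 1, 0) * d z \<partial>lborel) = - (\<integral>z. \<phi> z * D z $ i \<partial>lborel)" for i
        using weak_systemD(1)[OF gh(6) \<phi>, of i] weak_systemD(1)[OF gw(6) \<phi>, of i] Di[OF gh(1) space_dir_Basis, of i] Di[OF gw(1) space_dir_Basis, of i]
          \<phi>i[OF vn[OF gh(3)], of i] \<phi>i[OF vn[OF gw(3)], of i]
        by (simp add: d_def D_def right_diff_distrib)
      have "(\<integral>z. frechet_derivative \<phi> (at z) (axis i 1, 0) * F z $ i \<partial>lborel) =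
        (\<integral>z. frechet_derivative \<phi> (at z) (axis i 1, 0) * pflux p (gh z) $ i \<partial>lborel) -
        (\<integral>z. frechet_derivative \<phi> (at z) (axis i 1, 0) * pflux p (gw z) $ i \<partial>lborel)" for i
        using Di[OF vn[OF gh(5)] space_dir_Basis, of i i] Di[OF vn[OF gw(5)] space_dir_Basis, of i i]
        by (simp add: F_def right_diff_distrib)
      then show "(\<Sum>i\<in>UNIV. \<integral>z. frechet_derivative \<phi> (at z) (axis i 1, 0) * F z $ i \<partial>lborel) =
        (\<integral>z. frechet_derivative \<phi> (at z) (0, 1) * d z \<partial>lborel)"
        using weak_systemD(2)[OF gh(6) \<phi>] weak_systemD(2)[OF gw(6) \<phi>] Di[OF gh(1) time_dir_Basis] Di[OF gw(1) time_dir_Basis]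
        by (simp add: d_def right_diff_distrib sum_subtractf)
    qed
  qed
  then show ?thesis by eventually_elim (auto simp: d_def)
qed

text \<open>With the margin \<open>\<epsilon>\<close>, the set where
  \<open>h - w \<ge> \<epsilon>\<close> stays away from the parabolic boundary, so it fits into a
  compactly contained cylinder where the weak equations may be used. The starting time
  \<open>s\<close> is separate from \<open>t1\<close> because a truncated barrier coincides with a
  solution only after a certain time.\<close>

proposition parabolic_comparison:
  fixes h w :: "(real^'n) \<times> real \<Rightarrow> real"
  assumes p: "1 < p" and h: "p_parabolic p (box a b \<times> {t1<..<t2}) h" and w: "p_parabolic p (box a b \<times> {t1<..<t2}) w"
    and ch: "continuous_on (closure (box a b \<times> {t1<..<t2})) h"
    and cw: "continuous_on (closure (box a b \<times> {t1<..<t2})) w"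
    and s: "t1 \<le> s" and bd: "\<And>\<xi>. \<xi> \<in> parabolic_boundary (box a b) s t2 \<Longrightarrow> h \<xi> \<le> w \<xi>"
    and \<xi>: "\<xi> \<in> box a b \<times> {s<..<t2}"
  shows "h \<xi> \<le> w \<xi>"
proof (rule field_le_epsilon)
  fix \<epsilon> :: real assume \<epsilon>: "0 < \<epsilon>"
  let ?Q = "box a b"
  have st2: "s < t2" using \<xi> by auto
  have cl: "closure (?Q \<times> {t1<..<t2}) = closure ?Q \<times> {t1..t2}" using s st2 by (simp add: closure_Times)
  \<comment> \<open>Two intermediate times above \<open>\<xi>\<close> and below \<open>t2\<close>:
    no ordering is known on the top face, so the compact set is cut at \<open>T'\<close> and the
    time weight ends at \<open>T\<close>.\<close>
  define T where "T = (snd \<xi> + t2) / 2"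
  define T' where "T' = (T + t2) / 2"
  have T: "snd \<xi> < T" "T < T'" "T' < t2" "s < T'" proof -
    have "s < snd \<xi>" "snd \<xi> < t2" using \<xi> by auto
    then show "snd \<xi> < T" "T < T'" "T' < t2" "s < T'" unfolding T'_def T_def by (simp_all add: field_simps)
  qed
  define d where "d z = h z - w z" for z
  define K0 where "K0 = (closure ?Q \<times> {s..T'}) \<inter> d -` {\<epsilon>..}"
  have cQ: "compact (closure ?Q)" by (simp add: bounded_box compact_closure)
  have cd: "continuous_on (closure ?Q \<times> {t1..t2}) d"
    unfolding d_def using ch cw cl by (intro continuous_intros) auto
  have sub: "closure ?Q \<times> {s..T'} \<subseteq> closure ?Q \<times> {t1..t2}" using s T by auto
  have "closed K0" unfolding K0_def
    using continuous_on_subset[OF cd sub] cQ by (intro continuous_closed_preimage) (auto intro: closed_Times)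
  moreover have "K0 \<subseteq> closure ?Q \<times> {s..T'}" by (auto simp: K0_def)
  ultimately have K0: "compact K0"
    using compact_Int_closed[OF compact_Times[OF cQ compact_Icc[of s T']], of K0] by (simp add: Int_absorb1)
  \<comment> \<open>The boundary ordering excludes the bottom and the lateral faces because
    \<open>\<epsilon> > 0\<close>, and \<open>T' < t2\<close> excludes the top face.\<close>
  have K0box: "K0 \<subseteq> box (a, s) (b, t2)"
  proof
    fix z assume z: "z \<in> K0"
    obtain x t where xt: "z = (x, t)" by force
    have 1: "x \<in> closure ?Q" "s \<le> t" "t \<le> T'" "\<epsilon> \<le> h (x, t) - w (x, t)" using z by (auto simp: K0_def d_def xt)
    have "(x, t) \<notin> parabolic_boundary ?Q s t2" using bd[of "(x, t)"] 1(4) \<epsilon> by auto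
    then have "t \<noteq> s" "x \<notin> frontier ?Q" using 1 T by (auto simp: parabolic_boundary_def)
    then show "z \<in> box (a, s) (b, t2)" using 1 T by (auto simp: xt box_Pair frontier_def interior_open[OF open_box])
  qed
  have not_K0: "d z \<le> \<epsilon>" if "z \<in> ?Q \<times> {s<..<t2}" "snd z \<le> T'" "z \<notin> K0" for z
    using that closure_subset[of ?Q] by (cases z) (auto simp: K0_def)
  show "h \<xi> \<le> w \<xi> + \<epsilon>"
  proof (cases "\<xi> \<in> K0")
    case False
    then show ?thesis using not_K0[OF \<xi>] T by (simp add: d_def)
  next
    case True
    obtain a' b' where ab': "K0 \<subseteq> box a' b'" "cbox a' b' \<subseteq> box (a, s) (b, t2)"
      using compact_in_box_shrink[OF K0 _ K0box] True by blast
    obtain a1 \<tau>1 b1 \<tau>2 where c: "a' = (a1, \<tau>1)" "b' = (b1, \<tau>2)" by (cases a', cases b')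
    define W where "W = box a1 b1 \<times> {\<tau>1<..<\<tau>2}"
    have W': "box a' b' = W" by (simp add: c W_def box_Pair)
    have KW: "K0 \<subseteq> W" using ab'(1) W' by simp
    have W12: "\<tau>1 < \<tau>2" using True KW by (auto simp: W_def)
    have cbox: "closure W \<subseteq> cbox a' b'" unfolding W'[symmetric] by (intro closure_minimal box_subset_cbox closed_cbox)
    have QQ: "box (a, s) (b, t2) \<subseteq> ?Q \<times> {t1<..<t2}" using s by (auto simp: box_Pair)
    have WQ: "W \<Subset> ?Q \<times> {t1<..<t2}"
      unfolding compactly_contained_def
      using cbox ab'(2) QQ bounded_subset[OF bounded_cbox cbox] by (auto simp: compact_eq_bounded_closed)
    have Wsub: "W \<subseteq> ?Q \<times> {s<..<t2}"
      using closure_subset[of W] cbox ab'(2) by (auto simp: box_Pair)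
    have oW: "open W" unfolding W_def by (intro open_Times) auto
    have "AE z in lborel. z \<in> W \<and> snd z < T \<longrightarrow> h z - w z \<le> \<epsilon>"
    proof (rule p_parabolic_difference_AE_le[OF p h w open_box W12 W_def WQ K0 KW T(2)])
      fix z assume z: "z \<in> W" "snd z < T'" "z \<notin> K0"
      then show "h z - w z \<le> \<epsilon>" using not_K0[of z] Wsub by (auto simp: d_def)
    qed
    then have AE: "AE z in lborel. z \<in> W \<inter> {z. snd z < T} \<longrightarrow> d z \<le> \<epsilon>"
      by eventually_elim (auto simp: d_def)
    have "W \<inter> {z. snd z < T} \<subseteq> closure ?Q \<times> {t1..t2}"
      using Wsub s closure_subset[of ?Q] by force
    then have "d \<xi> \<le> \<epsilon>"
      using True KW T(1) oW
      by (intro AE_le_imp_le_on_open[OF _ _ AE] continuous_on_subset[OF cd])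
         (auto intro!: open_Int open_Collect_less continuous_intros)
    then show ?thesis by (simp add: d_def)
  qed
qed

section \<open>Explicit solutions\<close>

lemma set_integrable_continuous_bounded:
  fixes f :: "'a::euclidean_space \<Rightarrow> 'b::euclidean_space"
  assumes U: "open U" "bounded U" and f: "continuous_on UNIV f"
  shows "set_integrable lborel U f"
proof -
  have "compact (closure U)" using U by (simp add: compact_closure)
  then have "set_integrable lborel (closure U) f"
    unfolding set_integrable_def using f by (intro borel_integrable_compact) (auto intro: continuous_on_subset)
  then show ?thesis by (rule set_integrable_subset[OF _ _ closure_subset]) (use U in auto)
qed

lemma continuous_bounded_Lp:
  fixes f :: "'a::euclidean_space \<Rightarrow> 'b::euclidean_space"
  assumes U: "open U" "bounded U" and f: "continuous_on UNIV f" and p: "0 < p"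
  shows "f \<in> Lp p U"
proof -
  have "continuous_on UNIV (\<lambda>x. norm (f x) powr p)"
    using p by (intro continuous_on_powr' continuous_intros f) auto
  then have "set_integrable lborel U (\<lambda>x. norm (f x) powr p)"
    by (rule set_integrable_continuous_bounded[OF U])
  moreover have "set_borel_measurable lborel U f"
    using set_integrable_continuous_bounded[OF U f]
    unfolding set_borel_measurable_def set_integrable_def by (rule borel_measurable_integrable)
  ultimately show ?thesis by (simp add: Lp_def)
qed

lemma weak_gradient_C1:
  fixes f :: "real^'n \<Rightarrow> real" and g :: "real^'n \<Rightarrow> real^'n"
  assumes U: "open U" and der: "\<And>x. (f has_derivative (\<lambda>h. g x \<bullet> h)) (at x)" and g: "continuous_on UNIV g"
  shows "weak_gradient U f g"
  unfolding weak_gradient_def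
proof (intro conjI allI impI ballI)
  have f: "continuous_on UNIV f"
    using der by (auto intro: has_derivative_continuous continuous_at_imp_continuous_on)
  show "set_integrable lborel C f" "set_integrable lborel C g" if "compact C \<and> C \<subseteq> U" for C
    unfolding set_integrable_def using that
    by - (intro borel_integrable_compact continuous_on_subset[OF f] continuous_on_subset[OF g]; simp)+
  fix \<phi> assume \<phi>: "\<phi> \<in> test_functions U"
  note t = test_function_derivative[OF \<phi>]
  have grad: "gradient \<phi> x = (\<chi> i. frechet_derivative \<phi> (at x) (axis i 1))" for x by (simp add: gradient_def)
  have \<phi>0: "\<phi> x = 0" if "x \<notin> closure {z. \<phi> z \<noteq> 0}" for x
    using that closure_subset[of "{z. \<phi> z \<noteq> 0}"] by auto
  have B: "axis i 1 \<in> (Basis :: (real^'n) set)" for i by (auto simp: Basis_vec_def)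
  have df: "((\<lambda>s. f (x + s *\<^sub>R axis i 1)) has_real_derivative g x $ i) (at 0)" for x i
    using has_derivative_imp_directional[OF der, of x "axis i 1"] by (simp add: inner_axis)
  have cgi: "continuous_on U (\<lambda>x. g x $ i)" for i
    by (intro continuous_intros continuous_on_subset[OF g]) auto
  have ibp: "integrable lborel (\<lambda>x. indicator U x * (frechet_derivative \<phi> (at x) (axis i 1) * f x))"
    "integrable lborel (\<lambda>x. indicator U x * (\<phi> x * g x $ i))"
    "(\<integral>x. indicator U x * (frechet_derivative \<phi> (at x) (axis i 1) * f x) \<partial>lborel) =
       - (\<integral>x. indicator U x * (\<phi> x * g x $ i) \<partial>lborel)" for i
    using integration_by_parts_directional[OF U t(4,5) \<phi>0 continuous_on_subset[OF t(3)] continuous_on_subset[OF f]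
        continuous_on_subset[OF t(2)[OF B]] cgi test_function_line_derivative[OF \<phi>] df, of i]
    by auto
  have 1: "indicator U x *\<^sub>R (f x *\<^sub>R gradient \<phi> x) =
      (\<Sum>i\<in>UNIV. (indicator U x * (frechet_derivative \<phi> (at x) (axis i 1) * f x)) *\<^sub>R (axis i 1 :: real^'n))" for x
    by (simp add: grad vec_eq_iff axis_def if_distrib cong: if_cong)
  have 2: "indicator U x *\<^sub>R (\<phi> x *\<^sub>R g x) =
      (\<Sum>i\<in>UNIV. (indicator U x * (\<phi> x * g x $ i)) *\<^sub>R (axis i 1 :: real^'n))" for x
    by (simp add: vec_eq_iff axis_def if_distrib cong: if_cong)
  show "(LINT x:U|lborel. f x *\<^sub>R gradient \<phi> x) = - (LINT x:U|lborel. \<phi> x *\<^sub>R g x)"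
    unfolding set_lebesgue_integral_def 1 2
    using ibp by (simp add: sum_negf)
qed

lemma has_derivative_norm_powr:
  fixes y :: "'a::real_inner"
  assumes q: "2 < q"
  shows "((\<lambda>x. norm (x - y) powr q) has_derivative (\<lambda>h. (q * norm (x - y) powr (q - 2)) * ((x - y) \<bullet> h))) (at x)"
proof (cases "x = y")
  case False
  have "((\<lambda>x. x - y) has_derivative (\<lambda>h. h)) (at x)" by (auto intro!: derivative_eq_intros)
  from has_derivative_compose[OF this has_derivative_norm] False
  have "((\<lambda>x. norm (x - y)) has_derivative (\<lambda>h. sgn (x - y) \<bullet> h)) (at x)" by (simp add: inner_commute)
  from has_derivative_compose[OF this has_real_derivative_powr[THEN has_field_derivative_imp_has_derivative], of q] False
  have "((\<lambda>x. norm (x - y) powr q) has_derivative (\<lambda>h. q * norm (x - y) powr (q - 1) * (sgn (x - y) \<bullet> h))) (at x)" by simp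
  moreover have "norm (x - y) powr (q - 1) = norm (x - y) powr (q - 2) * norm (x - y)"
    using False by (simp add: powr_mult_base[symmetric] mult.commute) (simp add: powr_mult_base)
  moreover have "q * (norm (x - y) powr (q - 2) * norm (x - y)) * (sgn (x - y) \<bullet> h) =
      q * norm (x - y) powr (q - 2) * ((x - y) \<bullet> h)" for h
  proof -
    have "norm v * (sgn v \<bullet> h) = v \<bullet> h" if "v \<noteq> 0" for v :: 'a
      using that by (simp add: sgn_div_norm mult.assoc[symmetric])
    from this[of "x - y"] False show ?thesis by (simp only: mult.assoc) simp
  qed
  ultimately show ?thesis by (simp only:)
next
  case True
  show ?thesis unfolding True
  proof (rule has_derivativeI_sandwich[where e = 1])
    show "bounded_linear (\<lambda>h. q * norm (y - y) powr (q - 2) * ((y - y) \<bullet> h))" by simp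
    show "((\<lambda>z. norm (z - y) powr (q - 1)) \<longlongrightarrow> 0) (at y)"
      using q by (intro tendsto_zero_powrI tendsto_eq_intros) auto
    fix z assume "z \<noteq> y"
    then have "norm (z - y) powr q = norm (z - y) powr (q - 1) * norm (z - y)"
      using powr_mult_base[of "norm (z - y)" "q - 1"] by (simp add: mult.commute)
    then show "norm (norm (z - y) powr q - norm (y - y) powr q - q * norm (y - y) powr (q - 2) * ((y - y) \<bullet> (z - y))) / norm (z - y)
      \<le> norm (z - y) powr (q - 1)" using \<open>z \<noteq> y\<close> by simp
  qed simp
qed

text \<open>Here \<open>(p - 1) / p\<close> is \<open>1 / q\<close>, so the spatial gradient is
  \<open>\<gamma> |x - y|^(q-2) (x - y)\<close>. Positive \<open>\<gamma>\<close> serves for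
  touching from below, negative \<open>\<gamma>\<close> for the upper barrier, and
  \<open>\<gamma> = 0\<close> gives the constants.\<close>

definition power_solution :: "real \<Rightarrow> real \<Rightarrow> real^'n \<Rightarrow> real \<Rightarrow> (real^'n) \<times> real \<Rightarrow> real" where
  "power_solution p \<gamma> y c z = real CARD('n) * (\<bar>\<gamma>\<bar> powr (p - 2) * \<gamma>) * snd z +
     \<gamma> * (p - 1) / p * norm (fst z - y) powr (p / (p - 1)) + c"

text \<open>The powers of the norm cancel: \<open>(q - 1) * (p - 2) + (q - 2) = 0\<close>, because
  \<open>(p - 1) * (q - 1) = 1\<close>.\<close>

lemma pflux_power_gradient:
  fixes v :: "'a::real_normed_vector"
  assumes p: "1 < p"
  shows "pflux p ((\<gamma> * norm v powr (p / (p - 1) - 2)) *\<^sub>R v) = (\<bar>\<gamma>\<bar> powr (p - 2) * \<gamma>) *\<^sub>R v"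
proof (cases "v = 0 \<or> \<gamma> = 0")
  case True
  then show ?thesis by (auto simp: pflux_def)
next
  case False
  let ?q = "p / (p - 1)"
  have "norm ((\<gamma> * norm v powr (?q - 2)) *\<^sub>R v) = \<bar>\<gamma>\<bar> * (norm v * norm v powr (?q - 2))"
    by (simp add: abs_mult)
  also have "norm v * norm v powr (?q - 2) = norm v powr (?q - 1)"
    using False by (simp add: powr_mult_base)
  finally have "norm ((\<gamma> * norm v powr (?q - 2)) *\<^sub>R v) powr (p - 2) = \<bar>\<gamma>\<bar> powr (p - 2) * norm v powr ((?q - 1) * (p - 2))"
    by (simp add: powr_mult powr_powr)
  moreover have "norm v powr ((?q - 1) * (p - 2)) * norm v powr (?q - 2) = 1"
  proof -
    have "(?q - 1) * (p - 2) + (?q - 2) = 0" using p by (simp add: field_simps)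
    then show ?thesis using False by (simp only: powr_add[symmetric]) simp
  qed
  ultimately show ?thesis by (simp add: pflux_def mult.assoc mult.left_commute)
qed

text \<open>The linear flux \<open>\<mu> (x - y)\<close> has divergence
  \<open>n \<mu> = \<kappa>\<close>, which is the time derivative. In weak form, each of the
  \<open>n\<close> coordinate directions contributes the same integral of
  \<open>\<phi> \<mu>\<close>.\<close>

lemma power_solution_p_parabolic:
  fixes y :: "real^'n"
  assumes p: "1 < p" "p < 2"
  shows "p_parabolic p \<Theta> (power_solution p \<gamma> y c)"
proof -
  define q where "q = p / (p - 1)"
  have q: "2 < q" using p by (simp add: q_def field_simps)
  define \<mu> where "\<mu> = \<bar>\<gamma>\<bar> powr (p - 2) * \<gamma>"
  define \<kappa> where "\<kappa> = real CARD('n) * \<mu>"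
  define A where "A x = \<gamma> / q * norm (x - y) powr q + c" for x
  define g where "g x = (\<gamma> * norm (x - y) powr (q - 2)) *\<^sub>R (x - y)" for x
  let ?u = "power_solution p \<gamma> y c"
  have u: "?u (x, t) = A x + \<kappa> * t" for x t
    using p by (simp add: power_solution_def A_def \<kappa>_def \<mu>_def q_def)
  have dA: "(A has_derivative (\<lambda>h. g x \<bullet> h)) (at x)" for x
  proof -
    have "(A has_derivative (\<lambda>h. \<gamma> / q * (q * norm (x - y) powr (q - 2) * ((x - y) \<bullet> h)) + 0)) (at x)"
      unfolding A_def[abs_def]
      by (intro has_derivative_add has_derivative_mult_right has_derivative_norm_powr q has_derivative_const)
    moreover have "(\<lambda>h. \<gamma> / q * (q * norm (x - y) powr (q - 2) * ((x - y) \<bullet> h)) + 0) = (\<lambda>h. g x \<bullet> h)"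
      using q by (auto simp: g_def fun_eq_iff)
    ultimately show ?thesis by simp
  qed
  have cg: "continuous_on UNIV g"
    unfolding g_def[abs_def] using q by (intro continuous_intros continuous_on_powr') auto
  have cA: "continuous_on UNIV A"
    using dA by (auto intro: has_derivative_continuous continuous_at_imp_continuous_on)
  have cu: "continuous_on UNIV ?u"
  proof -
    have "?u = (\<lambda>z. A (fst z) + \<kappa> * snd z)" using u by (auto simp: fun_eq_iff)
    moreover have "continuous_on UNIV (\<lambda>z. A (fst z) + \<kappa> * snd z)"
      by (intro continuous_intros continuous_on_compose2[OF cA]) auto
    ultimately show ?thesis by simp
  qed
  have flux: "norm (g x) powr (p - 2) *\<^sub>R g x = \<mu> *\<^sub>R (x - y)" for x
    using pflux_power_gradient[OF p(1), of \<gamma> "x - y"] by (simp add: pflux_def g_def q_def \<mu>_def)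
  show ?thesis
    unfolding p_parabolic_def
  proof (intro conjI allI impI)
    show "continuous_on \<Theta> ?u" by (rule continuous_on_subset[OF cu]) simp
  next
    fix U :: "(real^'n) set" and t1 t2 :: real
    assume asm: "open U \<and> t1 < t2 \<and> U \<times> {t1<..<t2} \<Subset> \<Theta>"
    let ?W = "U \<times> {t1<..<t2}"
    have U: "open U" and t12: "t1 < t2" using asm by auto
    have bW: "bounded ?W"
      using asm bounded_subset[OF compact_imp_bounded closure_subset] by (auto simp: compactly_contained_def)
    have bU: "bounded U"
    proof -
      have "fst ` ?W = U" using t12 by (auto simp: image_iff intro!: bexI[of _ "(t1 + t2) / 2"])
      then show ?thesis using bounded_fst[OF bW] by simp
    qed
    have oW: "open ?W" by (intro open_Times U) auto
    have si: "set_integrable lborel U f" if "continuous_on UNIV f" for f :: "real^'n \<Rightarrow> real"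
      by (rule set_integrable_continuous_bounded[OF U bU that])
    \<comment> \<open>The squared norm of the slice is a quadratic polynomial in \<open>t\<close>,
      hence continuous in time.\<close>
    have "(LINT x:U|lborel. \<bar>?u (x, t)\<bar>\<^sup>2) =
        (LINT x:U|lborel. (A x)\<^sup>2) + 2 * \<kappa> * t * (LINT x:U|lborel. A x) + (\<kappa> * t)\<^sup>2 * (LINT x:U|lborel. 1)" for t
    proof -
      have "(LINT x:U|lborel. \<bar>?u (x, t)\<bar>\<^sup>2) = (LINT x:U|lborel. (A x)\<^sup>2 + (2 * \<kappa> * t) * A x + (\<kappa> * t)\<^sup>2 * 1)"
        by (simp add: u power2_eq_square algebra_simps)
      also have "\<dots> = (LINT x:U|lborel. (A x)\<^sup>2 + (2 * \<kappa> * t) * A x) + (LINT x:U|lborel. (\<kappa> * t)\<^sup>2 * 1)"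
        by (intro set_integral_add si continuous_intros cA)
      also have "(LINT x:U|lborel. (A x)\<^sup>2 + (2 * \<kappa> * t) * A x) = (LINT x:U|lborel. (A x)\<^sup>2) + (LINT x:U|lborel. (2 * \<kappa> * t) * A x)"
        by (intro set_integral_add si continuous_intros cA)
      finally show ?thesis by (simp only: set_integral_mult_right)
    qed
    then show "continuous_on {t1..t2} (\<lambda>t. LINT x:U|lborel. \<bar>?u (x, t)\<bar>\<^sup>2)"
      by (simp only:) (intro continuous_intros)
    show "\<exists>G. parabolic_sobolev p U t1 t2 ?u G \<and>
          (\<forall>\<phi>\<in>test_functions ?W.
             (LINT t:{t1<..<t2}|lborel. LINT x:U|lborel.
                (norm (G (x, t)) powr (p - 2) *\<^sub>R G (x, t)) \<bullet> gradient (\<lambda>y. \<phi> (y, t)) x)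
             - (LINT t:{t1<..<t2}|lborel. LINT x:U|lborel. ?u (x, t) * deriv (\<lambda>s. \<phi> (x, s)) t) = 0)"
    proof (intro exI[of _ "\<lambda>z. g (fst z)"] conjI ballI)
      have "(\<lambda>x. ?u (x, t)) \<in> W1p p U \<and> weak_gradient U (\<lambda>x. ?u (x, t)) g" for t
      proof -
        have d: "((\<lambda>x. ?u (x, t)) has_derivative (\<lambda>h. g x \<bullet> h)) (at x)" for x
          unfolding u by (auto intro!: derivative_eq_intros dA)
        have w: "weak_gradient U (\<lambda>x. ?u (x, t)) g" by (rule weak_gradient_C1[OF U d cg])
        have "continuous_on UNIV (\<lambda>x. ?u (x, t))" unfolding u by (intro continuous_intros cA)
        from continuous_bounded_Lp[OF U bU this] continuous_bounded_Lp[OF U bU cg]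
        have "(\<lambda>x. ?u (x, t)) \<in> Lp p U" "g \<in> Lp p U" using p by simp_all
        then show ?thesis using w by (auto simp: W1p_def)
      qed
      moreover have "?u \<in> Lp p ?W" "(\<lambda>z. g (fst z)) \<in> Lp p ?W"
        using p by (auto intro!: continuous_bounded_Lp[OF oW bW] cu continuous_on_compose2[OF cg] continuous_intros)
      ultimately show "parabolic_sobolev p U t1 t2 ?u (\<lambda>z. g (fst z))"
        by (simp add: parabolic_sobolev_def)
    next
      fix \<phi> assume \<phi>: "\<phi> \<in> test_functions ?W"
      note t = test_function_derivative[OF \<phi>]
      have \<phi>0: "\<phi> x = 0" if "x \<notin> closure {z. \<phi> z \<noteq> 0}" for x
        using that closure_subset[of "{z. \<phi> z \<noteq> 0}"] by auto
      have l1: "((\<lambda>s. \<mu> * (fst (z + s *\<^sub>R (axis i 1, 0)) - y) $ i) has_real_derivative \<mu>) (at 0)" for z i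
        by (auto intro!: derivative_eq_intros simp: axis_def)
      have l2: "((\<lambda>s. ?u (z + s *\<^sub>R (0, 1))) has_real_derivative \<kappa>) (at 0)" for z
      proof -
        have "?u (z + s *\<^sub>R (0, 1)) = A (fst z) + \<kappa> * (snd z + s)" for s by (cases z) (simp add: u)
        then show ?thesis by (auto intro!: derivative_eq_intros)
      qed
      have cl: "continuous_on ?W (\<lambda>z. \<mu> * (fst z - y) $ i)" for i by (intro continuous_intros)
      note cs = continuous_on_subset[OF t(3) subset_UNIV] continuous_on_subset[OF t(2) subset_UNIV]
        continuous_on_subset[OF cu subset_UNIV]
      have x: "integrable lborel (\<lambda>z. indicator ?W z * (frechet_derivative \<phi> (at z) (axis i 1, 0) * (\<mu> * (fst z - y) $ i)))"
        "(\<integral>z. indicator ?W z * (frechet_derivative \<phi> (at z) (axis i 1, 0) * (\<mu> * (fst z - y) $ i)) \<partial>lborel) =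
           - (\<integral>z. indicator ?W z * (\<phi> z * \<mu>) \<partial>lborel)" for i
        by (rule integration_by_parts_directional[OF oW t(4,5) \<phi>0 cs(1) cl cs(2)[OF space_dir_Basis]
            continuous_on_const test_function_line_derivative[OF \<phi>] l1], assumption)+
      have t': "integrable lborel (\<lambda>z. indicator ?W z * (frechet_derivative \<phi> (at z) (0, 1) * ?u z))"
        "(\<integral>z. indicator ?W z * (frechet_derivative \<phi> (at z) (0, 1) * ?u z) \<partial>lborel) =
           - (\<integral>z. indicator ?W z * (\<phi> z * \<kappa>) \<partial>lborel)"
        by (rule integration_by_parts_directional[OF oW t(4,5) \<phi>0 cs(1) cs(3) cs(2)[OF time_dir_Basis]
            continuous_on_const test_function_line_derivative[OF \<phi>] l2], assumption)+
      let ?P = "\<lambda>z. \<Sum>i\<in>UNIV. indicator ?W z * (frechet_derivative \<phi> (at z) (axis i 1, 0) * (\<mu> * (fst z - y) $ i))"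
      let ?H = "\<lambda>z. indicator ?W z * (frechet_derivative \<phi> (at z) (0, 1) * ?u z)"
      have Pi: "integrable lborel ?P" by (intro Bochner_Integration.integrable_sum x(1))
      have P: "indicator {t1<..<t2} t *\<^sub>R (indicator U x *\<^sub>R ((norm (g (fst (x, t))) powr (p - 2) *\<^sub>R g (fst (x, t))) \<bullet> gradient (\<lambda>y. \<phi> (y, t)) x))
        = ?P (x, t)" for x t
        unfolding flux slice_gradient[OF \<phi>] inner_vec_def sum_distrib_left[symmetric]
        by (auto simp: indicator_def mult.commute mult.left_commute sum_distrib_left)
      have H: "indicator {t1<..<t2} t *\<^sub>R (indicator U x *\<^sub>R (?u (x, t) * deriv (\<lambda>s. \<phi> (x, s)) t)) = ?H (x, t)" for x t
        unfolding slice_gradient[OF \<phi>] by (auto simp: indicator_def mult.commute)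
      have "(\<integral>z. ?P z \<partial>lborel) = (\<Sum>i\<in>UNIV. \<integral>z. indicator ?W z * (frechet_derivative \<phi> (at z) (axis i 1, 0) * (\<mu> * (fst z - y) $ i)) \<partial>lborel)"
        by (rule Bochner_Integration.integral_sum) (rule x(1))
      also have "\<dots> = (\<Sum>i\<in>(UNIV::'n set). - (\<integral>z. indicator ?W z * (\<phi> z * \<mu>) \<partial>lborel))"
        by (simp only: x(2))
      also have "\<dots> = - (\<integral>z. indicator ?W z * (\<phi> z * \<kappa>) \<partial>lborel)"
      proof -
        have "(\<integral>z. indicator ?W z * (\<phi> z * \<kappa>) \<partial>lborel) = (\<integral>z. real CARD('n) * (indicator ?W z * (\<phi> z * \<mu>)) \<partial>lborel)"
          by (intro Bochner_Integration.integral_cong) (simp_all add: \<kappa>_def)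
        then show ?thesis by simp
      qed
      also have "\<dots> = (\<integral>z. ?H z \<partial>lborel)" using t'(2) by simp
      finally have "(\<integral>t. \<integral>x. ?P (x, t) \<partial>lborel \<partial>lborel) = (\<integral>t. \<integral>x. ?H (x, t) \<partial>lborel \<partial>lborel)"
        using integral_lborel_snd[OF Pi] integral_lborel_snd[OF t'(1)] by simp
      then show "(LINT t:{t1<..<t2}|lborel. LINT x:U|lborel.
                (norm (g (fst (x, t))) powr (p - 2) *\<^sub>R g (fst (x, t))) \<bullet> gradient (\<lambda>y. \<phi> (y, t)) x)
             - (LINT t:{t1<..<t2}|lborel. LINT x:U|lborel. ?u (x, t) * deriv (\<lambda>s. \<phi> (x, s)) t) = 0"
        unfolding set_lebesgue_integral_def integral_scaleR_right[symmetric] P H by simp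
    qed
  qed
qed

section \<open>Superparabolic functions and strict subsolutions\<close>

text \<open>The derivative of the difference has the sign of
  \<open>\<rho> s - (s + (\<rho> - 1) r) = (\<rho> - 1) (s - r)\<close>, so \<open>s = r\<close> is
  the only minimum.\<close>

lemma shifted_power_strict_min:
  fixes q \<rho> r s :: real
  assumes q: "1 < q" and \<rho>: "1 < \<rho>" and r: "0 \<le> r" and s: "0 \<le> s" "s \<noteq> r"
  shows "\<rho> powr (q - 1) * r powr q - (r + (\<rho> - 1) * r) powr q < \<rho> powr (q - 1) * s powr q - (s + (\<rho> - 1) * r) powr q"
proof -
  define f where "f s = \<rho> powr (q - 1) * s powr q - (s + (\<rho> - 1) * r) powr q" for s
  have der: "(f has_real_derivative q * ((\<rho> * s) powr (q - 1) - (s + (\<rho> - 1) * r) powr (q - 1))) (at s)"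
    if "0 < s" for s
  proof -
    have pos: "0 < s + (\<rho> - 1) * r" using that \<rho> r by (intro add_pos_nonneg) auto
    have "(f has_real_derivative (\<rho> powr (q - 1) * (q * s powr (q - 1)) - q * (s + (\<rho> - 1) * r) powr (q - 1))) (at s)"
    proof -
      have "((\<lambda>s. s + (\<rho> - 1) * r) has_real_derivative 1) (at s)" by (auto intro!: derivative_eq_intros)
      from DERIV_chain2[OF has_real_derivative_powr[OF pos] this]
      have "((\<lambda>s. (s + (\<rho> - 1) * r) powr q) has_real_derivative q * (s + (\<rho> - 1) * r) powr (q - 1)) (at s)"
        by simp
      from DERIV_diff[OF DERIV_cmult[OF has_real_derivative_powr[OF that]] this] show ?thesis
        unfolding f_def .
    qed
    then show ?thesis using that \<rho> by (simp add: powr_mult algebra_simps)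
  qed
  have cont: "continuous_on {a..b} f" if "0 \<le> a" for a b
    unfolding f_def using q that \<rho> r
    by (intro continuous_intros continuous_on_powr') (auto intro!: add_nonneg_nonneg)
  have "f r < f s"
  proof (cases "r < s")
    case True
    show ?thesis
    proof (rule DERIV_pos_imp_increasing_open[OF True _ cont[OF r]])
      fix x assume x: "r < x" "x < s"
      have "x + (\<rho> - 1) * r < \<rho> * x" using mult_strict_left_mono[OF x(1), of "\<rho> - 1"] \<rho> by (simp add: algebra_simps)
      then have "(x + (\<rho> - 1) * r) powr (q - 1) < (\<rho> * x) powr (q - 1)"
        using x r q \<rho> by (intro powr_less_mono2) (auto intro!: add_nonneg_nonneg)
      then have "0 < q * ((\<rho> * x) powr (q - 1) - (x + (\<rho> - 1) * r) powr (q - 1))" using q by simp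
      moreover have "0 < x" using x r by simp
      ultimately show "\<exists>y. DERIV f x :> y \<and> 0 < y" using der by blast
    qed
  next
    case False
    then have lt: "s < r" using s by simp
    show ?thesis
    proof (rule DERIV_neg_imp_decreasing_open[OF lt _ cont[OF s(1)]])
      fix x assume x: "s < x" "x < r"
      have "\<rho> * x < x + (\<rho> - 1) * r" using mult_strict_left_mono[OF x(2), of "\<rho> - 1"] \<rho> by (simp add: algebra_simps)
      then have "(\<rho> * x) powr (q - 1) < (x + (\<rho> - 1) * r) powr (q - 1)"
        using x s q \<rho> by (intro powr_less_mono2) auto
      then have "q * ((\<rho> * x) powr (q - 1) - (x + (\<rho> - 1) * r) powr (q - 1)) < 0"
        using q by (simp add: mult_pos_neg)
      moreover have "0 < x" using x s by simp
      ultimately show "\<exists>y. DERIV f x :> y \<and> y < 0" using der by blast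
    qed
  qed
  then show ?thesis by (simp add: f_def)
qed

text \<open>Stretching \<open>x\<^sub>0\<close> to \<open>\<rho> x\<^sub>0\<close> makes the flatter power \<open>|x + (\<rho> - 1) x\<^sub>0|\<^sup>q\<close> tangent from
  below to the steeper \<open>\<rho>\<^sup>q\<^sup>-\<^sup>1 |x|\<^sup>q\<close> at \<open>x\<^sub>0\<close>.\<close>

lemma shifted_norm_power_touches:
  fixes x x0 :: "'a::real_inner"
  assumes q: "1 < q" and \<rho>: "1 < \<rho>" and x: "x \<noteq> x0"
  shows "norm (x + (\<rho> - 1) *\<^sub>R x0) powr q - \<rho> powr (q - 1) * norm x powr q
    < norm (x0 + (\<rho> - 1) *\<^sub>R x0) powr q - \<rho> powr (q - 1) * norm x0 powr q"
proof -
  let ?r = "norm x0" and ?s = "norm x"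
  have tri: "norm (x + (\<rho> - 1) *\<^sub>R x0) \<le> ?s + (\<rho> - 1) * ?r"
    using norm_triangle_ineq[of x "(\<rho> - 1) *\<^sub>R x0"] \<rho> by simp
  have "x0 + (\<rho> - 1) *\<^sub>R x0 = \<rho> *\<^sub>R x0" by (simp add: algebra_simps)
  then have n0: "norm (x0 + (\<rho> - 1) *\<^sub>R x0) = ?r + (\<rho> - 1) * ?r" using \<rho> by (simp add: algebra_simps)
  show ?thesis
  proof (cases "?s = ?r")
    case False
    have "norm (x + (\<rho> - 1) *\<^sub>R x0) powr q \<le> (?s + (\<rho> - 1) * ?r) powr q"
      using tri q by (intro powr_mono2) auto
    then show ?thesis
      using shifted_power_strict_min[OF q \<rho> norm_ge_zero norm_ge_zero False] unfolding n0 by linarith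
  next
    case True
    \<comment> \<open>On the sphere through \<open>x0\<close> the radial function gives no
      strictness; it comes from the triangle inequality, where equality would make \<open>x\<close>
      and \<open>x0\<close> parallel and hence equal.\<close>
    have "norm (x + (\<rho> - 1) *\<^sub>R x0) \<noteq> ?s + (\<rho> - 1) * ?r"
    proof
      assume "norm (x + (\<rho> - 1) *\<^sub>R x0) = ?s + (\<rho> - 1) * ?r"
      then have "norm (x + (\<rho> - 1) *\<^sub>R x0) = norm x + norm ((\<rho> - 1) *\<^sub>R x0)" using \<rho> by simp
      then have "norm x *\<^sub>R ((\<rho> - 1) *\<^sub>R x0) = norm ((\<rho> - 1) *\<^sub>R x0) *\<^sub>R x"
        by (simp only: norm_triangle_eq)
      then have "(?r * (\<rho> - 1)) *\<^sub>R x0 = (?r * (\<rho> - 1)) *\<^sub>R x" using \<rho> True by (simp add: mult.commute)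
      moreover have "?r \<noteq> 0" using True x by auto
      ultimately show False using \<rho> x by simp
    qed
    then have "norm (x + (\<rho> - 1) *\<^sub>R x0) powr q < (?r + (\<rho> - 1) * ?r) powr q"
      using tri True q by (intro powr_less_mono2) auto
    then show ?thesis unfolding n0 True by simp
  qed
qed

text \<open>The exact solution \<open>h\<close> is steeper in time than the subsolution and flatter
  in space, centred so that it touches from below at \<open>x0\<close>. On the parabolic boundary of
  a small box this leaves a margin \<open>\<eta>\<close>; raising \<open>h\<close> by that margin
  keeps it below \<open>u\<close> there, hence inside, and lifts it above the subsolution at
  \<open>(x0, t0)\<close>.\<close>

lemma superparabolic_touching:
  fixes \<Theta> :: "((real^'n) \<times> real) set" and x0 :: "real^'n"
  assumes p: "1 < p" "p < 2" and u: "p_superparabolic p \<Theta> u" and V: "open V" "V \<subseteq> \<Theta>" "(x0, t0) \<in> V"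
    and \<gamma>: "0 < \<gamma>" and k: "0 \<le> k" "k < real CARD('n) * \<gamma> powr (p - 1)"
    and le: "\<And>x t. (x, t) \<in> V \<Longrightarrow> ereal (k * t + \<gamma> * (p - 1) / p * norm x powr (p / (p - 1)) + c) \<le> u (x, t)"
  shows "ereal (k * t0 + \<gamma> * (p - 1) / p * norm x0 powr (p / (p - 1)) + c) < u (x0, t0)"
proof -
  define q where "q = p / (p - 1)"
  have q: "1 < q" using p by (simp add: q_def field_simps)
  let ?n = "real CARD('n)"
  \<comment> \<open>Any slope strictly between \<open>k\<close> and the slope belonging to
    \<open>\<gamma>\<close> would do: being larger than \<open>k\<close> it gains a margin at
    earlier times, being smaller than the other it forces
    \<open>\<gamma>' < \<gamma>\<close>.\<close>
  define k' where "k' = (k + ?n * \<gamma> powr (p - 1)) / 2"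
  have k': "k < k'" "k' < ?n * \<gamma> powr (p - 1)" "0 < k'" using k by (auto simp: k'_def)
  define \<gamma>' where "\<gamma>' = (k' / ?n) powr (1 / (p - 1))"
  have \<gamma>'pos: "0 < \<gamma>'" using k' by (simp add: \<gamma>'_def)
  have \<gamma>'p: "\<gamma>' powr (p - 1) = k' / ?n" using p k' by (simp add: \<gamma>'_def powr_powr)
  have k'eq: "?n * (\<bar>\<gamma>'\<bar> powr (p - 2) * \<gamma>') = k'"
  proof -
    have "\<bar>\<gamma>'\<bar> powr (p - 2) * \<gamma>' = \<gamma>' powr (p - 1)"
      using \<gamma>'pos powr_mult_base[of \<gamma>' "p - 2"] by (simp add: mult.commute)
    then show ?thesis by (simp add: \<gamma>'p)
  qed
  have \<gamma>lt: "\<gamma>' < \<gamma>"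
  proof -
    have "\<gamma>' powr (p - 1) < \<gamma> powr (p - 1)" using k'(2) by (simp add: \<gamma>'p field_simps)
    then show ?thesis using p \<gamma> powr_mono2[of "p - 1" \<gamma> \<gamma>'] by (meson le_less_linear less_eq_real_def not_le diff_ge_0_iff_ge)
  qed
  \<comment> \<open>Chosen so that \<open>\<gamma>' * \<rho> powr (q - 1) = \<gamma>\<close>, the
    ratio of coefficients for which the shifted power is tangent at \<open>x0\<close>.\<close>
  define \<rho> where "\<rho> = (\<gamma> / \<gamma>') powr (p - 1)"
  have \<rho>: "1 < \<rho>" unfolding \<rho>_def using \<gamma>lt \<gamma>'pos p by (intro gr_one_powr) auto
  have \<rho>q: "\<gamma>' * \<rho> powr (q - 1) = \<gamma>"
  proof -
    have "(p - 1) * (q - 1) = 1" using p by (simp add: q_def field_simps)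
    then show ?thesis using \<gamma> \<gamma>'pos by (simp add: \<rho>_def powr_powr)
  qed
  define w where "w = - ((\<rho> - 1) *\<^sub>R x0)"
  define \<beta> where "\<beta> = (p - 1) / p"
  have \<beta>: "0 < \<beta>" using p by (simp add: \<beta>_def)
  define B where "B x = \<beta> * (\<gamma>' * norm (x - w) powr q - \<gamma> * norm x powr q)" for x
  have B: "B x < B x0" if "x \<noteq> x0" for x
  proof -
    have "\<gamma>' * (norm (x + (\<rho> - 1) *\<^sub>R x0) powr q - \<rho> powr (q - 1) * norm x powr q)
      < \<gamma>' * (norm (x0 + (\<rho> - 1) *\<^sub>R x0) powr q - \<rho> powr (q - 1) * norm x0 powr q)"
      using shifted_norm_power_touches[OF q \<rho> that] \<gamma>'pos by simp
    then have "\<gamma>' * norm (x - w) powr q - \<gamma> * norm x powr q < \<gamma>' * norm (x0 - w) powr q - \<gamma> * norm x0 powr q"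
      by (simp add: w_def right_diff_distrib mult.assoc[symmetric] \<rho>q)
    then show ?thesis using \<beta> by (simp add: B_def)
  qed
  define v where "v x t = k * t + \<gamma> * (p - 1) / p * norm x powr (p / (p - 1)) + c" for x :: "real^'n" and t
  have vB: "power_solution p \<gamma>' w c' (x, t) = v x t + (k' - k) * t + B x + (c' - c)" for x t c'
    unfolding power_solution_def k'eq v_def B_def q_def[symmetric] using p
    by (simp add: \<beta>_def algebra_simps diff_divide_distrib)
  obtain a1 \<tau>1 b1 \<tau>2 where ab: "cbox (a1, \<tau>1) (b1, \<tau>2) \<subseteq> V" "(x0, t0) \<in> box (a1, \<tau>1) (b1, \<tau>2)"
    using open_contains_cbox[OF V(1,3)] by (metis surj_pair)
  have x0: "x0 \<in> box a1 b1" and t0: "\<tau>1 < t0" "t0 < \<tau>2" using ab(2) by (auto simp: box_Pair)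
  have abi: "a1 $ i < b1 $ i" for i using x0 by (auto simp: mem_box_cart intro: less_trans)
  have cbV: "(x, t) \<in> V" if "x \<in> cbox a1 b1" "\<tau>1 \<le> t" "t \<le> \<tau>2" for x t
    using ab(1) that by (auto simp: cbox_Pair_eq)
  have clQ: "closure (box a1 b1) = cbox a1 b1" using x0 by (intro closure_box) auto
  have cB: "continuous_on A B" for A
    unfolding B_def using q by (intro continuous_intros continuous_on_powr') auto
  obtain \<mu> where \<mu>: "0 < \<mu>" "\<And>x. x \<in> frontier (box a1 b1) \<Longrightarrow> B x \<le> B x0 - \<mu>"
  proof (cases "frontier (box a1 b1) = {}")
    case True
    then show ?thesis using that[of 1] by auto
  next
    case False
    have "compact (frontier (box a1 b1))" by (simp add: compact_frontier_bounded bounded_box)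
    from continuous_attains_sup[OF this False cB] obtain y where
      y: "y \<in> frontier (box a1 b1)" "\<And>x. x \<in> frontier (box a1 b1) \<Longrightarrow> B x \<le> B y" by blast
    have "y \<noteq> x0" using y(1) x0 by (auto simp: frontier_def interior_open[OF open_box])
    from B[OF this] show ?thesis using that[of "B x0 - B y"] y(2) by auto
  qed
  \<comment> \<open>After \<open>t0\<close> the solution outgrows the subsolution at rate
    \<open>k' - k\<close>; the box ends before this consumes half of the lateral margin
    \<open>\<mu>\<close>.\<close>
  define t2 where "t2 = min \<tau>2 (t0 + \<mu> / (2 * (k' - k)))"
  have t2: "t0 < t2" "t2 \<le> \<tau>2" using t0 \<mu> k' by (auto simp: t2_def)
  have t2': "(k' - k) * (t - t0) \<le> \<mu> / 2" if "t \<le> t2" for t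
  proof -
    have "t - t0 \<le> \<mu> / (2 * (k' - k))" using that by (auto simp: t2_def)
    then have "(k' - k) * (t - t0) \<le> (k' - k) * (\<mu> / (2 * (k' - k)))" using k' by (intro mult_left_mono) auto
    also have "\<dots> = \<mu> / 2" using k' by (simp add: field_simps)
    finally show ?thesis .
  qed
  \<comment> \<open>The first term is the half of the lateral margin that is left, the second the
    margin gained at the bottom between \<open>\<tau>1\<close> and \<open>t0\<close>.\<close>
  define \<eta> where "\<eta> = min (\<mu> / 2) ((k' - k) * (t0 - \<tau>1))"
  have \<eta>: "0 < \<eta>" "\<eta> \<le> \<mu> / 2" "\<eta> \<le> (k' - k) * (t0 - \<tau>1)" using \<mu> k' t0 by (auto simp: \<eta>_def)
  define h where "h = power_solution p \<gamma>' w (c - (k' - k) * t0 - B x0 + \<eta>)"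
  have h: "h (x, t) = v x t + (k' - k) * (t - t0) + (B x - B x0) + \<eta>" for x t
    unfolding h_def vB by (simp add: algebra_simps)
  have hp: "p_parabolic p S h" for S unfolding h_def by (rule power_solution_p_parabolic[OF p])
  have hc: "continuous_on S h" for S using hp[of S] by (simp add: p_parabolic_def)
  let ?Q = "box a1 b1"
  have cl: "closure (?Q \<times> {\<tau>1<..<t2}) = cbox a1 b1 \<times> {\<tau>1..t2}" using t0 t2 by (simp add: closure_Times clQ)
  have comp: "?Q \<times> {\<tau>1<..<t2} \<Subset> \<Theta>"
    unfolding compactly_contained_def cl using t2 cbV V(2) by (auto intro!: compact_Times)
  have bd: "ereal (h \<xi>) \<le> u \<xi>" if \<xi>: "\<xi> \<in> parabolic_boundary ?Q \<tau>1 t2" for \<xi>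
  proof -
    obtain x t where xt: "\<xi> = (x, t)" by force
    have fr: "frontier ?Q \<subseteq> cbox a1 b1" using clQ by (auto simp: frontier_def)
    have inV: "(x, t) \<in> V" using \<xi> t0 t2 clQ fr by (intro cbV) (auto simp: xt parabolic_boundary_def)
    have Ble: "B x \<le> B x0" using B[of x] by (cases "x = x0") auto
    have "h (x, t) \<le> v x t"
    proof (cases "t = \<tau>1")
      case True
      have "(k' - k) * (t - t0) = - ((k' - k) * (t0 - \<tau>1))" by (simp add: True algebra_simps)
      then show ?thesis unfolding h using Ble \<eta>(3) by linarith
    next
      case False
      then have "x \<in> frontier ?Q" "t \<le> t2" using \<xi> by (auto simp: xt parabolic_boundary_def)
      then show ?thesis unfolding h using \<mu>(2)[of x] t2'[of t] \<eta>(2) by linarith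
    qed
    then show ?thesis using le[OF inV] unfolding xt v_def by (meson ereal_less_eq(3) order_trans)
  qed
  have "ereal (h (x0, t0)) \<le> u (x0, t0)"
  proof -
    have "(x0, t0) \<in> ?Q \<times> {\<tau>1<..<t2}" using x0 t0 t2 by simp
    moreover have "(\<forall>i. a1 $ i < b1 $ i) \<and> \<tau>1 < t2 \<and> ?Q \<times> {\<tau>1<..<t2} \<Subset> \<Theta> \<and>
        p_parabolic p (?Q \<times> {\<tau>1<..<t2}) h \<and> continuous_on (closure (?Q \<times> {\<tau>1<..<t2})) h \<and>
        (\<forall>\<xi>\<in>parabolic_boundary ?Q \<tau>1 t2. ereal (h \<xi>) \<le> u \<xi>)"
      using abi t0 t2 comp hp hc bd by auto
    ultimately show ?thesis using u unfolding p_superparabolic_def by blast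
  qed
  moreover have "h (x0, t0) = v x0 t0 + \<eta>" by (simp add: h)
  ultimately have "ereal (v x0 t0 + \<eta>) \<le> u (x0, t0)" by simp
  moreover have "ereal (v x0 t0) < ereal (v x0 t0 + \<eta>)" using \<eta> by simp
  ultimately show ?thesis unfolding v_def by (meson less_le_trans)
qed

text \<open>A minimising sequence for \<open>u - v\<close> on the part of \<open>\<Theta>\<close>
  after \<open>T0\<close> has a limit in the compact closure. Were the infimum negative, this limit
  could lie neither on the frontier nor at time \<open>T0\<close>, and at an interior point the
  subsolution \<open>v\<close>, shifted by the infimum, would touch \<open>u\<close>, which
  \<open>superparabolic_touching\<close> forbids.\<close>

lemma superparabolic_ge_subsolution:
  fixes \<Theta> :: "((real^'n) \<times> real) set"
  assumes p: "1 < p" "p < 2" and \<Theta>: "open \<Theta>" "bounded \<Theta>" and u: "p_superparabolic p \<Theta> u"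
    and m: "\<And>\<xi>. \<xi> \<in> \<Theta> \<Longrightarrow> ereal m \<le> u \<xi>"
    and \<gamma>: "0 < \<gamma>" and k: "0 \<le> k" "k < real CARD('n) * \<gamma> powr (p - 1)"
    and v: "\<And>x t. v (x, t) = k * t + \<gamma> * (p - 1) / p * norm x powr (p / (p - 1)) + c"
    and frontier: "\<And>\<xi>. \<xi> \<in> frontier \<Theta> \<Longrightarrow> T0 \<le> snd \<xi> \<Longrightarrow> ereal (v \<xi>) \<le> Liminf (at \<xi> within \<Theta>) u"
    and bottom: "\<And>\<xi>. \<xi> \<in> \<Theta> \<Longrightarrow> snd \<xi> = T0 \<Longrightarrow> ereal (v \<xi>) \<le> u \<xi>"
    and \<xi>1: "\<xi>1 \<in> \<Theta>" "T0 \<le> snd \<xi>1"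
  shows "ereal (v \<xi>1) \<le> u \<xi>1"
proof (rule ccontr)
  assume neg: "\<not> ereal (v \<xi>1) \<le> u \<xi>1"
  have vc: "continuous_on UNIV v"
  proof -
    have "v = (\<lambda>z. k * snd z + \<gamma> * (p - 1) / p * norm (fst z) powr (p / (p - 1)) + c)"
      using v by (auto simp: fun_eq_iff)
    then show ?thesis using p by (auto intro!: continuous_intros continuous_on_powr')
  qed
  define D where "D = {\<xi>\<in>\<Theta>. T0 \<le> snd \<xi>}"
  \<comment> \<open>The finite values of \<open>u - v\<close>, taken as reals so that no subtraction
    of extended reals occurs.\<close>
  define S where "S = {r. \<exists>\<xi>\<in>D. u \<xi> = ereal (r + v \<xi>)}"
  have cl: "compact (closure \<Theta>)" using \<Theta> by (simp add: compact_closure)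
  have "compact (v ` closure \<Theta>)" by (intro compact_continuous_image cl continuous_on_subset[OF vc]) auto
  from compact_imp_bounded[OF this] obtain b where b: "\<And>\<xi>. \<xi> \<in> closure \<Theta> \<Longrightarrow> \<bar>v \<xi>\<bar> \<le> b"
    unfolding bounded_iff by auto
  have Sb: "m - b \<le> r" if r: "r \<in> S" for r
  proof -
    obtain \<xi> where \<xi>: "\<xi> \<in> \<Theta>" "u \<xi> = ereal (r + v \<xi>)" using r by (auto simp: S_def D_def)
    then have "m \<le> r + v \<xi>" using m[OF \<xi>(1)] by simp
    then show ?thesis using b[of \<xi>] \<xi>(1) closure_subset[of \<Theta>] by force
  qed
  then have bdd: "bdd_below S" by (auto simp: bdd_below_def)
  define c0 where "c0 = Inf S"
  have ge: "ereal (v \<xi> + c0) \<le> u \<xi>" if "\<xi> \<in> D" for \<xi>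
  proof (cases "u \<xi>")
    case (real x)
    then have "x - v \<xi> \<in> S" unfolding S_def using that by (intro CollectI bexI[of _ \<xi>]) simp_all
    then have "c0 \<le> x - v \<xi>" unfolding c0_def by (rule cInf_lower[OF _ bdd])
    then show ?thesis using real by simp
  next
    case MInf
    then show ?thesis using m[of \<xi>] that by (simp add: D_def)
  qed simp
  have \<xi>1D: "\<xi>1 \<in> D" using \<xi>1 by (simp add: D_def)
  have Sne: "S \<noteq> {}" and c0: "c0 < 0"
  proof -
    obtain x where x: "u \<xi>1 = ereal x" "x < v \<xi>1"
      using neg m[OF \<xi>1(1)] by (cases "u \<xi>1") auto
    then have "x - v \<xi>1 \<in> S" unfolding S_def using \<xi>1D by (intro CollectI bexI[of _ \<xi>1]) simp_all
    then show "S \<noteq> {}" by blast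
    have "c0 \<le> x - v \<xi>1" unfolding c0_def by (rule cInf_lower[OF \<open>x - v \<xi>1 \<in> S\<close> bdd])
    then show "c0 < 0" using x(2) by simp
  qed
  have "\<exists>\<xi>\<in>D. u \<xi> \<le> ereal (v \<xi> + c0 + 1 / real (Suc j))" for j
  proof -
    have "\<exists>r\<in>S. r < c0 + 1 / real (Suc j)" using cInf_lessD[OF Sne, of "c0 + 1 / real (Suc j)"] by (simp add: c0_def)
    then obtain r \<xi> where "\<xi> \<in> D" "u \<xi> = ereal (r + v \<xi>)" "r < c0 + 1 / real (Suc j)" by (auto simp: S_def)
    then show ?thesis by (intro bexI[of _ \<xi>]) auto
  qed
  then obtain X where X: "\<And>j. X j \<in> D" "\<And>j. u (X j) \<le> ereal (v (X j) + c0 + 1 / real (Suc j))" by metis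
  have "\<forall>j. X j \<in> closure \<Theta>" using X(1) closure_subset[of \<Theta>] by (auto simp: D_def)
  then obtain \<xi>0 s where \<xi>0: "\<xi>0 \<in> closure \<Theta>" and s: "strict_mono s" and lim: "(X \<circ> s) \<longlonglongrightarrow> \<xi>0"
    using cl unfolding compact_def by blast
  have snd0: "T0 \<le> snd \<xi>0"
  proof (rule LIMSEQ_le_const[OF tendsto_snd[OF lim]])
    show "\<exists>N. \<forall>n\<ge>N. T0 \<le> snd ((X \<circ> s) n)" using X(1) by (auto simp: D_def)
  qed
  \<comment> \<open>Lower semicontinuity along the sequence. The second premise on \<open>B\<close>
    is there because the sequence may hit \<open>\<xi>0\<close> itself, a point that
    \<open>at \<xi>0 within \<Theta>\<close> omits.\<close>
  have lsc: "B \<le> v \<xi>0 + c0" if B: "ereal B < Liminf (at \<xi>0 within \<Theta>) u" "\<xi>0 \<in> \<Theta> \<Longrightarrow> ereal B < u \<xi>0" for B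
  proof -
    have "\<forall>\<^sub>F \<xi> in at \<xi>0 within \<Theta>. ereal B < u \<xi>" using B(1) by (rule less_LiminfD)
    then have "\<forall>\<^sub>F \<xi> in nhds \<xi>0. \<xi> \<in> \<Theta> \<longrightarrow> ereal B < u \<xi>"
      unfolding eventually_at_filter by eventually_elim (use B(2) in auto)
    from eventually_compose_filterlim[OF this lim]
    have "\<forall>\<^sub>F j in sequentially. B \<le> v (X (s j)) + c0 + 1 / real (Suc (s j))"
    proof eventually_elim
      case (elim j)
      then have "ereal B < u (X (s j))" using X(1)[of "s j"] by (simp add: D_def)
      from less_le_trans[OF this X(2)] show ?case by simp
    qed
    moreover have "(\<lambda>j. v (X (s j)) + c0 + 1 / real (Suc (s j))) \<longlonglongrightarrow> v \<xi>0 + c0 + 0"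
    proof (intro tendsto_intros)
      show "(\<lambda>j. v (X (s j))) \<longlonglongrightarrow> v \<xi>0"
        using continuous_on_tendsto_compose[OF vc lim] by (simp add: comp_def)
      show "(\<lambda>j. 1 / real (Suc (s j))) \<longlonglongrightarrow> 0"
        using LIMSEQ_subseq_LIMSEQ[OF LIMSEQ_Suc[OF lim_1_over_n] s] by (simp add: comp_def)
    qed
    ultimately show ?thesis using tendsto_lowerbound by fastforce
  qed
  show False
  proof (cases "\<xi>0 \<in> \<Theta>")
    case False
    then have "\<xi>0 \<in> frontier \<Theta>" using \<xi>0 \<Theta> by (simp add: frontier_def interior_open)
    then have "ereal (v \<xi>0) \<le> Liminf (at \<xi>0 within \<Theta>) u" using frontier snd0 by blast
    moreover have "ereal (v \<xi>0 + c0 / 2) < ereal (v \<xi>0)" using c0 by simp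
    ultimately have "ereal (v \<xi>0 + c0 / 2) < Liminf (at \<xi>0 within \<Theta>) u" by (rule less_le_trans[rotated])
    from lsc[OF this] False have "v \<xi>0 + c0 / 2 \<le> v \<xi>0 + c0" by blast
    then show False using c0 by simp
  next
    case True
    have le0: "u \<xi>0 \<le> ereal (v \<xi>0 + c0)"
    proof (rule ccontr)
      assume "\<not> u \<xi>0 \<le> ereal (v \<xi>0 + c0)"
      then have "ereal (v \<xi>0 + c0) < u \<xi>0" by (simp only: not_le)
      then obtain B where B: "ereal (v \<xi>0 + c0) < ereal B" "ereal B < u \<xi>0"
        using ereal_dense2[of "ereal (v \<xi>0 + c0)" "u \<xi>0"] by auto
      have "u \<xi>0 \<le> Liminf (at \<xi>0 within \<Theta>) u" using u True by (simp add: p_superparabolic_def)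
      from lsc[OF less_le_trans[OF B(2) this]] B(2) have "B \<le> v \<xi>0 + c0" by blast
      then show False using B(1) by simp
    qed
    have "snd \<xi>0 \<noteq> T0"
    proof
      assume "snd \<xi>0 = T0"
      from order_trans[OF bottom[OF True this] le0] c0 show False by simp
    qed
    then have sn: "T0 < snd \<xi>0" using snd0 by simp
    define V where "V = \<Theta> \<inter> {\<xi>. T0 < snd \<xi>}"
    obtain x0 t0 where xt: "\<xi>0 = (x0, t0)" by force
    have oV: "open V" unfolding V_def by (intro open_Int \<Theta>(1) open_Collect_less continuous_intros)
    have "ereal (k * t0 + \<gamma> * (p - 1) / p * norm x0 powr (p / (p - 1)) + (c + c0)) < u (x0, t0)"
    proof (rule superparabolic_touching[OF p u oV _ _ \<gamma> k])
      show "V \<subseteq> \<Theta>" "(x0, t0) \<in> V" using True sn by (auto simp: V_def xt)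
      show "ereal (k * t + \<gamma> * (p - 1) / p * norm x powr (p / (p - 1)) + (c + c0)) \<le> u (x, t)" if "(x, t) \<in> V" for x t
        using ge[of "(x, t)"] that unfolding v by (auto simp: V_def D_def add.assoc)
    qed
    then show False using le0 unfolding xt v by (simp add: add.assoc)
  qed
qed

section \<open>Barriers\<close>

text \<open>A solution that is a useful barrier only at late times is continued backwards by the
  constant \<open>N\<close>. Since \<open>w \<ge> N\<close> on the whole layer from
  \<open>T0\<close> to \<open>T1\<close>, the minimum already equals \<open>N\<close> there, and the
  two pieces fit together.\<close>

lemma p_superparabolic_truncation:
  fixes \<Theta> :: "((real^'n) \<times> real) set"
  assumes p: "1 < p" "p < 2" and \<Theta>: "open \<Theta>" and w: "\<And>S. p_parabolic p S w"
    and T: "T0 < T1" and N: "\<And>\<xi>. \<xi> \<in> \<Theta> \<Longrightarrow> T0 \<le> snd \<xi> \<Longrightarrow> snd \<xi> \<le> T1 \<Longrightarrow> N \<le> w \<xi>"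
  shows "p_superparabolic p \<Theta> (\<lambda>\<xi>. ereal (if T0 < snd \<xi> then min (w \<xi>) N else N))"
proof -
  define u where "u \<xi> = (if T0 < snd \<xi> then min (w \<xi>) N else N)" for \<xi>
  have uN: "u \<xi> \<le> N" and u_le_w: "T0 < snd \<xi> \<Longrightarrow> u \<xi> \<le> w \<xi>" for \<xi> by (simp_all add: u_def)
  have wc: "continuous_on S w" for S using w[of S] by (simp add: p_parabolic_def)
  have cu: "continuous_on \<Theta> u"
  proof -
    \<comment> \<open>Continuity across \<open>T0\<close> follows from two open sets that overlap in
      the layer: on the one before \<open>T1\<close> the function is the constant
      \<open>N\<close>.\<close>
    have 1: "continuous_on (\<Theta> \<inter> {\<xi>. snd \<xi> < T1}) u"
    proof (rule continuous_on_eq[OF continuous_on_const[of _ N]])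
      fix \<xi> assume "\<xi> \<in> \<Theta> \<inter> {\<xi>. snd \<xi> < T1}"
      then have "T0 < snd \<xi> \<Longrightarrow> N \<le> w \<xi>" using N[of \<xi>] by simp
      then show "N = u \<xi>" by (simp add: u_def)
    qed
    have 2: "continuous_on (\<Theta> \<inter> {\<xi>. T0 < snd \<xi>}) u"
      by (rule continuous_on_eq[of _ "\<lambda>\<xi>. min (w \<xi>) N"]) (auto intro!: continuous_intros wc simp: u_def)
    have o: "open (\<Theta> \<inter> {\<xi>. snd \<xi> < T1})" "open (\<Theta> \<inter> {\<xi>. T0 < snd \<xi>})"
      by (intro open_Int \<Theta> open_Collect_less continuous_intros)+
    have "\<Theta> = \<Theta> \<inter> {\<xi>. snd \<xi> < T1} \<union> \<Theta> \<inter> {\<xi>. T0 < snd \<xi>}" using T by auto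
    then show ?thesis using continuous_on_open_Un[OF o 1 2] by simp
  qed
  have lsc: "ereal (u \<xi>) \<le> Liminf (at \<xi> within \<Theta>) (\<lambda>\<xi>. ereal (u \<xi>))" if "\<xi> \<in> \<Theta>" for \<xi>
  proof -
    have "(u \<longlongrightarrow> u \<xi>) (at \<xi> within \<Theta>)"
      using cu that by (simp add: continuous_on_def)
    then have lim: "((\<lambda>\<xi>. ereal (u \<xi>)) \<longlongrightarrow> ereal (u \<xi>)) (at \<xi> within \<Theta>)"
      by (rule tendsto_ereal)
    have "at \<xi> within \<Theta> \<noteq> bot" unfolding at_within_open[OF that \<Theta>] by (rule at_neq_bot)
    from lim_imp_Liminf[OF this lim] show ?thesis by simp
  qed
  have comparison: "h \<xi> \<le> u \<xi>"
    if Q: "box a b \<times> {t1<..<t2} \<Subset> \<Theta>" "t1 < t2" "\<And>i. a $ i < b $ i"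
      and h: "p_parabolic p (box a b \<times> {t1<..<t2}) h" "continuous_on (closure (box a b \<times> {t1<..<t2})) h"
      and bd: "\<And>\<xi>. \<xi> \<in> parabolic_boundary (box a b) t1 t2 \<Longrightarrow> h \<xi> \<le> u \<xi>"
      and \<xi>: "\<xi> \<in> box a b \<times> {t1<..<t2}" for a b t1 t2 h \<xi>
  proof -
    let ?Q = "box a b"
    have cl: "closure ?Q \<times> {t1..t2} \<subseteq> \<Theta>" using Q(1,2) by (auto simp: compactly_contained_def closure_Times)
    have clQ: "closure ?Q = ?Q \<union> frontier ?Q" using closure_Un_frontier by auto
    have N_par: "p_parabolic p S (\<lambda>_. N)" for S :: "((real^'n) \<times> real) set"
    proof -
      have "power_solution p 0 0 N = (\<lambda>_ :: (real^'n) \<times> real. N)" by (simp add: power_solution_def fun_eq_iff)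
      then show ?thesis using power_solution_p_parabolic[OF p, of S 0 0 N] by simp
    qed
    \<comment> \<open>The comparison with the constant comes first; it settles times up to
      \<open>T0\<close> and supplies initial values for the comparison with
      \<open>w\<close>.\<close>
    have hN: "h \<xi> \<le> N" if "\<xi> \<in> ?Q \<times> {t1<..<t2}" for \<xi>
      by (rule parabolic_comparison[OF p(1) h(1) N_par h(2) continuous_on_const order_refl _ that])
         (rule order_trans[OF bd uN])
    show ?thesis
    proof (cases "T0 < snd \<xi>")
      case False
      then show ?thesis using hN[OF \<xi>] by (simp add: u_def)
    next
      case True
      define s where "s = max t1 T0"
      have "h \<xi> \<le> w \<xi>"
      proof (rule parabolic_comparison[OF p(1) h(1) w h(2) wc])
        show "t1 \<le> s" by (simp add: s_def)
        show \<xi>s: "\<xi> \<in> ?Q \<times> {s<..<t2}" using \<xi> True by (auto simp: s_def)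
        fix \<zeta> assume \<zeta>: "\<zeta> \<in> parabolic_boundary ?Q s t2"
        have st: "s < t2" using \<xi>s by auto
        show "h \<zeta> \<le> w \<zeta>"
        proof (cases "\<zeta> \<in> parabolic_boundary ?Q t1 t2 \<and> T0 < snd \<zeta>")
          case True
          then show ?thesis using bd[of \<zeta>] u_le_w[of \<zeta>] by auto
        next
          case False
          obtain x t where xt: "\<zeta> = (x, t)" by force
          \<comment> \<open>What remains is an initial time equal to \<open>T0\<close>, where the
            solutions are ordered through the constant:
            \<open>h \<zeta> \<le> N \<le> w \<zeta>\<close>.\<close>
          have x: "x \<in> closure ?Q" "t = s" "s = T0" "t1 \<le> T0"
            using False \<zeta> clQ by (auto simp: xt parabolic_boundary_def s_def max_def split: if_splits)
          have "\<zeta> \<in> \<Theta>" using cl x st by (auto simp: xt)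
          then have "N \<le> w \<zeta>" using x T by (intro N) (auto simp: xt)
          moreover have "h \<zeta> \<le> N"
          proof (cases "\<zeta> \<in> ?Q \<times> {t1<..<t2}")
            case True
            then show ?thesis by (rule hN)
          next
            case False
            then have "\<zeta> \<in> parabolic_boundary ?Q t1 t2"
              using x st clQ by (auto simp: xt parabolic_boundary_def)
            from order_trans[OF bd[OF this] uN] show ?thesis .
          qed
          ultimately show ?thesis by simp
        qed
      qed
      then show ?thesis using hN[OF \<xi>] True by (simp add: u_def)
    qed
  qed
  show ?thesis
    unfolding p_superparabolic_def u_def[symmetric]
  proof (intro conjI allI ballI impI)
    show "\<Theta> \<subseteq> closure {\<xi>\<in>\<Theta>. ereal (u \<xi>) \<noteq> \<infinity>}" using closure_subset by auto
    show "ereal (u \<xi>) \<le> Liminf (at \<xi> within \<Theta>) (\<lambda>\<xi>. ereal (u \<xi>))" if "\<xi> \<in> \<Theta>" for \<xi>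
      by (rule lsc[OF that])
    show "ereal (h \<xi>) \<le> ereal (u \<xi>)"
      if "(\<forall>i. a $ i < b $ i) \<and> t1 < t2 \<and> box a b \<times> {t1<..<t2} \<Subset> \<Theta> \<and>
        p_parabolic p (box a b \<times> {t1<..<t2}) h \<and> continuous_on (closure (box a b \<times> {t1<..<t2})) h \<and>
        (\<forall>\<xi>\<in>parabolic_boundary (box a b) t1 t2. ereal (h \<xi>) \<le> ereal (u \<xi>))"
        and "\<xi> \<in> box a b \<times> {t1<..<t2}" for a b t1 t2 h \<xi>
      unfolding ereal_less_eq(3)
      by (rule comparison[of a b t1 t2 h \<xi>]) (use that in simp_all)
  qed auto
qed

text \<open>Once \<open>\<gamma>\<close> is solved from the equation with
  \<open>4 * N / \<delta>\<close>, every remaining condition holds for all sufficiently small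
  \<open>\<delta>\<close>. The constant 4 is twice that of the slope \<open>2 * N / \<delta>\<close>
  used from below: one factor 2 reaches height \<open>N\<close> after spending part of the slope on
  the power of \<open>|x|\<close>, the other makes the subsolution strict.\<close>

lemma barrier_parameters:
  fixes p l K N n r :: real
  assumes p: "1 < p" and l: "0 < l" "l < p" and pos: "0 < K" "0 < N" "0 < n" "0 < r"
  obtains \<delta> \<gamma> where "0 < \<delta>" "\<delta> < 1" "(K * \<delta>) powr (1 / l) + \<delta> < r" "0 < \<gamma>"
    "n * \<gamma> powr (p - 1) = 4 * N / \<delta>" "\<gamma> * (p - 1) / p * (K * \<delta>) powr (p / (p - 1) / l) \<le> N"
proof -
  define q where "q = p / (p - 1)"
  define e where "e = q / l - 1 / (p - 1)"
  have e: "0 < e"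
  proof -
    have "1 / (p - 1) = q / p" using p by (simp add: q_def)
    moreover have "q / p < q / l" using p l by (intro divide_strict_left_mono) (auto simp: q_def)
    ultimately show ?thesis by (simp add: e_def)
  qed
  define C where "C = (4 * N / n) powr (1 / (p - 1)) * (p - 1) / p * K powr (q / l)"
  have lim0: "((\<lambda>\<delta>. \<delta>) \<longlongrightarrow> 0) (at_right (0::real))" by (rule tendsto_ident_at)
  have ev0: "\<forall>\<^sub>F \<delta> in at_right (0::real). 0 < \<delta>" by (simp add: eventually_at_right_less)
  have "((\<lambda>\<delta>. \<delta> powr e) \<longlongrightarrow> 0) (at_right 0)"
    using ev0 by (intro tendsto_zero_powrI[OF lim0 tendsto_const _ e]) (auto elim: eventually_mono)
  from tendsto_mult_left[OF this, of C] have l1: "((\<lambda>\<delta>. C * \<delta> powr e) \<longlongrightarrow> 0) (at_right 0)" by simp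
  have "((\<lambda>\<delta>. K * \<delta>) \<longlongrightarrow> 0) (at_right 0)" using tendsto_mult_left[OF lim0, of K] by simp
  then have "((\<lambda>\<delta>. (K * \<delta>) powr (1 / l)) \<longlongrightarrow> 0) (at_right 0)"
    using ev0 pos l by (intro tendsto_zero_powrI[OF _ tendsto_const]) (auto elim: eventually_mono)
  from tendsto_add[OF this lim0] have l2: "((\<lambda>\<delta>. (K * \<delta>) powr (1 / l) + \<delta>) \<longlongrightarrow> 0) (at_right 0)" by simp
  have "\<forall>\<^sub>F \<delta> in at_right 0. 0 < \<delta> \<and> \<delta> < 1 \<and> C * \<delta> powr e < N \<and> (K * \<delta>) powr (1 / l) + \<delta> < r"
    using ev0 order_tendstoD(2)[OF lim0, of 1] order_tendstoD(2)[OF l1 pos(2)] order_tendstoD(2)[OF l2 pos(4)]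
    by (simp add: eventually_conj_iff)
  then obtain \<delta> where \<delta>: "0 < \<delta>" "\<delta> < 1" "C * \<delta> powr e < N" "(K * \<delta>) powr (1 / l) + \<delta> < r"
    using eventually_happens'[OF trivial_limit_at_right_real] by blast
  define \<gamma> where "\<gamma> = (4 * N / (n * \<delta>)) powr (1 / (p - 1))"
  show ?thesis
  proof (rule that[OF \<delta>(1,2,4)])
    show "0 < \<gamma>" using pos \<delta> by (simp add: \<gamma>_def)
    show "n * \<gamma> powr (p - 1) = 4 * N / \<delta>" using p pos \<delta> by (simp add: \<gamma>_def powr_powr)
    have "\<gamma> = (4 * N / n) powr (1 / (p - 1)) * \<delta> powr (- (1 / (p - 1)))"
    proof -
      have "4 * N / (n * \<delta>) = (4 * N / n) * (1 / \<delta>)" by simp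
      moreover have "(1 / \<delta>) powr (1 / (p - 1)) = \<delta> powr (- (1 / (p - 1)))"
        using \<delta>(1) by (simp add: powr_divide powr_minus_divide)
      ultimately show ?thesis by (simp only: \<gamma>_def powr_mult)
    qed
    moreover have "(K * \<delta>) powr (q / l) = K powr (q / l) * \<delta> powr (q / l)" by (simp add: powr_mult)
    moreover have "\<delta> powr (- (1 / (p - 1))) * \<delta> powr (q / l) = \<delta> powr e"
      by (simp add: powr_add[symmetric] e_def)
    ultimately have "\<gamma> * (p - 1) / p * (K * \<delta>) powr (q / l) = C * \<delta> powr e"
      by (simp add: C_def mult.assoc mult.left_commute)
    then show "\<gamma> * (p - 1) / p * (K * \<delta>) powr (p / (p - 1) / l) \<le> N" using \<delta>(3) by (simp add: q_def)
  qed
qed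

theorem proposition7p1:
  fixes p l K :: real
    and \<Theta> :: "((real^'n) \<times> real) set"
  assumes "1 < p" and "p < 2"
    and "0 < l" and "l < p"
    and "K > 1"
    and "\<Theta> = {(x, t). -1 < t \<and> t < 0 \<and> norm x powr l < K * (- t)}"
  shows "regular_point p \<Theta> (0, 0)"
proof -
  note p = assms(1,2) and l = assms(3,4) and K = assms(5)
  define q where "q = p / (p - 1)"
  have q: "2 < q" using p by (simp add: q_def field_simps)
  define \<beta> where "\<beta> = (p - 1) / p"
  have \<beta>: "0 < \<beta>" using p by (simp add: \<beta>_def)
  let ?n = "real CARD('n)"
  have \<Theta>_iff: "(x, t) \<in> \<Theta> \<longleftrightarrow> -1 < t \<and> t < 0 \<and> norm x powr l < K * (- t)" for x t
    by (simp add: assms(6))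

  \<comment> \<open>Topology and size of the domain\<close>
  have cl_powr: "continuous_on UNIV (\<lambda>z::(real^'n) \<times> real. norm (fst z) powr l)"
    using l by (intro continuous_on_powr' continuous_intros) auto
  have o\<Theta>: "open \<Theta>"
  proof -
    have "\<Theta> = {z. -1 < snd z} \<inter> {z. snd z < 0} \<inter> {z. norm (fst z) powr l < K * (- snd z)}"
      by (intro set_eqI) (simp add: assms(6) case_prod_beta)
    moreover have "open \<dots>"
      by (intro open_Int open_Collect_less continuous_intros cl_powr)
    ultimately show ?thesis by simp
  qed
  have closure_\<Theta>: "-1 \<le> t \<and> t \<le> 0 \<and> norm x powr l \<le> K * (- t)" if "(x, t) \<in> closure \<Theta>" for x t
  proof -
    let ?C = "{z. -1 \<le> snd z} \<inter> {z. snd z \<le> 0} \<inter> {z. norm (fst z) powr l \<le> K * (- snd z)} :: ((real^'n) \<times> real) set"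
    have "closed ?C" by (intro closed_Int closed_Collect_le continuous_intros cl_powr)
    moreover have "\<Theta> \<subseteq> ?C"
    proof
      fix z assume "z \<in> \<Theta>"
      then show "z \<in> ?C" by (cases z) (simp add: \<Theta>_iff less_imp_le)
    qed
    ultimately have "closure \<Theta> \<subseteq> ?C" by (intro closure_minimal)
    from subsetD[OF this that] show ?thesis by simp
  qed
  have norm_le: "norm x \<le> (K * s) powr (1 / l)" if "(x, t) \<in> closure \<Theta>" "- t \<le> s" for x t s
  proof -
    have "norm x powr l \<le> K * s"
      using closure_\<Theta>[OF that(1)] mult_left_mono[OF that(2), of K] K by linarith
    then have "(norm x powr l) powr (1 / l) \<le> (K * s) powr (1 / l)"
      using l by (intro powr_mono2) auto
    then show ?thesis using l by (simp add: powr_powr)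
  qed
  have b\<Theta>: "bounded \<Theta>"
  proof -
    have "norm z \<le> K powr (1 / l) + 1" if "z \<in> \<Theta>" for z
    proof -
      obtain x t where z: "z = (x, t)" by force
      have cl: "(x, t) \<in> closure \<Theta>" using that z closure_subset by auto
      have "norm x \<le> K powr (1 / l)" using norm_le[OF cl, of 1] closure_\<Theta>[OF cl] by simp
      moreover have "\<bar>t\<bar> \<le> 1" using closure_\<Theta>[OF cl] by auto
      ultimately show ?thesis using norm_Pair_le[of x t] by (simp add: z)
    qed
    then show ?thesis unfolding bounded_iff by blast
  qed
  have origin: "(0, 0) \<in> frontier \<Theta>"
  proof -
    have "(0, 0) \<in> closure \<Theta>"
      unfolding closure_approachable
    proof (intro allI impI)
      fix e :: real assume e: "0 < e"
      define t where "t = - min (e / 2) (1 / 2)"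
      have t: "-1 < t" "t < 0" "\<bar>t\<bar> < e" using e by (auto simp: t_def)
      have "((0, t) :: (real^'n) \<times> real) \<in> \<Theta>" using t K by (simp add: \<Theta>_iff mult_pos_neg)
      moreover have "dist ((0, t) :: (real^'n) \<times> real) (0, 0) < e" using t by (simp add: dist_Pair_Pair)
      ultimately show "\<exists>y\<in>\<Theta>. dist y (0, 0) < e" by blast
    qed
    moreover have "(0, 0) \<notin> \<Theta>" by (simp add: \<Theta>_iff)
    ultimately show ?thesis using o\<Theta> by (simp add: frontier_def interior_open)
  qed
  have fr_cl: "frontier \<Theta> \<subseteq> closure \<Theta>" by (auto simp: frontier_def)
  \<comment> \<open>A bound for \<open>|x|^q\<close> on the closure of \<open>\<Theta>\<close>, from
    \<open>|x|^l \<le> K\<close>.\<close>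
  define Rq where "Rq = (K powr (1 / l)) powr q"
  have Rq: "norm x powr q \<le> Rq" if "(x, t) \<in> closure \<Theta>" for x t
    unfolding Rq_def using norm_le[OF that, of 1] closure_\<Theta>[OF that] q by (intro powr_mono2) auto
  have \<beta>Rq: "0 \<le> \<beta> * Rq" using \<beta> by (simp add: Rq_def)
  have "(upper_Perron p \<Theta> f \<longlongrightarrow> ereal (f (0, 0))) (at (0, 0) within \<Theta>)" if f: "continuous_on (frontier \<Theta>) f" for f
  proof -
    let ?f0 = "f (0, 0)" and ?F = "at (0, 0) within \<Theta>"
    have "compact (f ` frontier \<Theta>)"
      using f b\<Theta> by (intro compact_continuous_image) (auto simp: compact_frontier_bounded)
    from compact_imp_bounded[OF this] obtain Bf where Bf: "\<And>\<xi>. \<xi> \<in> frontier \<Theta> \<Longrightarrow> \<bar>f \<xi>\<bar> \<le> Bf"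
      unfolding bounded_iff by auto
    \<comment> \<open>\<open>2 * Bf\<close> covers the oscillation of the boundary data.
      \<open>\<beta> * Rq\<close> is the further loss in the lower bound
      \<open>- Bf - \<beta> * Rq\<close> valid for all members of the upper class.\<close>
    define M where "M = 2 * Bf + \<beta> * Rq"
    have Bf0: "\<bar>?f0\<bar> \<le> Bf" by (rule Bf[OF origin])
    have M0: "0 \<le> M" unfolding M_def using Bf0 \<beta>Rq by linarith
    define N where "N = M + 1"
    have near: "\<forall>\<^sub>F \<xi> in ?F. ereal (?f0 - 2 * \<epsilon>) \<le> upper_Perron p \<Theta> f \<xi> \<and> upper_Perron p \<Theta> f \<xi> \<le> ereal (?f0 + 2 * \<epsilon>)"
      if \<epsilon>: "0 < \<epsilon>" for \<epsilon>
    proof -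
      obtain r where r: "0 < r" "\<And>\<xi>. \<xi> \<in> frontier \<Theta> \<Longrightarrow> norm \<xi> < r \<Longrightarrow> \<bar>f \<xi> - ?f0\<bar> < \<epsilon>"
      proof -
        obtain d where "d > 0" "\<And>\<xi>. \<xi> \<in> frontier \<Theta> \<Longrightarrow> dist \<xi> (0, 0) < d \<Longrightarrow> dist (f \<xi>) ?f0 < \<epsilon>"
          using f origin \<epsilon> unfolding continuous_on_iff by metis
        then show ?thesis using that[of d] by (simp add: dist_norm zero_prod_def[symmetric])
      qed
      have pos: "0 < K" "0 < N" "0 < ?n" using K M0 by (auto simp: N_def)
      obtain \<delta> \<gamma> where \<delta>: "0 < \<delta>" "\<delta> < 1" "(K * \<delta>) powr (1 / l) + \<delta> < r" "0 < \<gamma>"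
        "?n * \<gamma> powr (p - 1) = 4 * N / \<delta>" "\<gamma> * (p - 1) / p * (K * \<delta>) powr (p / (p - 1) / l) \<le> N"
        using barrier_parameters[OF p(1) l pos r(1)] by metis
      \<comment> \<open>With \<open>n \<gamma>^(p-1) = 2 * k\<close>, the coefficient
        \<open>\<gamma>\<close> belongs to an exact solution of slope \<open>2 * k\<close> and to a
        strict subsolution of slope \<open>k\<close>.\<close>
      define k where "k = 2 * N / \<delta>"
      have k: "0 < k" "?n * \<gamma> powr (p - 1) = 2 * k" "k * \<delta> = 2 * N" using \<delta> pos by (auto simp: k_def)
      have small: "norm \<xi> < r" if "\<xi> \<in> closure \<Theta>" "- \<delta> \<le> snd \<xi>" for \<xi>
      proof -
        obtain x t where xt: "\<xi> = (x, t)" by force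
        have "norm x \<le> (K * \<delta>) powr (1 / l)" using norm_le[of x t \<delta>] that by (simp add: xt)
        moreover have "\<bar>t\<bar> \<le> \<delta>" using closure_\<Theta>[of x t] that by (auto simp: xt)
        ultimately show ?thesis using norm_Pair_le[of x t] \<delta>(3) by (simp add: xt)
      qed
      \<comment> \<open>The estimate at time \<open>- \<delta>\<close> scales down to the origin:
        \<open>|x|^q\<close> is controlled by \<open>(- t) powr (q / l)\<close> with
        \<open>q / l \<ge> 1\<close>, and since \<open>- t / \<delta> \<le> 1\<close> this decays at
        least linearly. Only \<open>k / 2\<close> of the slope is spent.\<close>
      have barrier: "\<gamma> * \<beta> * norm x powr q \<le> k / 2 * (- t)" if xt: "(x, t) \<in> closure \<Theta>" "- \<delta> \<le> t" for x t
      proof (cases "t = 0")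
        case True
        then have "norm x = 0" using closure_\<Theta>[OF xt(1)] by simp
        then show ?thesis using True by simp
      next
        case False
        then have t: "0 < - t" "- t \<le> \<delta>" using closure_\<Theta>[OF xt(1)] xt(2) by auto
        have "norm x powr q \<le> ((K * (- t)) powr (1 / l)) powr q"
          using norm_le[OF xt(1) order_refl] q by (intro powr_mono2) auto
        also have "\<dots> = (K * \<delta> * (- t / \<delta>)) powr (q / l)" using \<delta>(1) by (simp add: powr_powr)
        also have "\<dots> = (K * \<delta>) powr (q / l) * (- t / \<delta>) powr (q / l)" by (rule powr_mult)
        also have "\<dots> \<le> (K * \<delta>) powr (q / l) * (- t / \<delta>)"
        proof (rule mult_left_mono)
          have "1 \<le> q / l" using q p l by (simp add: field_simps)
          then have "(- t / \<delta>) powr (q / l) \<le> (- t / \<delta>) powr 1"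
            using t \<delta>(1) by (intro powr_mono') (auto simp: field_simps)
          then show "(- t / \<delta>) powr (q / l) \<le> - t / \<delta>" using t \<delta>(1) by simp
        qed simp
        finally have "\<gamma> * \<beta> * norm x powr q \<le> \<gamma> * \<beta> * ((K * \<delta>) powr (q / l) * (- t / \<delta>))"
          using \<delta>(4) \<beta> by (intro mult_left_mono) auto
        also have "\<dots> = (\<gamma> * \<beta> * (K * \<delta>) powr (q / l)) * (- t / \<delta>)" by simp
        also have "\<dots> \<le> N * (- t / \<delta>)"
        proof (rule mult_right_mono)
          show "\<gamma> * \<beta> * (K * \<delta>) powr (q / l) \<le> N" using \<delta>(6) by (simp add: \<beta>_def q_def)
          show "0 \<le> - t / \<delta>" using t \<delta>(1) by (intro divide_nonneg_pos) auto
        qed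
        also have "\<dots> = k / 2 * (- t)" using \<delta>(1) by (simp add: k_def)
        finally show ?thesis .
      qed

      \<comment> \<open>Bound from above by a member of the upper class\<close>
      define w where "w = power_solution p (- \<gamma>) (0 :: real^'n) (?f0 + \<epsilon>)"
      have \<gamma>p: "\<gamma> powr (p - 2) * \<gamma> = \<gamma> powr (p - 1)"
        using \<delta>(4) powr_mult_base[of \<gamma> "p - 2"] by (simp add: mult.commute)
      have w: "w (x, t) = 2 * k * (- t) - \<gamma> * \<beta> * norm x powr q + (?f0 + \<epsilon>)" for x t
        using \<gamma>p k(2) \<delta>(4) by (simp add: w_def power_solution_def q_def \<beta>_def)
      have w_ge: "w (x, t) \<ge> 3 / 2 * k * (- t) + (?f0 + \<epsilon>)" if "(x, t) \<in> closure \<Theta>" "- \<delta> \<le> t" for x t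
        using barrier[OF that] unfolding w by (simp add: algebra_simps)
      have wpar: "p_parabolic p S w" for S unfolding w_def by (rule power_solution_p_parabolic[OF p])
      define N' where "N' = ?f0 + \<epsilon> + M"
      define U where "U \<xi> = (if - \<delta> < snd \<xi> then min (w \<xi>) N' else N')" for \<xi>
      have U_ge: "?f0 + \<epsilon> \<le> U \<xi>" if \<xi>: "\<xi> \<in> \<Theta>" for \<xi>
      proof -
        obtain x t where xt: "\<xi> = (x, t)" by force
        have cl: "(x, t) \<in> closure \<Theta>" and t: "t < 0"
          using \<xi> closure_subset[of \<Theta>] by (auto simp: xt \<Theta>_iff)
        have "0 \<le> 3 / 2 * k * (- t)" using k(1) t by (intro mult_nonneg_nonneg) auto
        then have "?f0 + \<epsilon> \<le> w (x, t)" if "- \<delta> < t" using w_ge[OF cl] that by linarith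
        then show ?thesis using M0 by (auto simp: U_def xt N'_def)
      qed
      have "p_superparabolic p \<Theta> (\<lambda>\<xi>. ereal (U \<xi>))"
        unfolding U_def
      proof (rule p_superparabolic_truncation[OF p o\<Theta> wpar])
        \<comment> \<open>The gluing layer ends at \<open>- \<delta> / 2\<close>: up to there
          \<open>w\<close> still exceeds \<open>f\<close> at the origin plus
          \<open>\<epsilon>\<close> by at least \<open>3 / 2 * N\<close>, which is more than
          \<open>M\<close>.\<close>
        show "- \<delta> < - \<delta> / 2" using \<delta>(1) by simp
        fix \<xi> assume \<xi>: "\<xi> \<in> \<Theta>" "- \<delta> \<le> snd \<xi>" "snd \<xi> \<le> - \<delta> / 2"
        obtain x t where xt: "\<xi> = (x, t)" by force
        have "(x, t) \<in> closure \<Theta>" using \<xi>(1) closure_subset[of \<Theta>] by (auto simp: xt)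
        then have "3 / 2 * k * (- t) + (?f0 + \<epsilon>) \<le> w (x, t)" using \<xi>(2) by (intro w_ge) (auto simp: xt)
        moreover have "3 / 2 * k * (\<delta> / 2) \<le> 3 / 2 * k * (- t)"
          using \<xi>(3) k(1) by (intro mult_left_mono) (auto simp: xt)
        moreover have "3 / 2 * k * (\<delta> / 2) = 3 / 2 * N" using k(3) by simp
        ultimately show "N' \<le> w \<xi>" using M0 by (simp add: xt N'_def N_def)
      qed
      moreover have "ereal (f \<xi>) \<le> Liminf (at \<xi> within \<Theta>) (\<lambda>\<xi>. ereal (U \<xi>))" if \<xi>: "\<xi> \<in> frontier \<Theta>" for \<xi>
      proof (rule Liminf_bounded)
        show "\<forall>\<^sub>F \<zeta> in at \<xi> within \<Theta>. ereal (f \<xi>) \<le> ereal (U \<zeta>)"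
        \<comment> \<open>Frontier points after \<open>- \<delta>\<close> lie within
          \<open>r\<close> of the origin, where the data are below the floor of \<open>U\<close>;
          near all earlier ones \<open>U\<close> is the constant \<open>N'\<close>, which exceeds
          all data.\<close>
        proof (cases "- \<delta> \<le> snd \<xi>")
          case True
          have "\<xi> \<in> closure \<Theta>" using \<xi> fr_cl by blast
          then have "f \<xi> \<le> ?f0 + \<epsilon>" using r(2)[OF \<xi> small[OF _ True]] by auto
          then show ?thesis
            unfolding eventually_at_filter by (intro always_eventually) (auto intro: order_trans[OF _ U_ge])
        next
          case False
          have "\<forall>\<^sub>F \<zeta> in nhds \<xi>. snd \<zeta> < - \<delta>"
          proof -
            have "open {\<zeta> :: (real^'n) \<times> real. snd \<zeta> < - \<delta>}" by (intro open_Collect_less continuous_intros)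
            then show ?thesis using eventually_nhds_in_open[of "{\<zeta>. snd \<zeta> < - \<delta>}" \<xi>] False by simp
          qed
          moreover have "f \<xi> \<le> N'"
            unfolding N'_def M_def using Bf[OF \<xi>] Bf0 \<epsilon> \<beta>Rq by linarith
          ultimately show ?thesis
            unfolding eventually_at_filter by (auto elim!: eventually_mono simp: U_def)
        qed
      qed
      ultimately have "(\<lambda>\<xi>. ereal (U \<xi>)) \<in> upper_class p \<Theta> f"
        using U_ge unfolding upper_class_def by (auto intro!: exI[of _ "?f0 + \<epsilon>"])
      then have upper: "upper_Perron p \<Theta> f \<xi> \<le> ereal (U \<xi>)" for \<xi>
        unfolding upper_Perron_def by (rule INF_lower)

      \<comment> \<open>Bound from below for every member of the upper class\<close>
      define v where "v z = k * snd z + \<gamma> * (p - 1) / p * norm (fst z) powr (p / (p - 1)) + (?f0 - \<epsilon>)" for z :: "(real^'n) \<times> real"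
      have v_le: "v (x, t) \<le> ?f0 - \<epsilon> + k / 2 * t" if "(x, t) \<in> closure \<Theta>" "- \<delta> \<le> t" for x t
      proof -
        have "v (x, t) = k * t + \<gamma> * \<beta> * norm x powr q + (?f0 - \<epsilon>)" by (simp add: v_def q_def \<beta>_def)
        moreover have "k * t + k / 2 * (- t) = k / 2 * t" by (simp add: field_simps)
        ultimately show ?thesis using barrier[OF that] by linarith
      qed
      have lower: "ereal (v \<xi>) \<le> upper_Perron p \<Theta> f \<xi>" if \<xi>: "\<xi> \<in> \<Theta>" "- \<delta> \<le> snd \<xi>" for \<xi>
        unfolding upper_Perron_def
      proof (rule INF_greatest)
        fix u assume "u \<in> upper_class p \<Theta> f"
        then obtain m where u: "p_superparabolic p \<Theta> u" and m: "\<And>\<xi>. \<xi> \<in> \<Theta> \<Longrightarrow> ereal m \<le> u \<xi>"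
          and Lf: "\<And>\<xi>. \<xi> \<in> frontier \<Theta> \<Longrightarrow> ereal (f \<xi>) \<le> Liminf (at \<xi> within \<Theta>) u"
          unfolding upper_class_def by blast
        \<comment> \<open>The bound \<open>m\<close> depends on \<open>u\<close>; this one does not.
          It compares \<open>u\<close> with the stationary strict subsolution with
          \<open>\<gamma> = 1\<close> and slope 0, starting at time -2, before the domain begins, so
          that the frontier alone matters.\<close>
        have u_low: "ereal (- Bf - \<beta> * Rq) \<le> u \<zeta>" if \<zeta>: "\<zeta> \<in> \<Theta>" for \<zeta>
        proof -
          define v0 where "v0 z = 0 * snd z + 1 * (p - 1) / p * norm (fst z) powr (p / (p - 1)) + (- Bf - \<beta> * Rq)" for z :: "(real^'n) \<times> real"
          have v0_le: "v0 z \<le> - Bf" if "z \<in> closure \<Theta>" for z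
            using mult_left_mono[OF Rq[of "fst z" "snd z"], of \<beta>] that \<beta> by (simp add: v0_def \<beta>_def q_def)
          have "ereal (v0 \<zeta>) \<le> u \<zeta>"
          proof (rule superparabolic_ge_subsolution[where ?T0.0 = "-2" and k = 0 and \<gamma> = 1, OF p o\<Theta> b\<Theta> u m])
            show "v0 (x, t) = 0 * t + 1 * (p - 1) / p * norm x powr (p / (p - 1)) + (- Bf - \<beta> * Rq)" for x t
              by (simp add: v0_def)
            show "ereal (v0 z) \<le> Liminf (at z within \<Theta>) u" if z: "z \<in> frontier \<Theta>" for z
            proof (rule order_trans[OF _ Lf[OF z]])
              show "ereal (v0 z) \<le> ereal (f z)" using v0_le[of z] Bf[OF z] z fr_cl by auto
            qed
            show "ereal (v0 z) \<le> u z" if "z \<in> \<Theta>" "snd z = -2" for z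
              using that by (cases z) (auto simp: \<Theta>_iff)
            show "-2 \<le> snd \<zeta>" using \<zeta> by (cases \<zeta>) (auto simp: \<Theta>_iff)
          qed (use \<zeta> in auto)
          moreover have "- Bf - \<beta> * Rq \<le> v0 \<zeta>" using p by (simp add: v0_def)
          ultimately show ?thesis by (meson ereal_less_eq(3) order_trans)
        qed
        show "ereal (v \<xi>) \<le> u \<xi>"
        proof (rule superparabolic_ge_subsolution[where ?T0.0 = "- \<delta>" and k = k and \<gamma> = \<gamma>, OF p o\<Theta> b\<Theta> u m])
          show "v (x, t) = k * t + \<gamma> * (p - 1) / p * norm x powr (p / (p - 1)) + (?f0 - \<epsilon>)" for x t
            by (simp add: v_def)
          show "0 < \<gamma>" "0 \<le> k" "k < ?n * \<gamma> powr (p - 1)" using \<delta>(4) k by auto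
          show "ereal (v z) \<le> Liminf (at z within \<Theta>) u" if z: "z \<in> frontier \<Theta>" "- \<delta> \<le> snd z" for z
          proof (rule order_trans[OF _ Lf[OF z(1)]])
            obtain x t where xt: "z = (x, t)" by force
            have cl: "z \<in> closure \<Theta>" using z fr_cl by blast
            have "k / 2 * t \<le> 0" using closure_\<Theta>[of x t] cl k(1) by (simp add: xt mult_nonneg_nonpos)
            then have "v z \<le> ?f0 - \<epsilon>" using v_le[of x t] cl z(2) by (simp add: xt)
            moreover have "?f0 - \<epsilon> \<le> f z" using r(2)[OF z(1) small[OF cl z(2)]] by linarith
            ultimately show "ereal (v z) \<le> ereal (f z)" by simp
          qed
          show "ereal (v z) \<le> u z" if z: "z \<in> \<Theta>" "snd z = - \<delta>" for z
          \<comment> \<open>At time \<open>- \<delta>\<close> the subsolution has dropped by at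
            least \<open>N\<close>, which was sized to bring it under the common lower
            bound.\<close>
          proof (rule order_trans[OF _ u_low[OF z(1)]])
            obtain x t where xt: "z = (x, t)" by force
            have "v z \<le> ?f0 - \<epsilon> + k / 2 * t"
              using v_le[of x t] z closure_subset[of \<Theta>] by (auto simp: xt)
            also have "k / 2 * t = - N" using z(2) k(3) by (simp add: xt)
            finally show "ereal (v z) \<le> ereal (- Bf - \<beta> * Rq)" using Bf0 \<epsilon> by (simp add: N_def M_def)
          qed
        qed (use \<xi> in auto)
      qed

      \<comment> \<open>Both bounds near the origin\<close>
      have cw: "continuous_on UNIV w" using wpar[of UNIV] by (simp add: p_parabolic_def)
      have cv: "continuous_on UNIV v"
        unfolding v_def using p by (intro continuous_intros continuous_on_powr') auto
      have "\<forall>\<^sub>F \<xi> in nhds ((0, 0) :: (real^'n) \<times> real). snd \<xi> > - \<delta>"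
      proof -
        have "open {\<xi> :: (real^'n) \<times> real. - \<delta> < snd \<xi>}" by (intro open_Collect_less continuous_intros)
        then show ?thesis
          using eventually_nhds_in_open[of "{\<xi>. - \<delta> < snd \<xi>}" "((0, 0) :: (real^'n) \<times> real)"] \<delta>(1) by simp
      qed
      moreover have "\<forall>\<^sub>F \<xi> in nhds (0, 0). w \<xi> < ?f0 + 2 * \<epsilon>"
      proof -
        have "open {\<xi>. w \<xi> < ?f0 + 2 * \<epsilon>}" by (intro open_Collect_less cw continuous_intros)
        moreover have "w (0, 0) < ?f0 + 2 * \<epsilon>" using q \<epsilon> by (simp add: w)
        ultimately show ?thesis using eventually_nhds_in_open[of "{\<xi>. w \<xi> < ?f0 + 2 * \<epsilon>}" "(0, 0)"] by simp
      qed
      moreover have "\<forall>\<^sub>F \<xi> in nhds (0, 0). ?f0 - 2 * \<epsilon> < v \<xi>"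
      proof -
        have "open {\<xi>. ?f0 - 2 * \<epsilon> < v \<xi>}" by (intro open_Collect_less cv continuous_intros)
        moreover have "?f0 - 2 * \<epsilon> < v (0, 0)" using p \<epsilon> by (simp add: v_def)
        ultimately show ?thesis using eventually_nhds_in_open[of "{\<xi>. ?f0 - 2 * \<epsilon> < v \<xi>}" "(0, 0)"] by simp
      qed
      ultimately show ?thesis
        unfolding eventually_at_filter
      proof eventually_elim
        case (elim \<xi>)
        show ?case
        proof (intro impI conjI)
          assume \<xi>: "\<xi> \<in> \<Theta>"
          have "ereal (?f0 - 2 * \<epsilon>) \<le> ereal (v \<xi>)" using elim by simp
          then show "ereal (?f0 - 2 * \<epsilon>) \<le> upper_Perron p \<Theta> f \<xi>"
            using lower[OF \<xi>] elim by (meson less_imp_le order_trans)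
          have "U \<xi> \<le> ?f0 + 2 * \<epsilon>" using elim unfolding U_def by auto
          then have "ereal (U \<xi>) \<le> ereal (?f0 + 2 * \<epsilon>)" by simp
          then show "upper_Perron p \<Theta> f \<xi> \<le> ereal (?f0 + 2 * \<epsilon>)" using upper[of \<xi>] by (rule order_trans[rotated])
        qed
      qed
    qed
    show ?thesis
    proof (rule order_tendstoI)
      fix a assume "a < ereal ?f0"
      then obtain b where b: "a < ereal b" "ereal b < ereal ?f0" using ereal_dense2 by blast
      have e: "?f0 - 2 * ((?f0 - b) / 2) = b" by (simp add: field_simps)
      have "0 < (?f0 - b) / 2" using b by simp
      from near[OF this] show "\<forall>\<^sub>F \<xi> in ?F. a < upper_Perron p \<Theta> f \<xi>"
        unfolding e by eventually_elim (use b(1) less_le_trans in blast)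
    next
      fix a assume "ereal ?f0 < a"
      then obtain b where b: "ereal ?f0 < ereal b" "ereal b < a" using ereal_dense2 by blast
      have e: "?f0 + 2 * ((b - ?f0) / 2) = b" by (simp add: field_simps)
      have "0 < (b - ?f0) / 2" using b by simp
      from near[OF this] show "\<forall>\<^sub>F \<xi> in ?F. upper_Perron p \<Theta> f \<xi> < a"
        unfolding e by eventually_elim (use b(2) le_less_trans in blast)
    qed
  qed
  then show ?thesis using origin by (simp add: regular_point_def)
qed

end
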